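(* Let $\mathscr{G}=(I,O,\lambda)$ be a synchronous game. Given a $\mathrm{C}^*$-algebra $\mathsf{B}$ and $\Psi\in\mathrm{Mor}(\mathbb{C}^O,\mathbb{C}^I\otimes\mathsf{B})$ such that \[ (\delta_x\otimes\delta_y\otimes\mathrm{id})\bigl(\Psi(e_a)_{13}\Psi(e_b)_{23}\bigr)=\lambda(a,b,x,y)\,(\delta_x\otimes\delta_y\otimes\mathrm{id})\bigl(\Psi(e_a)_{13}\Psi(e_b)_{23}\bigr) \] for all $x,y\in I$ and $a,b\in O$, there exists a unique $\Theta\in\mathrm{Mor}(\mathsf{A}(\mathscr{G}),\mathsf{B})$ such that $\Psi=(\mathrm{id}\otimes\Theta)\circ\Phi_{\mathscr{G}}$.
   Context: Morphisms: for $\mathrm{C}^*$-algebras $\mathsf{A},\mathsf{C}$, $\mathrm{Mor}(\mathsf{A},\mathsf{C})$ is the set of $*$-homomorphisms $\Phi:\mathsf{A}\to\mathrm{M}(\mathsf{C})$ into the multiplier algebra that are non-degenerate, i.e. $\Phi(\mathsf{A})\mathsf{C}$ is dense in $\mathsf{C}$. If $\mathsf{A}$ is unital these are exactly the unital $*$-homomorphisms $\mathsf{A}\to\mathrm{M}(\mathsf{C})$. Morphisms are composed using their canonical extensions $\mathrm{M}(\mathsf{A})\to\mathrm{M}(\mathsf{C})$. A projection is an element $p$ with $p^*p=p$. A synchronous game $\mathscr{G}=(I,O,\lambda)$ consists of finite sets $I$ (inputs), $O$ (outputs) and a function $\lambda:O\times O\times I\times I\to\{0,1\}$ with $\lambda(a,b,x,x)=\delta_{a,b}$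 for all $x\in I$, $a,b\in O$. Its $\mathrm{C}^*$-algebra $\mathsf{A}(\mathscr{G})$ is the universal unital $\mathrm{C}^*$-algebra generated by projections $\{p_{x,a}\}_{x\in I,a\in O}$ satisfying $\sum_{a\in O}p_{x,a}=\mathbf{1}$ for all $x\in I$ and $p_{x,a}p_{y,b}=\lambda(a,b,x,y)\,p_{x,a}p_{y,b}$ for all $x,y\in I$, $a,b\in O$. $\mathbb{C}^I$ and $\mathbb{C}^O$ are the algebras of all complex functions on $I$ and $O$, with standard bases $\{e_x\}_{x\in I}$ and $\{e_a\}_{a\in O}$; $\delta_x$ denotes evaluation at $x\in I$ on $\mathbb{C}^I$. The morphism $\Phi_{\mathscr{G}}\in\mathrm{Mor}(\mathbb{C}^O,\mathbb{C}^I\otimes\mathsf{A}(\mathscr{G}))$ is given by $\Phi_{\mathscr{G}}(e_a)=\sum_{x\in I}e_x\otimes p_{x,a}$, $a\in O$. Leg-numbering notation: for $T\in\mathrm{M}(\mathbb{C}^I\otimes\mathsf{B})$, the elements $T_{13},T_{23}\in\mathrm{M}(\mathbb{C}^I\otimes\mathbb{C}^I\otimes\mathsf{B})$ are the images of $T$ under the maps determined by $v\otimes b\mapsto v\otimes\mathbf{1}\otimes b$ and $v\otimes b\mapsto\mathbf{1}\otimes v\otimes b$ respectively. *)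

theory Defs
  imports
    "HOL-Analysis.Analysis"
    "HOL-Algebra.Module"
    "HOL-Library.Poly_Mapping"
begin

section \<open>C*-algebras\<close>

text \<open>
  C*-algebras are not assumed to be unital.  The field \<open>one\<close>, inherited from the ring records of
  HOL-Algebra, carries no meaning unless the algebra has a unit.
\<close>

record 'a cstar = "(complex, 'a) module" +
  star :: "'a \<Rightarrow> 'a"
  nrm :: "'a \<Rightarrow> real"

text \<open>
  The locale \<open>Metric_space\<close> asks for symmetry and nonnegativity on the whole type, so the
  distance is set to 0 off the carrier.
\<close>

definition cdist :: "('a, 'm) cstar_scheme \<Rightarrow> 'a \<Rightarrow> 'a \<Rightarrow> real" where
  "cdist A x y = (if x \<in> carrier A \<and> y \<in> carrier A then nrm A (x \<ominus>\<^bsub>A\<^esub> y) else 0)"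

locale cstar_algebra = abelian_group A for A :: "('a, 'm) cstar_scheme" (structure) +
  assumes mult_closed: "\<lbrakk>x \<in> carrier A; y \<in> carrier A\<rbrakk> \<Longrightarrow> x \<otimes> y \<in> carrier A"
    and mult_assoc: "\<lbrakk>x \<in> carrier A; y \<in> carrier A; z \<in> carrier A\<rbrakk> \<Longrightarrow> (x \<otimes> y) \<otimes> z = x \<otimes> (y \<otimes> z)"
    and mult_add_left: "\<lbrakk>x \<in> carrier A; y \<in> carrier A; z \<in> carrier A\<rbrakk> \<Longrightarrow> (x \<oplus> y) \<otimes> z = x \<otimes> z \<oplus> y \<otimes> z"
    and mult_add_right: "\<lbrakk>x \<in> carrier A; y \<in> carrier A; z \<in> carrier A\<rbrakk> \<Longrightarrow> x \<otimes> (y \<oplus> z) = x \<otimes> y \<oplus> x \<otimes> z"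
    and scale_closed: "x \<in> carrier A \<Longrightarrow> c \<odot> x \<in> carrier A"
    and scale_add_left: "x \<in> carrier A \<Longrightarrow> (c + d) \<odot> x = c \<odot> x \<oplus> d \<odot> x"
    and scale_add_right: "\<lbrakk>x \<in> carrier A; y \<in> carrier A\<rbrakk> \<Longrightarrow> c \<odot> (x \<oplus> y) = c \<odot> x \<oplus> c \<odot> y"
    and scale_scale: "x \<in> carrier A \<Longrightarrow> (c * d) \<odot> x = c \<odot> (d \<odot> x)"
    and scale_one: "x \<in> carrier A \<Longrightarrow> 1 \<odot> x = x"
    and scale_mult_left: "\<lbrakk>x \<in> carrier A; y \<in> carrier A\<rbrakk> \<Longrightarrow> (c \<odot> x) \<otimes> y = c \<odot> (x \<otimes> y)"
    and scale_mult_right: "\<lbrakk>x \<in> carrier A; y \<in> carrier A\<rbrakk> \<Longrightarrow> x \<otimes> (c \<odot> y) = c \<odot> (x \<otimes> y)"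
    and star_closed: "x \<in> carrier A \<Longrightarrow> star A x \<in> carrier A"
    and star_star: "x \<in> carrier A \<Longrightarrow> star A (star A x) = x"
    and star_add: "\<lbrakk>x \<in> carrier A; y \<in> carrier A\<rbrakk> \<Longrightarrow> star A (x \<oplus> y) = star A x \<oplus> star A y"
    and star_scale: "x \<in> carrier A \<Longrightarrow> star A (c \<odot> x) = cnj c \<odot> star A x"
    and star_mult: "\<lbrakk>x \<in> carrier A; y \<in> carrier A\<rbrakk> \<Longrightarrow> star A (x \<otimes> y) = star A y \<otimes> star A x"
    and nrm_nonneg: "x \<in> carrier A \<Longrightarrow> 0 \<le> nrm A x"
    and nrm_eq_zero_iff: "x \<in> carrier A \<Longrightarrow> nrm A x = 0 \<longleftrightarrow> x = \<zero>"
    and nrm_triangle: "\<lbrakk>x \<in> carrier A; y \<in> carrier A\<rbrakk> \<Longrightarrow> nrm A (x \<oplus> y) \<le> nrm A x + nrm A y"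
    and nrm_scale: "x \<in> carrier A \<Longrightarrow> nrm A (c \<odot> x) = cmod c * nrm A x"
    and nrm_mult: "\<lbrakk>x \<in> carrier A; y \<in> carrier A\<rbrakk> \<Longrightarrow> nrm A (x \<otimes> y) \<le> nrm A x * nrm A y"
    and cstar_identity: "x \<in> carrier A \<Longrightarrow> nrm A (star A x \<otimes> x) = (nrm A x)\<^sup>2"
    and complete: "Metric_space.mcomplete (carrier A) (cdist A)"

definition complex_cstar :: "complex cstar" where
  "complex_cstar = \<lparr>carrier = UNIV, mult = (*), one = 1, zero = 0, add = (+), smult = (*),
     star = cnj, nrm = cmod\<rparr>"

section \<open>Multipliers and morphisms\<close>

definition bounded_op :: "('a, 'm) cstar_scheme \<Rightarrow> ('a \<Rightarrow> 'a) \<Rightarrow> bool" where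
  "bounded_op C T \<longleftrightarrow> T \<in> carrier C \<rightarrow>\<^sub>E carrier C \<and>
     (\<forall>x\<in>carrier C. \<forall>y\<in>carrier C. T (x \<oplus>\<^bsub>C\<^esub> y) = T x \<oplus>\<^bsub>C\<^esub> T y) \<and>
     (\<forall>c. \<forall>x\<in>carrier C. T (c \<odot>\<^bsub>C\<^esub> x) = c \<odot>\<^bsub>C\<^esub> T x) \<and>
     (\<exists>K. \<forall>x\<in>carrier C. nrm C (T x) \<le> K * nrm C x)"

definition op_nrm :: "('a, 'm) cstar_scheme \<Rightarrow> ('a \<Rightarrow> 'a) \<Rightarrow> real" where
  "op_nrm C T = Sup {nrm C (T x) | x. x \<in> carrier C \<and> nrm C x \<le> 1}"

text \<open>
  The multiplier algebra is realised by double centralizers \<open>(L, R)\<close>, where \<open>L\<close> is left and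
  \<open>R\<close> is right multiplication by the multiplier.
\<close>

definition double_centralizer :: "('a, 'm) cstar_scheme \<Rightarrow> ('a \<Rightarrow> 'a) \<times> ('a \<Rightarrow> 'a) \<Rightarrow> bool" where
  "double_centralizer C m \<longleftrightarrow> (case m of (L, R) \<Rightarrow> bounded_op C L \<and> bounded_op C R \<and>
     (\<forall>x\<in>carrier C. \<forall>y\<in>carrier C.
        L (x \<otimes>\<^bsub>C\<^esub> y) = L x \<otimes>\<^bsub>C\<^esub> y \<and> R (x \<otimes>\<^bsub>C\<^esub> y) = x \<otimes>\<^bsub>C\<^esub> R y \<and> x \<otimes>\<^bsub>C\<^esub> L y = R x \<otimes>\<^bsub>C\<^esub> y))"

definition multiplier_alg ::
  "('a, 'm) cstar_scheme \<Rightarrow> (('a \<Rightarrow> 'a) \<times> ('a \<Rightarrow> 'a)) cstar" where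
  "multiplier_alg C =
    \<lparr>carrier = {m. double_centralizer C m},
     mult = (\<lambda>(L, R) (L', R'). (compose (carrier C) L L', compose (carrier C) R' R)),
     one = (\<lambda>x\<in>carrier C. x, \<lambda>x\<in>carrier C. x),
     zero = (\<lambda>x\<in>carrier C. \<zero>\<^bsub>C\<^esub>, \<lambda>x\<in>carrier C. \<zero>\<^bsub>C\<^esub>),
     add = (\<lambda>(L, R) (L', R'). (\<lambda>x\<in>carrier C. L x \<oplus>\<^bsub>C\<^esub> L' x, \<lambda>x\<in>carrier C. R x \<oplus>\<^bsub>C\<^esub> R' x)),
     smult = (\<lambda>c (L, R). (\<lambda>x\<in>carrier C. c \<odot>\<^bsub>C\<^esub> L x, \<lambda>x\<in>carrier C. c \<odot>\<^bsub>C\<^esub> R x)),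
     star = (\<lambda>(L, R). (\<lambda>x\<in>carrier C. star C (R (star C x)), \<lambda>x\<in>carrier C. star C (L (star C x)))),
     nrm = (\<lambda>(L, R). op_nrm C L)\<rparr>"

definition mult_embed :: "('a, 'm) cstar_scheme \<Rightarrow> 'a \<Rightarrow> ('a \<Rightarrow> 'a) \<times> ('a \<Rightarrow> 'a)" where
  "mult_embed C a = (\<lambda>x\<in>carrier C. a \<otimes>\<^bsub>C\<^esub> x, \<lambda>x\<in>carrier C. x \<otimes>\<^bsub>C\<^esub> a)"

text \<open>
  Homomorphisms are extensional functions, so that equality of morphisms is equality in HOL.
\<close>

definition star_hom :: "('a, 'm) cstar_scheme \<Rightarrow> ('b, 'n) cstar_scheme \<Rightarrow> ('a \<Rightarrow> 'b) set" where
  "star_hom A D = {\<Phi> \<in> carrier A \<rightarrow>\<^sub>E carrier D.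
     (\<forall>x\<in>carrier A. \<forall>y\<in>carrier A. \<Phi> (x \<oplus>\<^bsub>A\<^esub> y) = \<Phi> x \<oplus>\<^bsub>D\<^esub> \<Phi> y \<and> \<Phi> (x \<otimes>\<^bsub>A\<^esub> y) = \<Phi> x \<otimes>\<^bsub>D\<^esub> \<Phi> y) \<and>
     (\<forall>c. \<forall>x\<in>carrier A. \<Phi> (c \<odot>\<^bsub>A\<^esub> x) = c \<odot>\<^bsub>D\<^esub> \<Phi> x) \<and>
     (\<forall>x\<in>carrier A. \<Phi> (star A x) = star D (\<Phi> x))}"

definition Mor :: "('a, 'm) cstar_scheme \<Rightarrow> ('c, 'n) cstar_scheme \<Rightarrow>
    ('a \<Rightarrow> ('c \<Rightarrow> 'c) \<times> ('c \<Rightarrow> 'c)) set" where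
  "Mor A C = {\<Phi> \<in> star_hom A (multiplier_alg C).
     Metric_space.mtopology (carrier C) (cdist C)
       closure_of {fst (\<Phi> a) c | a c. a \<in> carrier A \<and> c \<in> carrier C} = carrier C}"

text \<open>
  The canonical extension of \<open>\<Phi> \<in> Mor(A, C)\<close> to \<open>M(A) \<rightarrow> M(C)\<close> sends \<open>m\<close> to the unique
  \<open>n \<in> M(C)\<close> with \<open>n \<Phi>(a) = \<Phi>(m a)\<close> for all \<open>a \<in> A\<close>; here \<open>m a = fst m a\<close>.
\<close>

definition mor_ext :: "('a, 'm) cstar_scheme \<Rightarrow> ('c, 'n) cstar_scheme \<Rightarrow>
    ('a \<Rightarrow> ('c \<Rightarrow> 'c) \<times> ('c \<Rightarrow> 'c)) \<Rightarrow> ('a \<Rightarrow> 'a) \<times> ('a \<Rightarrow> 'a) \<Rightarrow> ('c \<Rightarrow> 'c) \<times> ('c \<Rightarrow> 'c)" where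
  "mor_ext A C \<Phi> m = (THE n. n \<in> carrier (multiplier_alg C) \<and>
     (\<forall>a\<in>carrier A. n \<otimes>\<^bsub>multiplier_alg C\<^esub> \<Phi> a = \<Phi> (fst m a)))"

text \<open>The composition \<open>\<Psi> \<circ> \<Phi>\<close> of \<open>\<Phi> \<in> Mor(A, C)\<close> and \<open>\<Psi> \<in> Mor(C, D)\<close>.\<close>

definition mor_comp :: "('a, 'm) cstar_scheme \<Rightarrow> ('c, 'n) cstar_scheme \<Rightarrow> ('d, 'k) cstar_scheme \<Rightarrow>
    ('c \<Rightarrow> ('d \<Rightarrow> 'd) \<times> ('d \<Rightarrow> 'd)) \<Rightarrow> ('a \<Rightarrow> ('c \<Rightarrow> 'c) \<times> ('c \<Rightarrow> 'c)) \<Rightarrow>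
    'a \<Rightarrow> ('d \<Rightarrow> 'd) \<times> ('d \<Rightarrow> 'd)" where
  "mor_comp A C D \<Psi> \<Phi> = (\<lambda>a\<in>carrier A. mor_ext C D \<Psi> (\<Phi> a))"

text \<open>A non-degenerate *-homomorphism \<open>A \<rightarrow> C\<close> viewed as an element of \<open>Mor(A, C)\<close>.\<close>

definition mor_of :: "('a, 'm) cstar_scheme \<Rightarrow> ('c, 'n) cstar_scheme \<Rightarrow> ('a \<Rightarrow> 'c) \<Rightarrow>
    'a \<Rightarrow> ('c \<Rightarrow> 'c) \<times> ('c \<Rightarrow> 'c)" where
  "mor_of A C f = (\<lambda>a\<in>carrier A. mult_embed C (f a))"

section \<open>Tensor products with finite-dimensional commutative algebras\<close>

text \<open>
  For a finite set \<open>X\<close>, the C*-tensor product of the algebra of all complex functions on \<open>X\<close> with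
  \<open>B\<close> is the algebra of all \<open>B\<close>-valued functions on \<open>X\<close> with pointwise operations and the
  supremum norm; \<open>v \<otimes> b\<close> is the function \<open>x \<mapsto> v(x) b\<close>.  The element 0 is inserted to make the
  norm meaningful for empty \<open>X\<close>.
\<close>

definition fun_tensor :: "'x set \<Rightarrow> ('b, 'm) cstar_scheme \<Rightarrow> ('x \<Rightarrow> 'b) cstar" where
  "fun_tensor X B =
    \<lparr>carrier = X \<rightarrow>\<^sub>E carrier B,
     mult = (\<lambda>f g. \<lambda>x\<in>X. f x \<otimes>\<^bsub>B\<^esub> g x),
     one = (\<lambda>x\<in>X. \<one>\<^bsub>B\<^esub>),
     zero = (\<lambda>x\<in>X. \<zero>\<^bsub>B\<^esub>),
     add = (\<lambda>f g. \<lambda>x\<in>X. f x \<oplus>\<^bsub>B\<^esub> g x),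
     smult = (\<lambda>c f. \<lambda>x\<in>X. c \<odot>\<^bsub>B\<^esub> f x),
     star = (\<lambda>f. \<lambda>x\<in>X. star B (f x)),
     nrm = (\<lambda>f. Max (insert 0 ((\<lambda>x. nrm B (f x)) ` X)))\<rparr>"

definition fun_alg :: "'x set \<Rightarrow> ('x \<Rightarrow> complex) cstar" where
  "fun_alg X = fun_tensor X complex_cstar"

definition unit_vec :: "'x set \<Rightarrow> 'x \<Rightarrow> 'x \<Rightarrow> complex" where
  "unit_vec X x = (\<lambda>y\<in>X. if y = x then 1 else 0)"

definition tens :: "'x set \<Rightarrow> ('b, 'm) cstar_scheme \<Rightarrow> ('x \<Rightarrow> complex) \<Rightarrow> 'b \<Rightarrow> 'x \<Rightarrow> 'b" where
  "tens X B v b = (\<lambda>x\<in>X. v x \<odot>\<^bsub>B\<^esub> b)"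

text \<open>
  \<open>id \<otimes> \<Theta>\<close> for \<open>\<Theta> \<in> Mor(A, B)\<close>.  A family \<open>(m x)\<close> of multipliers of \<open>B\<close> acts on
  \<open>B\<close>-valued functions pointwise; \<open>v \<otimes> a\<close> is sent to the multiplier given by the family
  \<open>v(x) \<Theta>(a)\<close>, which is \<open>v \<otimes> \<Theta>(a)\<close>.
\<close>

definition id_tensor :: "'x set \<Rightarrow> ('a, 'm) cstar_scheme \<Rightarrow> ('b, 'n) cstar_scheme \<Rightarrow>
    ('a \<Rightarrow> ('b \<Rightarrow> 'b) \<times> ('b \<Rightarrow> 'b)) \<Rightarrow>
    ('x \<Rightarrow> 'a) \<Rightarrow> (('x \<Rightarrow> 'b) \<Rightarrow> 'x \<Rightarrow> 'b) \<times> (('x \<Rightarrow> 'b) \<Rightarrow> 'x \<Rightarrow> 'b)" where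
  "id_tensor X A B \<Theta> = (\<lambda>f\<in>carrier (fun_tensor X A).
     (\<lambda>g\<in>carrier (fun_tensor X B). \<lambda>x\<in>X. fst (\<Theta> (f x)) (g x),
      \<lambda>g\<in>carrier (fun_tensor X B). \<lambda>x\<in>X. snd (\<Theta> (f x)) (g x)))"

text \<open>
  The maps \<open>v \<otimes> b \<mapsto> v \<otimes> 1 \<otimes> b\<close> and \<open>v \<otimes> b \<mapsto> 1 \<otimes> v \<otimes> b\<close> and their canonical extensions to
  multipliers; see the lemmas below.
\<close>

definition incl13 :: "'x set \<Rightarrow> ('x \<Rightarrow> 'b) \<Rightarrow> 'x \<Rightarrow> 'x \<Rightarrow> 'b" where
  "incl13 X f = (\<lambda>x\<in>X. \<lambda>y\<in>X. f x)"

definition incl23 :: "'x set \<Rightarrow> ('x \<Rightarrow> 'b) \<Rightarrow> 'x \<Rightarrow> 'x \<Rightarrow> 'b" where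
  "incl23 X f = (\<lambda>x\<in>X. \<lambda>y\<in>X. f y)"

lemma incl13_tens:
  "incl13 X (tens X B v b) = tens X (fun_tensor X B) v (tens X B (\<one>\<^bsub>fun_alg X\<^esub>) b)"
  if "cstar_algebra B" "b \<in> carrier B"
proof -
  interpret cstar_algebra B by fact
  show ?thesis
    using that(2)
    by (auto simp: incl13_def tens_def fun_tensor_def fun_alg_def complex_cstar_def scale_one
        intro!: restrict_ext)
qed

lemma incl23_tens:
  "incl23 X (tens X B v b) = tens X (fun_tensor X B) (\<one>\<^bsub>fun_alg X\<^esub>) (tens X B v b)"
  if "cstar_algebra B" "b \<in> carrier B"
proof -
  interpret cstar_algebra B by fact
  show ?thesis
    using that(2)
    by (auto simp: incl23_def tens_def fun_tensor_def fun_alg_def complex_cstar_def scale_one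
        scale_closed intro!: restrict_ext)
qed

definition leg13 :: "'x set \<Rightarrow> ('b, 'm) cstar_scheme \<Rightarrow>
    (('x \<Rightarrow> 'b) \<Rightarrow> 'x \<Rightarrow> 'b) \<times> (('x \<Rightarrow> 'b) \<Rightarrow> 'x \<Rightarrow> 'b) \<Rightarrow>
    (('x \<Rightarrow> 'x \<Rightarrow> 'b) \<Rightarrow> 'x \<Rightarrow> 'x \<Rightarrow> 'b) \<times> (('x \<Rightarrow> 'x \<Rightarrow> 'b) \<Rightarrow> 'x \<Rightarrow> 'x \<Rightarrow> 'b)" where
  "leg13 X B = (let C = fun_tensor X B; D = fun_tensor X C in
     mor_ext C D (mor_of C D (incl13 X)))"

definition leg23 :: "'x set \<Rightarrow> ('b, 'm) cstar_scheme \<Rightarrow>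
    (('x \<Rightarrow> 'b) \<Rightarrow> 'x \<Rightarrow> 'b) \<times> (('x \<Rightarrow> 'b) \<Rightarrow> 'x \<Rightarrow> 'b) \<Rightarrow>
    (('x \<Rightarrow> 'x \<Rightarrow> 'b) \<Rightarrow> 'x \<Rightarrow> 'x \<Rightarrow> 'b) \<times> (('x \<Rightarrow> 'x \<Rightarrow> 'b) \<Rightarrow> 'x \<Rightarrow> 'x \<Rightarrow> 'b)" where
  "leg23 X B = (let C = fun_tensor X B; D = fun_tensor X C in
     mor_ext C D (mor_of C D (incl23 X)))"

text \<open>\<open>\<delta>\<^sub>x \<otimes> \<delta>\<^sub>y \<otimes> id\<close>, extended to multipliers\<close>

definition eval2 :: "'x set \<Rightarrow> ('b, 'm) cstar_scheme \<Rightarrow> 'x \<Rightarrow> 'x \<Rightarrow>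
    (('x \<Rightarrow> 'x \<Rightarrow> 'b) \<Rightarrow> 'x \<Rightarrow> 'x \<Rightarrow> 'b) \<times> (('x \<Rightarrow> 'x \<Rightarrow> 'b) \<Rightarrow> 'x \<Rightarrow> 'x \<Rightarrow> 'b) \<Rightarrow>
    ('b \<Rightarrow> 'b) \<times> ('b \<Rightarrow> 'b)" where
  "eval2 X B x y = (let D = fun_tensor X (fun_tensor X B) in
     mor_ext D B (mor_of D B (\<lambda>F. F x y)))"

section \<open>Universal unital C*-algebras\<close>

text \<open>
  The free unital *-algebra on a set of generators is the complex monoid algebra of the free monoid
  of words in the letters \<open>g\<close> and \<open>g*\<close>; the Boolean component of a letter marks the adjoint.
\<close>

datatype 'g word = Word (letters: "('g \<times> bool) list")

instantiation word :: (type) monoid_add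
begin
definition zero_word :: "'g word" where "zero_word = Word []"
definition plus_word :: "'g word \<Rightarrow> 'g word \<Rightarrow> 'g word" where
  "plus_word u v = Word (letters u @ letters v)"
instance by standard (auto simp: zero_word_def plus_word_def)
end

definition word_star :: "'g word \<Rightarrow> 'g word" where
  "word_star w = Word (rev (map (\<lambda>(g, s). (g, \<not> s)) (letters w)))"

type_synonym 'g star_poly = "'g word \<Rightarrow>\<^sub>0 complex"

definition sp_gen :: "'g \<Rightarrow> 'g star_poly" where
  "sp_gen g = Poly_Mapping.single (Word [(g, False)]) 1"

definition sp_scale :: "complex \<Rightarrow> 'g star_poly \<Rightarrow> 'g star_poly" where
  "sp_scale c f = Poly_Mapping.single 0 c * f"

definition sp_star :: "'g star_poly \<Rightarrow> 'g star_poly" where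
  "sp_star f = (\<Sum>w\<in>Poly_Mapping.keys f.
     Poly_Mapping.single (word_star w) (cnj (Poly_Mapping.lookup f w)))"

definition star_polys :: "'g set \<Rightarrow> 'g star_poly set" where
  "star_polys X = {f. \<forall>w\<in>Poly_Mapping.keys f. fst ` set (letters w) \<subseteq> X}"

text \<open>
  The C*-seminorms on the free unital *-algebra on \<open>X\<close> vanishing on the relators \<open>R\<close> are exactly
  the functions \<open>f \<mapsto> \<parallel>\<pi>(f)\<parallel>\<close> for unital *-homomorphisms \<open>\<pi>\<close> into unital C*-algebras with
  \<open>\<pi>(r) = 0\<close> for \<open>r \<in> R\<close>.  The universal C*-algebra is the Hausdorff completion of the free
  *-algebra in the largest such seminorm (the generators have to be bounded for it to exist, which
  is automatic for projections).  Its elements are equivalence classes of Cauchy sequences.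
\<close>

definition cstar_seminorm :: "'g set \<Rightarrow> 'g star_poly set \<Rightarrow> ('g star_poly \<Rightarrow> real) \<Rightarrow> bool" where
  "cstar_seminorm X R q \<longleftrightarrow>
     (\<forall>f\<in>star_polys X. 0 \<le> q f \<and> q (sp_star f * f) = (q f)\<^sup>2 \<and> (\<forall>c. q (sp_scale c f) = cmod c * q f)) \<and>
     (\<forall>f\<in>star_polys X. \<forall>g\<in>star_polys X. q (f + g) \<le> q f + q g \<and> q (f * g) \<le> q f * q g) \<and>
     (\<forall>r\<in>R. q r = 0)"

definition univ_nrm :: "'g set \<Rightarrow> 'g star_poly set \<Rightarrow> 'g star_poly \<Rightarrow> real" where
  "univ_nrm X R f = Sup {q f | q. cstar_seminorm X R q}"

definition univ_cauchy :: "'g set \<Rightarrow> 'g star_poly set \<Rightarrow> (nat \<Rightarrow> 'g star_poly) set" where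
  "univ_cauchy X R = {s. range s \<subseteq> star_polys X \<and>
     (\<forall>e>0. \<exists>N. \<forall>m\<ge>N. \<forall>n\<ge>N. univ_nrm X R (s m - s n) < e)}"

definition univ_class :: "'g set \<Rightarrow> 'g star_poly set \<Rightarrow> (nat \<Rightarrow> 'g star_poly) \<Rightarrow>
    (nat \<Rightarrow> 'g star_poly) set" where
  "univ_class X R s = {t \<in> univ_cauchy X R. (\<lambda>n. univ_nrm X R (s n - t n)) \<longlonglongrightarrow> 0}"

definition univ_rep :: "(nat \<Rightarrow> 'g star_poly) set \<Rightarrow> nat \<Rightarrow> 'g star_poly" where
  "univ_rep S = (SOME s. s \<in> S)"

definition univ_cstar :: "'g set \<Rightarrow> 'g star_poly set \<Rightarrow> (nat \<Rightarrow> 'g star_poly) set cstar" where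
  "univ_cstar X R =
    \<lparr>carrier = univ_class X R ` univ_cauchy X R,
     mult = (\<lambda>S T. univ_class X R (\<lambda>n. univ_rep S n * univ_rep T n)),
     one = univ_class X R (\<lambda>_. 1),
     zero = univ_class X R (\<lambda>_. 0),
     add = (\<lambda>S T. univ_class X R (\<lambda>n. univ_rep S n + univ_rep T n)),
     smult = (\<lambda>c S. univ_class X R (\<lambda>n. sp_scale c (univ_rep S n))),
     star = (\<lambda>S. univ_class X R (\<lambda>n. sp_star (univ_rep S n))),
     nrm = (\<lambda>S. lim (\<lambda>n. univ_nrm X R (univ_rep S n)))\<rparr>"

definition univ_gen :: "'g set \<Rightarrow> 'g star_poly set \<Rightarrow> 'g \<Rightarrow> (nat \<Rightarrow> 'g star_poly) set" where
  "univ_gen X R g = univ_class X R (\<lambda>_. sp_gen g)"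

section \<open>Synchronous games\<close>

definition synchronous_game :: "'i set \<Rightarrow> 'o set \<Rightarrow> ('o \<Rightarrow> 'o \<Rightarrow> 'i \<Rightarrow> 'i \<Rightarrow> nat) \<Rightarrow> bool" where
  "synchronous_game I Out lam \<longleftrightarrow> finite I \<and> finite Out \<and>
     (\<forall>a\<in>Out. \<forall>b\<in>Out. \<forall>x\<in>I. \<forall>y\<in>I. lam a b x y \<in> {0, 1}) \<and>
     (\<forall>a\<in>Out. \<forall>b\<in>Out. \<forall>x\<in>I. lam a b x x = (if a = b then 1 else 0))"

definition game_relators :: "'i set \<Rightarrow> 'o set \<Rightarrow> ('o \<Rightarrow> 'o \<Rightarrow> 'i \<Rightarrow> 'i \<Rightarrow> nat) \<Rightarrow>
    ('i \<times> 'o) star_poly set" where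
  "game_relators I Out lam = (let p = (\<lambda>x a. sp_gen (x, a)) in
     {sp_star (p x a) * p x a - p x a | x a. x \<in> I \<and> a \<in> Out} \<union>
     {(\<Sum>a\<in>Out. p x a) - 1 | x. x \<in> I} \<union>
     {p x a * p y b - sp_scale (of_nat (lam a b x y)) (p x a * p y b) | x y a b.
        x \<in> I \<and> y \<in> I \<and> a \<in> Out \<and> b \<in> Out})"

definition game_cstar :: "'i set \<Rightarrow> 'o set \<Rightarrow> ('o \<Rightarrow> 'o \<Rightarrow> 'i \<Rightarrow> 'i \<Rightarrow> nat) \<Rightarrow>
    (nat \<Rightarrow> ('i \<times> 'o) star_poly) set cstar" where
  "game_cstar I Out lam = univ_cstar (I \<times> Out) (game_relators I Out lam)"

definition game_proj :: "'i set \<Rightarrow> 'o set \<Rightarrow> ('o \<Rightarrow> 'o \<Rightarrow> 'i \<Rightarrow> 'i \<Rightarrow> nat) \<Rightarrow>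
    'i \<Rightarrow> 'o \<Rightarrow> (nat \<Rightarrow> ('i \<times> 'o) star_poly) set" where
  "game_proj I Out lam x a = univ_gen (I \<times> Out) (game_relators I Out lam) (x, a)"

text \<open>The linear map given by \<open>e\<^sub>a \<mapsto> \<Sum>\<^sub>x e\<^sub>x \<otimes> p\<^sub>x\<^sub>a\<close>, as a morphism.\<close>

definition game_mor :: "'i set \<Rightarrow> 'o set \<Rightarrow> ('o \<Rightarrow> 'o \<Rightarrow> 'i \<Rightarrow> 'i \<Rightarrow> nat) \<Rightarrow>
    ('o \<Rightarrow> complex) \<Rightarrow>
    (('i \<Rightarrow> (nat \<Rightarrow> ('i \<times> 'o) star_poly) set) \<Rightarrow> 'i \<Rightarrow> (nat \<Rightarrow> ('i \<times> 'o) star_poly) set) \<times>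
    (('i \<Rightarrow> (nat \<Rightarrow> ('i \<times> 'o) star_poly) set) \<Rightarrow> 'i \<Rightarrow> (nat \<Rightarrow> ('i \<times> 'o) star_poly) set)" where
  "game_mor I Out lam = (let A = game_cstar I Out lam; C = fun_tensor I A in
     mor_of (fun_alg Out) C
       (\<lambda>v. \<Oplus>\<^bsub>C\<^esub>a\<in>Out. v a \<odot>\<^bsub>C\<^esub> (\<Oplus>\<^bsub>C\<^esub>x\<in>I. tens I A (unit_vec I x) (game_proj I Out lam x a))))"

end

theory Submission
  imports Defs
begin

text \<open>
  Evaluating \<open>\<Psi>\<close> at a point \<open>x \<in> I\<close> gives a *-homomorphism \<open>h x\<close> from the functions on \<open>Out\<close> to \<open>M(B)\<close>,
  hence elements \<open>P x a = h x (e\<^sub>a)\<close> of \<open>M(B)\<close>. They are projections because \<open>e\<^sub>a\<close> is one, they sum to 1 over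
  \<open>a\<close> because \<open>\<Psi>\<close> is non-degenerate and therefore unital, and the condition on \<open>\<Psi>\<close> says precisely that
  \<open>P x a P y b = \<lambda>(a,b,x,y) P x a P y b\<close>. So \<open>P\<close> satisfies the relations that define the algebra of the
  game, and the universal property gives a unital *-homomorphism \<open>\<Theta>\<close> with \<open>\<Theta> (p x a) = P x a\<close>.
  Conversely, \<open>\<Psi> = (id \<otimes> \<Theta>) \<circ> \<Phi>\<close> holds if and only if \<open>\<Theta> (p x a) = P x a\<close> for all \<open>x\<close> and \<open>a\<close>, and a
  unital *-homomorphism is determined by its values on the generators.

  Four bodies of facts carry this argument.

  \<^item> The multipliers of a C*-algebra form a unital C*-algebra (\<open>cstar_algebra_multiplier\<close>,
    \<open>unital_multiplier\<close>), and the functions from a finite set to a C*-algebra form a C*-algebra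
    (\<open>cstar_algebra_fun_tensor\<close>).

  \<^item> A multiplier of an algebra of functions on a finite set acts pointwise, so that it is a family of
    multipliers (\<open>multiplier_pointwise\<close>, \<open>family_fibre\<close>). This makes the legs explicit:
    \<open>\<Psi>(e\<^sub>a)\<^sub>1\<^sub>3 \<Psi>(e\<^sub>b)\<^sub>2\<^sub>3\<close> evaluated at \<open>(x, y)\<close> is the product \<open>P x a P y b\<close> (\<open>eval2_legs\<close>).

  \<^item> The completion of the free *-algebra in the largest C*-seminorm is a C*-algebra with the expected
    universal property (\<open>cstar_algebra_A\<close>, \<open>universal_property\<close>). For a game that seminorm is finite,
    since a C*-seminorm is at most 1 on a projection.

  \<^item> Homomorphisms are purely algebraic here, so uniqueness on the completion needs automatic continuity.
    A *-homomorphism from a unital C*-algebra is contractive (\<open>star_hom_contractive\<close>): a selfadjoint \<open>h\<close>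
    with \<open>\<parallel>h\<parallel> < 1\<close> is the real part of the unitary \<open>h + i (1 - h\<^sup>2)\<^sup>1\<^sup>/\<^sup>2\<close>, and a unitary has an image of norm
    at most 1. This replaces the comparison of spectral radii.
\<close>

section \<open>Norms and limits of sequences\<close>

text \<open>
  The axioms of a C*-algebra apart from completeness. Each C*-algebra below is first shown to be one of
  these; completeness is then stated and proved in terms of sequences (\<open>cstar_algebraI\<close>).
\<close>

locale pre_cstar_algebra = abelian_group A for A :: "('a, 'm) cstar_scheme" (structure) +
  assumes mult_closed: "\<lbrakk>x \<in> carrier A; y \<in> carrier A\<rbrakk> \<Longrightarrow> x \<otimes> y \<in> carrier A"
    and mult_assoc: "\<lbrakk>x \<in> carrier A; y \<in> carrier A; z \<in> carrier A\<rbrakk> \<Longrightarrow> (x \<otimes> y) \<otimes> z = x \<otimes> (y \<otimes> z)"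
    and mult_add_left: "\<lbrakk>x \<in> carrier A; y \<in> carrier A; z \<in> carrier A\<rbrakk> \<Longrightarrow> (x \<oplus> y) \<otimes> z = x \<otimes> z \<oplus> y \<otimes> z"
    and mult_add_right: "\<lbrakk>x \<in> carrier A; y \<in> carrier A; z \<in> carrier A\<rbrakk> \<Longrightarrow> x \<otimes> (y \<oplus> z) = x \<otimes> y \<oplus> x \<otimes> z"
    and scale_closed: "x \<in> carrier A \<Longrightarrow> c \<odot> x \<in> carrier A"
    and scale_add_left: "x \<in> carrier A \<Longrightarrow> (c + d) \<odot> x = c \<odot> x \<oplus> d \<odot> x"
    and scale_add_right: "\<lbrakk>x \<in> carrier A; y \<in> carrier A\<rbrakk> \<Longrightarrow> c \<odot> (x \<oplus> y) = c \<odot> x \<oplus> c \<odot> y"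
    and scale_scale: "x \<in> carrier A \<Longrightarrow> (c * d) \<odot> x = c \<odot> (d \<odot> x)"
    and scale_one: "x \<in> carrier A \<Longrightarrow> 1 \<odot> x = x"
    and scale_mult_left: "\<lbrakk>x \<in> carrier A; y \<in> carrier A\<rbrakk> \<Longrightarrow> (c \<odot> x) \<otimes> y = c \<odot> (x \<otimes> y)"
    and scale_mult_right: "\<lbrakk>x \<in> carrier A; y \<in> carrier A\<rbrakk> \<Longrightarrow> x \<otimes> (c \<odot> y) = c \<odot> (x \<otimes> y)"
    and star_closed: "x \<in> carrier A \<Longrightarrow> star A x \<in> carrier A"
    and star_star: "x \<in> carrier A \<Longrightarrow> star A (star A x) = x"
    and star_add: "\<lbrakk>x \<in> carrier A; y \<in> carrier A\<rbrakk> \<Longrightarrow> star A (x \<oplus> y) = star A x \<oplus> star A y"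
    and star_scale: "x \<in> carrier A \<Longrightarrow> star A (c \<odot> x) = cnj c \<odot> star A x"
    and star_mult: "\<lbrakk>x \<in> carrier A; y \<in> carrier A\<rbrakk> \<Longrightarrow> star A (x \<otimes> y) = star A y \<otimes> star A x"
    and nrm_nonneg: "x \<in> carrier A \<Longrightarrow> 0 \<le> nrm A x"
    and nrm_eq_zero_iff: "x \<in> carrier A \<Longrightarrow> nrm A x = 0 \<longleftrightarrow> x = \<zero>"
    and nrm_triangle: "\<lbrakk>x \<in> carrier A; y \<in> carrier A\<rbrakk> \<Longrightarrow> nrm A (x \<oplus> y) \<le> nrm A x + nrm A y"
    and nrm_scale: "x \<in> carrier A \<Longrightarrow> nrm A (c \<odot> x) = cmod c * nrm A x"
    and nrm_mult: "\<lbrakk>x \<in> carrier A; y \<in> carrier A\<rbrakk> \<Longrightarrow> nrm A (x \<otimes> y) \<le> nrm A x * nrm A y"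
    and cstar_identity: "x \<in> carrier A \<Longrightarrow> nrm A (star A x \<otimes> x) = (nrm A x)\<^sup>2"

sublocale cstar_algebra \<subseteq> pre_cstar_algebra
  by unfold_locales
    (fact mult_closed mult_assoc mult_add_left mult_add_right scale_closed scale_add_left
      scale_add_right scale_scale scale_one scale_mult_left scale_mult_right star_closed star_star
      star_add star_scale star_mult nrm_nonneg nrm_eq_zero_iff nrm_triangle nrm_scale nrm_mult
      cstar_identity)+

definition tends :: "('a, 'm) cstar_scheme \<Rightarrow> (nat \<Rightarrow> 'a) \<Rightarrow> 'a \<Rightarrow> bool" where
  "tends A s l \<longleftrightarrow> l \<in> carrier A \<and> range s \<subseteq> carrier A \<and> (\<lambda>n. nrm A (s n \<ominus>\<^bsub>A\<^esub> l)) \<longlonglongrightarrow> 0"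

definition cauchy :: "('a, 'm) cstar_scheme \<Rightarrow> (nat \<Rightarrow> 'a) \<Rightarrow> bool" where
  "cauchy A s \<longleftrightarrow> range s \<subseteq> carrier A \<and>
     (\<forall>e>0. \<exists>N. \<forall>m\<ge>N. \<forall>n\<ge>N. nrm A (s m \<ominus>\<^bsub>A\<^esub> s n) < e)"

lemma le_of_square_le_mult:
  fixes a b :: real
  assumes "a\<^sup>2 \<le> b * a" "0 \<le> a" "0 \<le> b"
  shows "a \<le> b"
  using assms by (cases "a = 0") (simp_all add: power2_eq_square)

text \<open>
  A one-sided bound for all scalars suffices for homogeneity, since \<open>c\<close> can be undone by its inverse. It is
  applied with \<open>a\<close> the norm of a vector and \<open>b\<close> the norm of its multiple by \<open>c\<close>.
\<close>

lemma homogeneousI: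
  fixes a b :: real and c :: complex
  assumes "b \<le> cmod c * a" "0 \<le> b" and inverse: "c \<noteq> 0 \<Longrightarrow> a \<le> cmod (inverse c) * b"
  shows "b = cmod c * a"
proof (cases "c = 0")
  case False
  have "cmod c * a \<le> cmod c * (cmod (inverse c) * b)"
    using inverse[OF False] by (rule mult_left_mono) simp
  also have "\<dots> = b"
    using False by (simp add: norm_inverse)
  finally show ?thesis
    using assms(1) by linarith
qed (use assms in simp)

context pre_cstar_algebra
begin

lemmas closed [simp] = mult_closed scale_closed star_closed

lemma scale_zero_left [simp]: "x \<in> carrier A \<Longrightarrow> 0 \<odot> x = \<zero>"
  using nrm_eq_zero_iff[of "0 \<odot> x"] nrm_scale[of x 0] by simp

lemma nrm_zero [simp]: "nrm A \<zero> = 0"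
  by (simp add: nrm_eq_zero_iff)

lemma scale_zero_right [simp]: "c \<odot> \<zero> = \<zero>"
  using nrm_eq_zero_iff[of "c \<odot> \<zero>"] nrm_scale[of \<zero> c] by simp

lemma minus_eq_scale: "x \<in> carrier A \<Longrightarrow> \<ominus> x = (-1) \<odot> x"
  using scale_add_left[of x "-1" 1] by (intro minus_equality) (simp_all add: scale_one)

lemma nrm_minus [simp]: "x \<in> carrier A \<Longrightarrow> nrm A (\<ominus> x) = nrm A x"
  by (simp add: minus_eq_scale nrm_scale)

lemma mult_zero_left [simp]: "x \<in> carrier A \<Longrightarrow> \<zero> \<otimes> x = \<zero>"
  by (metis scale_mult_left scale_zero_left mult_closed zero_closed)

lemma mult_zero_right [simp]: "x \<in> carrier A \<Longrightarrow> x \<otimes> \<zero> = \<zero>"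
  by (metis scale_mult_right scale_zero_left mult_closed zero_closed)

lemma star_zero [simp]: "star A \<zero> = \<zero>"
  by (metis star_scale scale_zero_left complex_cnj_zero star_closed zero_closed)

lemma mult_minus_left: "\<lbrakk>x \<in> carrier A; y \<in> carrier A\<rbrakk> \<Longrightarrow> (\<ominus> x) \<otimes> y = \<ominus> (x \<otimes> y)"
  by (simp add: minus_eq_scale scale_mult_left)

lemma mult_minus_right: "\<lbrakk>x \<in> carrier A; y \<in> carrier A\<rbrakk> \<Longrightarrow> x \<otimes> (\<ominus> y) = \<ominus> (x \<otimes> y)"
  by (simp add: minus_eq_scale scale_mult_right)

lemma scale_minus_right: "x \<in> carrier A \<Longrightarrow> c \<odot> (\<ominus> x) = \<ominus> (c \<odot> x)"
  by (simp add: minus_eq_scale flip: scale_scale)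

lemma star_minus: "x \<in> carrier A \<Longrightarrow> star A (\<ominus> x) = \<ominus> (star A x)"
  by (simp add: minus_eq_scale star_scale)

lemma diff_self [simp]: "x \<in> carrier A \<Longrightarrow> x \<ominus> x = \<zero>"
  by (simp add: a_minus_def r_neg)

lemma diff_eq_zero_iff: "\<lbrakk>x \<in> carrier A; y \<in> carrier A\<rbrakk> \<Longrightarrow> x \<ominus> y = \<zero> \<longleftrightarrow> x = y"
  by (metis a_minus_def a_inv_closed add.inv_equality minus_minus r_neg)

lemma mult_diff_left: "\<lbrakk>x \<in> carrier A; y \<in> carrier A; z \<in> carrier A\<rbrakk> \<Longrightarrow> (x \<ominus> y) \<otimes> z = x \<otimes> z \<ominus> y \<otimes> z"
  by (simp add: a_minus_def mult_add_left mult_minus_left)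

lemma mult_diff_right: "\<lbrakk>x \<in> carrier A; y \<in> carrier A; z \<in> carrier A\<rbrakk> \<Longrightarrow> x \<otimes> (y \<ominus> z) = x \<otimes> y \<ominus> x \<otimes> z"
  by (simp add: a_minus_def mult_add_right mult_minus_right)

lemma scale_diff: "\<lbrakk>x \<in> carrier A; y \<in> carrier A\<rbrakk> \<Longrightarrow> c \<odot> (x \<ominus> y) = c \<odot> x \<ominus> c \<odot> y"
  by (simp add: a_minus_def scale_add_right scale_minus_right)

lemma star_diff: "\<lbrakk>x \<in> carrier A; y \<in> carrier A\<rbrakk> \<Longrightarrow> star A (x \<ominus> y) = star A x \<ominus> star A y"
  by (simp add: a_minus_def star_add star_minus)

lemma diff_diff_telescope:
  "\<lbrakk>x \<in> carrier A; y \<in> carrier A; z \<in> carrier A\<rbrakk> \<Longrightarrow> x \<ominus> z = (x \<ominus> y) \<oplus> (y \<ominus> z)"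
  by (simp add: a_minus_def a_assoc) (simp add: a_assoc[symmetric] l_neg)

lemma nrm_diff_commute: "\<lbrakk>x \<in> carrier A; y \<in> carrier A\<rbrakk> \<Longrightarrow> nrm A (x \<ominus> y) = nrm A (y \<ominus> x)"
  using nrm_minus[of "x \<ominus> y"] by (simp add: a_minus_def minus_add a_comm)

lemma nrm_diff_triangle:
  "\<lbrakk>x \<in> carrier A; y \<in> carrier A; z \<in> carrier A\<rbrakk> \<Longrightarrow> nrm A (x \<ominus> z) \<le> nrm A (x \<ominus> y) + nrm A (y \<ominus> z)"
  by (metis diff_diff_telescope minus_closed nrm_triangle)

lemma nrm_reverse_triangle:
  assumes "x \<in> carrier A" "y \<in> carrier A"
  shows "\<bar>nrm A x - nrm A y\<bar> \<le> nrm A (x \<ominus> y)"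
  using nrm_diff_triangle[of x y \<zero>] nrm_diff_triangle[of y x \<zero>] nrm_diff_commute[of x y] assms
  by (simp add: a_minus_def minus_eq_scale[of \<zero>])

lemma nrm_star [simp]: "x \<in> carrier A \<Longrightarrow> nrm A (star A x) = nrm A x"
proof -
  have le: "nrm A x \<le> nrm A (star A x)" if x: "x \<in> carrier A" for x
    by (rule le_of_square_le_mult)
      (use nrm_mult[of "star A x" x] x in \<open>simp_all add: cstar_identity nrm_nonneg\<close>)
  show "nrm A (star A x) = nrm A x" if "x \<in> carrier A"
    using le[of x] le[of "star A x"] that by (simp add: star_star)
qed

text \<open>
  Testing against \<open>z = y\<^sup>*\<close> turns a vanishing product into a vanishing norm. In an algebra without unit
  this does the work of an approximate unit: equalities are checked after multiplication.
\<close>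

lemma left_faithful:
  assumes "y \<in> carrier A" "\<And>z. z \<in> carrier A \<Longrightarrow> z \<otimes> y = \<zero>"
  shows "y = \<zero>"
  using cstar_identity[of y] assms nrm_eq_zero_iff[of y] by simp

lemma right_faithful:
  assumes "y \<in> carrier A" "\<And>z. z \<in> carrier A \<Longrightarrow> y \<otimes> z = \<zero>"
  shows "y = \<zero>"
proof -
  have "star A y = \<zero>"
    by (rule left_faithful) (use assms star_mult[of y "star A _"] in \<open>simp_all add: star_star[symmetric]\<close>,
      metis star_star star_mult star_zero star_closed)
  then show ?thesis
    using assms(1) star_star star_zero by metis
qed

lemma metric: "Metric_space (carrier A) (cdist A)"
proof
  fix x y z
  show "0 \<le> cdist A x y"
    by (simp add: cdist_def nrm_nonneg)
  show "cdist A x y = cdist A y x"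
    by (simp add: cdist_def nrm_diff_commute)
  assume "x \<in> carrier A" "y \<in> carrier A"
  then show "cdist A x y = 0 \<longleftrightarrow> x = y"
    by (simp add: cdist_def nrm_eq_zero_iff diff_eq_zero_iff)
  assume "z \<in> carrier A"
  with \<open>x \<in> carrier A\<close> \<open>y \<in> carrier A\<close> show "cdist A x z \<le> cdist A x y + cdist A y z"
    by (simp add: cdist_def nrm_diff_triangle)
qed

lemma tends_iff:
  "tends A s l \<longleftrightarrow> l \<in> carrier A \<and> range s \<subseteq> carrier A \<and>
     (\<forall>e>0. \<exists>N. \<forall>n\<ge>N. nrm A (s n \<ominus> l) < e)"
proof -
  have "\<bar>nrm A (s n \<ominus> l)\<bar> = nrm A (s n \<ominus> l)" if "l \<in> carrier A" "range s \<subseteq> carrier A" for n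
    using that nrm_nonneg[of "s n \<ominus> l"] by (simp add: image_subset_iff)
  then show ?thesis
    by (auto simp: tends_def LIMSEQ_iff)
qed

lemma limitin_iff_tends:
  assumes "range s \<subseteq> carrier A"
  shows "limitin (Metric_space.mtopology (carrier A) (cdist A)) s l sequentially \<longleftrightarrow> tends A s l"
  using assms unfolding Metric_space.limit_metric_sequentially[OF metric] tends_iff
  by (auto simp: cdist_def image_subset_iff)

lemma MCauchy_iff_cauchy: "Metric_space.MCauchy (carrier A) (cdist A) s \<longleftrightarrow> cauchy A s"
proof (cases "range s \<subseteq> carrier A")
  case True
  then have "s n \<in> carrier A" for n
    by auto
  with True show ?thesis
    unfolding Metric_space.MCauchy_def[OF metric] cauchy_def by (auto simp: cdist_def)
qed (simp add: Metric_space.MCauchy_def[OF metric] cauchy_def)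

lemma mcomplete_iff:
  "Metric_space.mcomplete (carrier A) (cdist A) \<longleftrightarrow> (\<forall>s. cauchy A s \<longrightarrow> (\<exists>l. tends A s l))"
  unfolding Metric_space.mcomplete_def[OF metric] MCauchy_iff_cauchy
  by (metis cauchy_def limitin_iff_tends)

lemma cstar_algebraI:
  assumes "\<And>s. cauchy A s \<Longrightarrow> \<exists>l. tends A s l"
  shows "cstar_algebra A"
proof -
  have mcomplete: "Metric_space.mcomplete (carrier A) (cdist A)"
    using assms mcomplete_iff by blast
  show ?thesis
  by unfold_locales
    (fact mult_closed mult_assoc mult_add_left mult_add_right scale_closed scale_add_left
      scale_add_right scale_scale scale_one scale_mult_left scale_mult_right star_closed star_star
      star_add star_scale star_mult nrm_nonneg nrm_eq_zero_iff nrm_triangle nrm_scale nrm_mult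
      cstar_identity mcomplete)+
qed

lemma tends_closed: "tends A s l \<Longrightarrow> l \<in> carrier A" "tends A s l \<Longrightarrow> s n \<in> carrier A"
  by (auto simp: tends_def)

lemma tendsI:
  assumes "l \<in> carrier A" "\<And>n. s n \<in> carrier A" "\<And>n. nrm A (s n \<ominus> l) \<le> g n" "g \<longlonglongrightarrow> 0"
  shows "tends A s l"
  unfolding tends_def
proof (intro conjI)
  show "(\<lambda>n. nrm A (s n \<ominus> l)) \<longlonglongrightarrow> 0"
    by (rule tendsto_sandwich[OF _ _ tendsto_const assms(4)]) (use assms in \<open>auto simp: nrm_nonneg\<close>)
qed (use assms in auto)

lemma tends_lim: "tends A s l \<Longrightarrow> (\<lambda>n. nrm A (s n \<ominus> l)) \<longlonglongrightarrow> 0"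
  by (simp add: tends_def)

lemma tends_const: "l \<in> carrier A \<Longrightarrow> tends A (\<lambda>_. l) l"
  by (simp add: tends_def)

lemma tends_unique:
  assumes "tends A s l" "tends A s m"
  shows "l = m"
proof -
  have "(\<lambda>n. nrm A (s n \<ominus> l) + nrm A (s n \<ominus> m)) \<longlonglongrightarrow> 0 + 0"
    by (intro tendsto_add tends_lim assms)
  then have "nrm A (l \<ominus> m) \<le> 0 + 0"
    by (rule LIMSEQ_le_const)
      (metis assms nrm_diff_commute nrm_diff_triangle tends_closed)
  then show ?thesis
    using assms tends_closed nrm_nonneg[of "l \<ominus> m"]
    by (metis add_0 diff_eq_zero_iff dual_order.antisym minus_closed nrm_eq_zero_iff)
qed

lemma tends_add:
  assumes "tends A s l" "tends A t m"
  shows "tends A (\<lambda>n. s n \<oplus> t n) (l \<oplus> m)"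
proof (rule tendsI)
  note c = tends_closed[OF assms(1)] tends_closed[OF assms(2)]
  show "l \<oplus> m \<in> carrier A" "\<And>n. s n \<oplus> t n \<in> carrier A"
    using c by auto
  show "nrm A (s n \<oplus> t n \<ominus> (l \<oplus> m)) \<le> nrm A (s n \<ominus> l) + nrm A (t n \<ominus> m)" for n
  proof -
    have "s n \<oplus> t n \<ominus> (l \<oplus> m) = (s n \<ominus> l) \<oplus> (t n \<ominus> m)"
      using c by (simp add: a_minus_def minus_add a_ac)
    then show ?thesis
      using c by (simp add: nrm_triangle)
  qed
  show "(\<lambda>n. nrm A (s n \<ominus> l) + nrm A (t n \<ominus> m)) \<longlonglongrightarrow> 0"
    using tendsto_add[OF tends_lim[OF assms(1)] tends_lim[OF assms(2)]] by simp
qed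

lemma tends_nrm:
  assumes "tends A s l"
  shows "(\<lambda>n. nrm A (s n)) \<longlonglongrightarrow> nrm A l"
proof -
  have "(\<lambda>n. nrm A (s n) - nrm A l) \<longlonglongrightarrow> 0"
    by (rule Lim_null_comparison[OF _ tends_lim[OF assms]])
      (use tends_closed[OF assms] nrm_reverse_triangle in auto)
  then show ?thesis
    by (simp add: LIM_zero_iff)
qed

lemma tends_mult:
  assumes "tends A s l" "tends A t m"
  shows "tends A (\<lambda>n. s n \<otimes> t n) (l \<otimes> m)"
proof (rule tendsI)
  note c = tends_closed[OF assms(1)] tends_closed[OF assms(2)]
  show "l \<otimes> m \<in> carrier A" "\<And>n. s n \<otimes> t n \<in> carrier A"
    using c by auto
  show "nrm A (s n \<otimes> t n \<ominus> l \<otimes> m) \<le> nrm A (s n \<ominus> l) * nrm A (t n) + nrm A l * nrm A (t n \<ominus> m)" for n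
  proof -
    have "s n \<otimes> t n \<ominus> l \<otimes> m = (s n \<ominus> l) \<otimes> t n \<oplus> l \<otimes> (t n \<ominus> m)"
      using c diff_diff_telescope[of "s n \<otimes> t n" "l \<otimes> t n" "l \<otimes> m"]
      by (simp add: mult_diff_left mult_diff_right)
    then show ?thesis
      using c nrm_triangle[of "(s n \<ominus> l) \<otimes> t n" "l \<otimes> (t n \<ominus> m)"] nrm_mult[of "s n \<ominus> l" "t n"]
        nrm_mult[of l "t n \<ominus> m"] by simp
  qed
  show "(\<lambda>n. nrm A (s n \<ominus> l) * nrm A (t n) + nrm A l * nrm A (t n \<ominus> m)) \<longlonglongrightarrow> 0"
    using tendsto_add[OF tendsto_mult[OF tends_lim[OF assms(1)] tends_nrm[OF assms(2)]]
        tendsto_mult[OF tendsto_const tends_lim[OF assms(2)]]] by simp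
qed

lemma tends_scale:
  assumes "tends A s l"
  shows "tends A (\<lambda>n. c \<odot> s n) (c \<odot> l)"
proof (rule tendsI)
  note c = tends_closed[OF assms(1)]
  show "c \<odot> l \<in> carrier A" "\<And>n. c \<odot> s n \<in> carrier A"
    using c by auto
  show "nrm A (c \<odot> s n \<ominus> c \<odot> l) \<le> cmod c * nrm A (s n \<ominus> l)" for n
    using c by (simp flip: scale_diff add: nrm_scale)
  show "(\<lambda>n. cmod c * nrm A (s n \<ominus> l)) \<longlonglongrightarrow> 0"
    using tendsto_mult[OF tendsto_const tends_lim[OF assms]] by fastforce
qed

lemma tends_star:
  assumes "tends A s l"
  shows "tends A (\<lambda>n. star A (s n)) (star A l)"
  by (rule tendsI[OF _ _ _ tends_lim[OF assms]])
    (use tends_closed[OF assms] in \<open>auto simp flip: star_diff\<close>)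

end

lemma (in cstar_algebra) cauchy_tends: "cauchy A s \<Longrightarrow> \<exists>l. tends A s l"
  using complete mcomplete_iff by blast

section \<open>Functions on a finite set\<close>

lemma fun_tensor_simps [simp]:
  "carrier (fun_tensor X B) = X \<rightarrow>\<^sub>E carrier B"
  "f \<otimes>\<^bsub>fun_tensor X B\<^esub> g = (\<lambda>x\<in>X. f x \<otimes>\<^bsub>B\<^esub> g x)"
  "f \<oplus>\<^bsub>fun_tensor X B\<^esub> g = (\<lambda>x\<in>X. f x \<oplus>\<^bsub>B\<^esub> g x)"
  "\<zero>\<^bsub>fun_tensor X B\<^esub> = (\<lambda>x\<in>X. \<zero>\<^bsub>B\<^esub>)"
  "\<one>\<^bsub>fun_tensor X B\<^esub> = (\<lambda>x\<in>X. \<one>\<^bsub>B\<^esub>)"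
  "c \<odot>\<^bsub>fun_tensor X B\<^esub> f = (\<lambda>x\<in>X. c \<odot>\<^bsub>B\<^esub> f x)"
  "star (fun_tensor X B) f = (\<lambda>x\<in>X. star B (f x))"
  by (simp_all add: fun_tensor_def)

lemma nrm_fun_tensor_le_iff:
  assumes "finite X"
  shows "nrm (fun_tensor X B) f \<le> K \<longleftrightarrow> 0 \<le> K \<and> (\<forall>x\<in>X. nrm B (f x) \<le> K)"
  using assms by (simp add: fun_tensor_def)

lemma nrm_fun_tensor_ge:
  assumes "finite X"
  shows "0 \<le> nrm (fun_tensor X B) f" "x \<in> X \<Longrightarrow> nrm B (f x) \<le> nrm (fun_tensor X B) f"
  using nrm_fun_tensor_le_iff[OF assms, of B f "nrm (fun_tensor X B) f"] by auto

lemma fun_eqI_on: "\<lbrakk>f \<in> X \<rightarrow>\<^sub>E Y; g \<in> X \<rightarrow>\<^sub>E Y; \<And>x. x \<in> X \<Longrightarrow> f x = g x\<rbrakk> \<Longrightarrow> f = g"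
  by (rule PiE_ext)

context pre_cstar_algebra
begin

text \<open>
  Completeness of a derived algebra \<open>D\<close> is reduced to that of \<open>A\<close> in this way: a Cauchy sequence in \<open>D\<close>
  yields Cauchy sequences of values in \<open>A\<close>.
\<close>

lemma cauchy_comparison:
  assumes "cauchy D s" "range t \<subseteq> carrier A" "0 \<le> K"
    and le: "\<And>m n. nrm A (t m \<ominus> t n) \<le> K * nrm D (s m \<ominus>\<^bsub>D\<^esub> s n)"
  shows "cauchy A t"
  unfolding cauchy_def
proof (intro conjI allI impI)
  fix e :: real assume "e > 0"
  have "K + 1 > 0"
    using \<open>0 \<le> K\<close> by simp
  with \<open>e > 0\<close> obtain N where N: "\<forall>m\<ge>N. \<forall>n\<ge>N. nrm D (s m \<ominus>\<^bsub>D\<^esub> s n) < e / (K + 1)"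
    using assms(1) unfolding cauchy_def by (meson divide_pos_pos)
  show "\<exists>N. \<forall>m\<ge>N. \<forall>n\<ge>N. nrm A (t m \<ominus> t n) < e"
  proof (intro exI allI impI)
    fix m n assume "m \<ge> N" "n \<ge> N"
    with N have "nrm D (s m \<ominus>\<^bsub>D\<^esub> s n) < e / (K + 1)"
      by auto
    then have "K * nrm D (s m \<ominus>\<^bsub>D\<^esub> s n) \<le> K * (e / (K + 1))"
      using \<open>0 \<le> K\<close> by (intro mult_left_mono) auto
    also have "\<dots> < e"
      using \<open>0 \<le> K\<close> \<open>e > 0\<close> by (simp add: field_simps)
    finally show "nrm A (t m \<ominus> t n) < e"
      using le[of m n] by linarith
  qed
qed (use assms in auto)

lemma pre_cstar_algebra_fun_tensor:
  assumes "finite X"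
  shows "pre_cstar_algebra (fun_tensor X A)"
proof -
  let ?C = "fun_tensor X A"
  have mem [simp, intro]: "f x \<in> carrier A" if "f \<in> X \<rightarrow>\<^sub>E carrier A" "x \<in> X" for f x
    using that by (rule PiE_mem)
  note eqI = fun_eqI_on[where X = X and Y = "carrier A"]
  have group: "abelian_group ?C"
  proof (rule abelian_groupI)
    fix f assume f: "f \<in> carrier ?C"
    then have fx: "f x \<in> carrier A" if "x \<in> X" for x
      using that by auto
    then have "(\<lambda>x\<in>X. \<ominus> f x) \<oplus>\<^bsub>?C\<^esub> f = \<zero>\<^bsub>?C\<^esub>" "(\<lambda>x\<in>X. \<ominus> f x) \<in> carrier ?C"
      by (auto intro!: restrict_ext l_neg)
    then show "\<exists>g\<in>carrier ?C. g \<oplus>\<^bsub>?C\<^esub> f = \<zero>\<^bsub>?C\<^esub>"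
      by blast
  qed (((rule eqI)?; auto simp: a_ac)+)
  show ?thesis
  proof (intro pre_cstar_algebra.intro group pre_cstar_algebra_axioms.intro)
    fix f assume f: "f \<in> carrier ?C"
    show "nrm ?C (star ?C f \<otimes>\<^bsub>?C\<^esub> f) = (nrm ?C f)\<^sup>2"
    proof (rule antisym)
      show "nrm ?C (star ?C f \<otimes>\<^bsub>?C\<^esub> f) \<le> (nrm ?C f)\<^sup>2"
        using f nrm_fun_tensor_ge[OF assms, where B=A and f=f]
        by (auto simp: nrm_fun_tensor_le_iff[OF assms] cstar_identity nrm_nonneg intro!: power_mono)
      have "nrm ?C f \<le> sqrt (nrm ?C (star ?C f \<otimes>\<^bsub>?C\<^esub> f))"
        unfolding nrm_fun_tensor_le_iff[OF assms, of _ f]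
      proof (intro conjI ballI)
        fix x assume x: "x \<in> X"
        have "(nrm A (f x))\<^sup>2 \<le> nrm ?C (star ?C f \<otimes>\<^bsub>?C\<^esub> f)"
          using nrm_fun_tensor_ge(2)[OF assms x, of A "star ?C f \<otimes>\<^bsub>?C\<^esub> f"] f x
          by (simp add: cstar_identity)
        then show "nrm A (f x) \<le> sqrt (nrm ?C (star ?C f \<otimes>\<^bsub>?C\<^esub> f))"
          by (rule real_le_rsqrt)
      qed (simp only: real_sqrt_ge_0_iff nrm_fun_tensor_ge[OF assms])
      then have "(nrm ?C f)\<^sup>2 \<le> (sqrt (nrm ?C (star ?C f \<otimes>\<^bsub>?C\<^esub> f)))\<^sup>2"
        by (rule power_mono) (simp only: nrm_fun_tensor_ge[OF assms])
      then show "(nrm ?C f)\<^sup>2 \<le> nrm ?C (star ?C f \<otimes>\<^bsub>?C\<^esub> f)"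
        by (simp only: real_sqrt_pow2 nrm_fun_tensor_ge[OF assms])
    qed
    show "0 \<le> nrm ?C f"
      by (rule nrm_fun_tensor_ge[OF assms])
    show "(nrm ?C f = 0) = (f = \<zero>\<^bsub>?C\<^esub>)"
    proof
      assume "nrm ?C f = 0"
      then have "nrm A (f x) = 0" if "x \<in> X" for x
        using nrm_fun_tensor_ge(2)[OF assms that, of A f] nrm_nonneg[of "f x"] f that by force
      then show "f = \<zero>\<^bsub>?C\<^esub>"
        using f by (intro eqI) (auto simp: nrm_eq_zero_iff)
    next
      assume "f = \<zero>\<^bsub>?C\<^esub>"
      then show "nrm ?C f = 0"
        using nrm_fun_tensor_le_iff[OF assms, of A f 0] nrm_fun_tensor_ge(1)[OF assms, of A f] by auto
    qed
    show "nrm ?C (c \<odot>\<^bsub>?C\<^esub> f) = cmod c * nrm ?C f" for c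
    proof (rule homogeneousI)
      have le: "nrm ?C (d \<odot>\<^bsub>?C\<^esub> g) \<le> cmod d * nrm ?C g" if "g \<in> carrier ?C" for d g
        using that nrm_fun_tensor_ge[OF assms, where B=A and f=g]
        by (auto simp: nrm_fun_tensor_le_iff[OF assms] nrm_scale intro!: mult_left_mono)
      show "nrm ?C (c \<odot>\<^bsub>?C\<^esub> f) \<le> cmod c * nrm ?C f"
        using f by (rule le)
      assume "c \<noteq> 0"
      then have "inverse c \<odot>\<^bsub>?C\<^esub> (c \<odot>\<^bsub>?C\<^esub> f) = f"
        using f by (intro eqI) (auto simp: scale_one simp flip: scale_scale)
      moreover have "c \<odot>\<^bsub>?C\<^esub> f \<in> carrier ?C"
        using f by auto
      ultimately show "nrm ?C f \<le> cmod (inverse c) * nrm ?C (c \<odot>\<^bsub>?C\<^esub> f)"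
        using le[of "c \<odot>\<^bsub>?C\<^esub> f" "inverse c"] by metis
    qed (rule nrm_fun_tensor_ge[OF assms])
    fix g assume g: "g \<in> carrier ?C"
    show "nrm ?C (f \<oplus>\<^bsub>?C\<^esub> g) \<le> nrm ?C f + nrm ?C g"
      unfolding nrm_fun_tensor_le_iff[OF assms]
    proof (intro conjI ballI)
      fix x assume "x \<in> X"
      then show "nrm A ((f \<oplus>\<^bsub>?C\<^esub> g) x) \<le> nrm ?C f + nrm ?C g"
        using nrm_triangle[of "f x" "g x"] nrm_fun_tensor_ge(2)[OF assms, of x A f]
          nrm_fun_tensor_ge(2)[OF assms, of x A g] f g by (simp add: add_mono)
    qed (simp add: nrm_fun_tensor_ge[OF assms])
    show "nrm ?C (f \<otimes>\<^bsub>?C\<^esub> g) \<le> nrm ?C f * nrm ?C g"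
      unfolding nrm_fun_tensor_le_iff[OF assms]
    proof (intro conjI ballI)
      fix x assume x: "x \<in> X"
      then have "nrm A ((f \<otimes>\<^bsub>?C\<^esub> g) x) \<le> nrm A (f x) * nrm A (g x)"
        using nrm_mult f g by simp
      also have "\<dots> \<le> nrm ?C f * nrm ?C g"
        using x nrm_fun_tensor_ge[OF assms] f g by (intro mult_mono) (auto simp: nrm_nonneg)
      finally show "nrm A ((f \<otimes>\<^bsub>?C\<^esub> g) x) \<le> nrm ?C f * nrm ?C g" .
    qed (simp add: nrm_fun_tensor_ge[OF assms])
  qed (((rule eqI)?; auto simp: mult_assoc mult_add_left mult_add_right scale_add_left
      scale_add_right scale_one scale_scale scale_mult_left scale_mult_right star_star star_add
      star_scale star_mult)+)
qed

lemma fun_tensor_minus: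
  assumes "finite X" "f \<in> carrier (fun_tensor X A)" "g \<in> carrier (fun_tensor X A)" "x \<in> X"
  shows "(f \<ominus>\<^bsub>fun_tensor X A\<^esub> g) x = f x \<ominus> g x"
proof -
  interpret C: pre_cstar_algebra "fun_tensor X A"
    by (rule pre_cstar_algebra_fun_tensor) fact
  show ?thesis
    using assms minus_eq_scale[OF PiE_mem[OF assms(3)[simplified] assms(4)]]
    by (simp add: a_minus_def C.minus_eq_scale)
qed

end

context cstar_algebra
begin

lemma cstar_algebra_fun_tensor:
  assumes "finite X"
  shows "cstar_algebra (fun_tensor X A)"
proof -
  let ?C = "fun_tensor X A"
  interpret C: pre_cstar_algebra ?C
    by (rule pre_cstar_algebra_fun_tensor) fact
  show ?thesis
  proof (rule C.cstar_algebraI)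
    fix s assume s: "cauchy ?C s"
    then have sc: "s n \<in> carrier ?C" for n
      by (auto simp: cauchy_def)
    have "\<exists>l. tends A (\<lambda>n. s n x) l" if x: "x \<in> X" for x
    proof (rule cauchy_tends, rule cauchy_comparison[OF s])
      show "range (\<lambda>n. s n x) \<subseteq> carrier A"
        using sc x by (auto simp: PiE_mem)
      show "nrm A (s m x \<ominus> s n x) \<le> 1 * nrm ?C (s m \<ominus>\<^bsub>?C\<^esub> s n)" for m n
        using nrm_fun_tensor_ge(2)[OF assms x, of A "s m \<ominus>\<^bsub>?C\<^esub> s n"]
          fun_tensor_minus[OF assms sc sc x] by simp
    qed simp
    then obtain l where l: "tends A (\<lambda>n. s n x) (l x)" if "x \<in> X" for x
      by metis
    have lc: "(\<lambda>x\<in>X. l x) \<in> carrier ?C"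
      using l tends_closed(1) by auto
    have "tends ?C s (\<lambda>x\<in>X. l x)"
    proof (rule C.tendsI[OF lc sc])
      show "nrm ?C (s n \<ominus>\<^bsub>?C\<^esub> (\<lambda>x\<in>X. l x)) \<le> (\<Sum>x\<in>X. nrm A (s n x \<ominus> l x))" for n
        unfolding nrm_fun_tensor_le_iff[OF assms]
      proof (intro conjI ballI)
        have nn: "0 \<le> nrm A (s n x \<ominus> l x)" if "x \<in> X" for x
          using tends_closed[OF l[OF that]] by (simp add: nrm_nonneg)
        then show "0 \<le> (\<Sum>x\<in>X. nrm A (s n x \<ominus> l x))"
          by (rule sum_nonneg)
        fix x assume x: "x \<in> X"
        show "nrm A ((s n \<ominus>\<^bsub>?C\<^esub> (\<lambda>x\<in>X. l x)) x) \<le> (\<Sum>x\<in>X. nrm A (s n x \<ominus> l x))"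
          using member_le_sum[OF x, of "\<lambda>x. nrm A (s n x \<ominus> l x)"] nn assms x
            fun_tensor_minus[OF assms sc lc x] by simp
      qed
      show "(\<lambda>n. \<Sum>x\<in>X. nrm A (s n x \<ominus> l x)) \<longlonglongrightarrow> 0"
        using tendsto_sum[of X "\<lambda>x n. nrm A (s n x \<ominus> l x)" "\<lambda>_. 0"] tends_lim[OF l] by simp
    qed
    then show "\<exists>l. tends ?C s l"
      by blast
  qed
qed


end

section \<open>The multiplier algebra\<close>

lemma double_centralizerD:
  assumes "double_centralizer C m"
  shows "fst m \<in> carrier C \<rightarrow>\<^sub>E carrier C" "snd m \<in> carrier C \<rightarrow>\<^sub>E carrier C"
    and "x \<in> carrier C \<Longrightarrow> fst m x \<in> carrier C" "x \<in> carrier C \<Longrightarrow> snd m x \<in> carrier C"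
    and "\<lbrakk>x \<in> carrier C; y \<in> carrier C\<rbrakk> \<Longrightarrow> fst m (x \<oplus>\<^bsub>C\<^esub> y) = fst m x \<oplus>\<^bsub>C\<^esub> fst m y"
    and "\<lbrakk>x \<in> carrier C; y \<in> carrier C\<rbrakk> \<Longrightarrow> snd m (x \<oplus>\<^bsub>C\<^esub> y) = snd m x \<oplus>\<^bsub>C\<^esub> snd m y"
    and "x \<in> carrier C \<Longrightarrow> fst m (c \<odot>\<^bsub>C\<^esub> x) = c \<odot>\<^bsub>C\<^esub> fst m x"
    and "x \<in> carrier C \<Longrightarrow> snd m (c \<odot>\<^bsub>C\<^esub> x) = c \<odot>\<^bsub>C\<^esub> snd m x"
    and "\<lbrakk>x \<in> carrier C; y \<in> carrier C\<rbrakk> \<Longrightarrow> fst m (x \<otimes>\<^bsub>C\<^esub> y) = fst m x \<otimes>\<^bsub>C\<^esub> y"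
    and "\<lbrakk>x \<in> carrier C; y \<in> carrier C\<rbrakk> \<Longrightarrow> snd m (x \<otimes>\<^bsub>C\<^esub> y) = x \<otimes>\<^bsub>C\<^esub> snd m y"
    and "\<lbrakk>x \<in> carrier C; y \<in> carrier C\<rbrakk> \<Longrightarrow> x \<otimes>\<^bsub>C\<^esub> fst m y = snd m x \<otimes>\<^bsub>C\<^esub> y"
    and "\<exists>K. \<forall>x\<in>carrier C. nrm C (fst m x) \<le> K * nrm C x"
    and "\<exists>K. \<forall>x\<in>carrier C. nrm C (snd m x) \<le> K * nrm C x"
  using assms unfolding double_centralizer_def bounded_op_def split_beta
  by (blast dest: PiE_mem)+

lemma multiplier_carrier: "m \<in> carrier (multiplier_alg C) \<longleftrightarrow> double_centralizer C m"
  by (simp add: multiplier_alg_def)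

lemmas multiplierD = double_centralizerD[OF iffD1[OF multiplier_carrier]]

lemma multiplier_apply:
  "x \<in> carrier C \<Longrightarrow> fst (m \<otimes>\<^bsub>multiplier_alg C\<^esub> n) x = fst m (fst n x)"
  "x \<in> carrier C \<Longrightarrow> snd (m \<otimes>\<^bsub>multiplier_alg C\<^esub> n) x = snd n (snd m x)"
  "x \<in> carrier C \<Longrightarrow> fst (m \<oplus>\<^bsub>multiplier_alg C\<^esub> n) x = fst m x \<oplus>\<^bsub>C\<^esub> fst n x"
  "x \<in> carrier C \<Longrightarrow> snd (m \<oplus>\<^bsub>multiplier_alg C\<^esub> n) x = snd m x \<oplus>\<^bsub>C\<^esub> snd n x"
  "x \<in> carrier C \<Longrightarrow> fst (c \<odot>\<^bsub>multiplier_alg C\<^esub> m) x = c \<odot>\<^bsub>C\<^esub> fst m x"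
  "x \<in> carrier C \<Longrightarrow> snd (c \<odot>\<^bsub>multiplier_alg C\<^esub> m) x = c \<odot>\<^bsub>C\<^esub> snd m x"
  "x \<in> carrier C \<Longrightarrow> fst (star (multiplier_alg C) m) x = star C (snd m (star C x))"
  "x \<in> carrier C \<Longrightarrow> snd (star (multiplier_alg C) m) x = star C (fst m (star C x))"
  "x \<in> carrier C \<Longrightarrow> fst \<zero>\<^bsub>multiplier_alg C\<^esub> x = \<zero>\<^bsub>C\<^esub>"
  "x \<in> carrier C \<Longrightarrow> snd \<zero>\<^bsub>multiplier_alg C\<^esub> x = \<zero>\<^bsub>C\<^esub>"
  "x \<in> carrier C \<Longrightarrow> fst \<one>\<^bsub>multiplier_alg C\<^esub> x = x"
  "x \<in> carrier C \<Longrightarrow> snd \<one>\<^bsub>multiplier_alg C\<^esub> x = x"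
  by (auto simp: multiplier_alg_def compose_def split: prod.splits)

lemma multiplier_extensional:
  "fst (m \<otimes>\<^bsub>multiplier_alg C\<^esub> n) \<in> extensional (carrier C)"
  "snd (m \<otimes>\<^bsub>multiplier_alg C\<^esub> n) \<in> extensional (carrier C)"
  "fst (m \<oplus>\<^bsub>multiplier_alg C\<^esub> n) \<in> extensional (carrier C)"
  "snd (m \<oplus>\<^bsub>multiplier_alg C\<^esub> n) \<in> extensional (carrier C)"
  "fst (c \<odot>\<^bsub>multiplier_alg C\<^esub> m) \<in> extensional (carrier C)"
  "snd (c \<odot>\<^bsub>multiplier_alg C\<^esub> m) \<in> extensional (carrier C)"
  "fst (star (multiplier_alg C) m) \<in> extensional (carrier C)"
  "snd (star (multiplier_alg C) m) \<in> extensional (carrier C)"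
  "fst \<zero>\<^bsub>multiplier_alg C\<^esub> \<in> extensional (carrier C)"
  "snd \<zero>\<^bsub>multiplier_alg C\<^esub> \<in> extensional (carrier C)"
  "fst \<one>\<^bsub>multiplier_alg C\<^esub> \<in> extensional (carrier C)"
  "snd \<one>\<^bsub>multiplier_alg C\<^esub> \<in> extensional (carrier C)"
  by (auto simp: multiplier_alg_def compose_def split: prod.splits)

lemma multiplier_eqI:
  assumes "m \<in> carrier (multiplier_alg C)" "n \<in> carrier (multiplier_alg C)"
    and "\<And>x. x \<in> carrier C \<Longrightarrow> fst m x = fst n x" "\<And>x. x \<in> carrier C \<Longrightarrow> snd m x = snd n x"
  shows "m = n"
  using assms by (intro prod_eqI fun_eqI_on[OF multiplierD(1) multiplierD(1)]
      fun_eqI_on[OF multiplierD(2) multiplierD(2)]) simp_all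

context cstar_algebra
begin

text \<open>
  The exchange identity \<open>x L(y) = R(x) y\<close> implies the rest: linearity and the module properties of \<open>L\<close> and
  \<open>R\<close> hold after multiplication by an arbitrary element, hence hold by faithfulness. A bound for \<open>L\<close> bounds
  \<open>R\<close>, because \<open>\<parallel>R x\<parallel>\<^sup>2 = \<parallel>R x (R x)\<^sup>*\<parallel> = \<parallel>x L((R x)\<^sup>*)\<parallel> \<le> \<parallel>x\<parallel> K \<parallel>R x\<parallel>\<close>.
\<close>

lemma multiplierI:
  assumes "fst m \<in> extensional (carrier A)" "snd m \<in> extensional (carrier A)"
    and L: "\<And>x. x \<in> carrier A \<Longrightarrow> fst m x \<in> carrier A"
    and R: "\<And>x. x \<in> carrier A \<Longrightarrow> snd m x \<in> carrier A"
    and LR: "\<And>x y. \<lbrakk>x \<in> carrier A; y \<in> carrier A\<rbrakk> \<Longrightarrow> x \<otimes> fst m y = snd m x \<otimes> y"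
    and K: "\<And>x. x \<in> carrier A \<Longrightarrow> nrm A (fst m x) \<le> K * nrm A x"
  shows "m \<in> carrier (multiplier_alg A)"
proof -
  have eqL: "a = b" if "a \<in> carrier A" "b \<in> carrier A" "\<And>z. z \<in> carrier A \<Longrightarrow> z \<otimes> a = z \<otimes> b" for a b
    using left_faithful[of "a \<ominus> b"] that by (simp add: mult_diff_right diff_eq_zero_iff)
  have eqR: "a = b" if "a \<in> carrier A" "b \<in> carrier A" "\<And>z. z \<in> carrier A \<Longrightarrow> a \<otimes> z = b \<otimes> z" for a b
    using right_faithful[of "a \<ominus> b"] that by (simp add: mult_diff_left diff_eq_zero_iff)
  have KR: "nrm A (snd m x) \<le> K * nrm A x" if x: "x \<in> carrier A" for x
  proof (cases "nrm A (snd m x) = 0")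
    case True
    have "0 \<le> K * nrm A (star A x)"
      using K[of "star A x"] nrm_nonneg[OF L, of "star A x"] x by simp
    with True x show ?thesis
      by simp
  next
    case False
    have "(nrm A (snd m x))\<^sup>2 = nrm A (snd m x \<otimes> star A (snd m x))"
      using cstar_identity[of "star A (snd m x)"] R x by (simp add: star_star)
    also have "\<dots> = nrm A (x \<otimes> fst m (star A (snd m x)))"
      using LR R x by simp
    also have "\<dots> \<le> nrm A x * nrm A (fst m (star A (snd m x)))"
      using L R x by (intro nrm_mult) auto
    also have "\<dots> \<le> nrm A x * (K * nrm A (snd m x))"
      using K[of "star A (snd m x)"] R x by (intro mult_left_mono) (auto simp: nrm_nonneg)
    finally have "nrm A (snd m x) * nrm A (snd m x) \<le> (K * nrm A x) * nrm A (snd m x)"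
      by (simp add: power2_eq_square mult_ac)
    with False nrm_nonneg[OF R[OF x]] show ?thesis
      by simp
  qed
  have *: "fst m \<in> carrier A \<rightarrow>\<^sub>E carrier A" "snd m \<in> carrier A \<rightarrow>\<^sub>E carrier A"
    using assms by (auto simp: PiE_def)
  show ?thesis
    unfolding multiplier_carrier double_centralizer_def bounded_op_def
  proof (simp only: split_beta, intro conjI ballI allI * LR)
    show "\<exists>K. \<forall>x\<in>carrier A. nrm A (fst m x) \<le> K * nrm A x" "\<exists>K. \<forall>x\<in>carrier A. nrm A (snd m x) \<le> K * nrm A x"
      using K KR by auto
    fix x assume x: "x \<in> carrier A"
    show "fst m (c \<odot> x) = c \<odot> fst m x" for c
      by (rule eqL) (use x L R LR in \<open>simp_all add: scale_mult_right\<close>)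
    show "snd m (c \<odot> x) = c \<odot> snd m x" for c
      by (rule eqR) (use x L R LR[symmetric] in \<open>simp_all add: scale_mult_left\<close>)
    fix y assume y: "y \<in> carrier A"
    show "fst m (x \<oplus> y) = fst m x \<oplus> fst m y"
      by (rule eqL) (use x y L R LR in \<open>simp_all add: mult_add_right\<close>)
    show "snd m (x \<oplus> y) = snd m x \<oplus> snd m y"
      by (rule eqR) (use x y L R LR[symmetric] in \<open>simp_all add: mult_add_left\<close>)
    show "fst m (x \<otimes> y) = fst m x \<otimes> y"
      by (rule eqL) (use x y L R LR in \<open>simp_all add: LR flip: mult_assoc\<close>)
    show "snd m (x \<otimes> y) = x \<otimes> snd m y"
      by (rule eqR) (use x y L R LR[symmetric] in \<open>simp_all add: mult_assoc LR[symmetric]\<close>)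
  qed
qed

lemma bdd_above_multiplier:
  assumes "m \<in> carrier (multiplier_alg A)"
  shows "bdd_above {nrm A (fst m x) | x. x \<in> carrier A \<and> nrm A x \<le> 1}"
proof -
  obtain K where K: "\<forall>x\<in>carrier A. nrm A (fst m x) \<le> K * nrm A x"
    using multiplierD(12)[OF assms(1)] by blast
  show ?thesis
  proof (rule bdd_aboveI)
    fix r assume "r \<in> {nrm A (fst m x) | x. x \<in> carrier A \<and> nrm A x \<le> 1}"
    then obtain z where z: "r = nrm A (fst m z)" "z \<in> carrier A" "nrm A z \<le> 1"
      by auto
    have "r \<le> K * nrm A z"
      using K z by auto
    also have "\<dots> \<le> \<bar>K\<bar> * 1"
      using z nrm_nonneg[of z] by (intro mult_mono) auto
    finally show "r \<le> \<bar>K\<bar>"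
      by simp
  qed
qed

lemma multiplier_nrm_upper:
  assumes "m \<in> carrier (multiplier_alg A)" "x \<in> carrier A" "nrm A x \<le> 1"
  shows "nrm A (fst m x) \<le> nrm (multiplier_alg A) m"
proof -
  have "nrm A (fst m x) \<le> op_nrm A (fst m)"
    unfolding op_nrm_def
    by (rule cSup_upper[OF _ bdd_above_multiplier[OF assms(1)]]) (use assms in auto)
  then show ?thesis
    by (simp add: multiplier_alg_def split_beta)
qed

lemma multiplier_nrm_nonneg: "m \<in> carrier (multiplier_alg A) \<Longrightarrow> 0 \<le> nrm (multiplier_alg A) m"
  using multiplier_nrm_upper[of m \<zero>] nrm_nonneg[OF multiplierD(3)[of m A \<zero>]] by simp

lemma multiplier_bound:
  assumes "m \<in> carrier (multiplier_alg A)" "x \<in> carrier A"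
  shows "nrm A (fst m x) \<le> nrm (multiplier_alg A) m * nrm A x"
proof (cases "nrm A x = 0")
  case True
  with assms show ?thesis
    using multiplierD(7)[OF assms(1), of \<zero> 0] multiplierD(3)[OF assms(1), of \<zero>]
    by (simp add: nrm_eq_zero_iff)
next
  case False
  then have pos: "nrm A x > 0"
    using assms(2) nrm_nonneg[of x] by simp
  define y where "y = complex_of_real (1 / nrm A x) \<odot> x"
  have y: "y \<in> carrier A" "nrm A y = 1"
    using assms pos by (simp_all add: y_def nrm_scale norm_divide)
  have "nrm A (fst m y) \<le> nrm (multiplier_alg A) m"
    using multiplier_nrm_upper[OF assms(1)] y by simp
  moreover have "nrm A (fst m y) = 1 / nrm A x * nrm A (fst m x)"
    using assms pos by (simp add: y_def multiplierD nrm_scale norm_divide)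
  ultimately show ?thesis
    using pos by (simp add: field_simps)
qed

lemma multiplier_nrm_le:
  assumes "0 \<le> K" "\<And>x. x \<in> carrier A \<Longrightarrow> nrm A (fst m x) \<le> K * nrm A x"
  shows "nrm (multiplier_alg A) m \<le> K"
proof -
  have "op_nrm A (fst m) \<le> K"
    unfolding op_nrm_def
  proof (rule cSup_least)
    show "{nrm A (fst m x) | x. x \<in> carrier A \<and> nrm A x \<le> 1} \<noteq> {}"
      by (auto intro!: exI[of _ \<zero>])
    fix r assume "r \<in> {nrm A (fst m x) | x. x \<in> carrier A \<and> nrm A x \<le> 1}"
    then obtain z where z: "r = nrm A (fst m z)" "z \<in> carrier A" "nrm A z \<le> 1"
      by auto
    then have "r \<le> K * nrm A z"
      using assms by auto
    also have "\<dots> \<le> K * 1"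
      using z assms by (intro mult_left_mono) auto
    finally show "r \<le> K"
      by simp
  qed
  then show ?thesis
    by (simp add: multiplier_alg_def split_beta)
qed


lemma multiplier_closed:
  assumes m: "m \<in> carrier (multiplier_alg A)" and n: "n \<in> carrier (multiplier_alg A)"
  shows "m \<otimes>\<^bsub>multiplier_alg A\<^esub> n \<in> carrier (multiplier_alg A)"
    and "m \<oplus>\<^bsub>multiplier_alg A\<^esub> n \<in> carrier (multiplier_alg A)"
    and "c \<odot>\<^bsub>multiplier_alg A\<^esub> m \<in> carrier (multiplier_alg A)"
    and "star (multiplier_alg A) m \<in> carrier (multiplier_alg A)"
proof -
  note [simp] = multiplier_apply multiplier_extensional multiplierD(3,4)[OF m] multiplierD(3,4)[OF n]
  obtain K where K: "\<And>x. x \<in> carrier A \<Longrightarrow> nrm A (snd m x) \<le> K * nrm A x"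
    using multiplierD(13)[OF m] by blast
  show "m \<otimes>\<^bsub>multiplier_alg A\<^esub> n \<in> carrier (multiplier_alg A)"
  proof (rule multiplierI)
    fix x assume x: "x \<in> carrier A"
    have "nrm A (fst m (fst n x)) \<le> nrm (multiplier_alg A) m * nrm A (fst n x)"
      using m x by (simp add: multiplier_bound)
    also have "\<dots> \<le> nrm (multiplier_alg A) m * (nrm (multiplier_alg A) n * nrm A x)"
      using m n x by (intro mult_left_mono multiplier_bound multiplier_nrm_nonneg) auto
    finally show "nrm A (fst (m \<otimes>\<^bsub>multiplier_alg A\<^esub> n) x)
        \<le> (nrm (multiplier_alg A) m * nrm (multiplier_alg A) n) * nrm A x"
      using x by (simp add: mult.assoc)
  qed (use multiplierD(11)[OF m] multiplierD(11)[OF n] in simp_all)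
  show "m \<oplus>\<^bsub>multiplier_alg A\<^esub> n \<in> carrier (multiplier_alg A)"
  proof (rule multiplierI)
    fix x assume x: "x \<in> carrier A"
    show "nrm A (fst (m \<oplus>\<^bsub>multiplier_alg A\<^esub> n) x)
        \<le> (nrm (multiplier_alg A) m + nrm (multiplier_alg A) n) * nrm A x"
      using x nrm_triangle[of "fst m x" "fst n x"] multiplier_bound[OF m x] multiplier_bound[OF n x]
      by (simp add: distrib_right)
  qed (use multiplierD(11)[OF m] multiplierD(11)[OF n] in \<open>simp_all add: mult_add_left mult_add_right\<close>)
  show "c \<odot>\<^bsub>multiplier_alg A\<^esub> m \<in> carrier (multiplier_alg A)"
  proof (rule multiplierI)
    fix x assume x: "x \<in> carrier A"
    show "nrm A (fst (c \<odot>\<^bsub>multiplier_alg A\<^esub> m) x)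
        \<le> (cmod c * nrm (multiplier_alg A) m) * nrm A x"
      using x multiplier_bound[OF m x] by (simp add: nrm_scale mult.assoc mult_left_mono)
  qed (use multiplierD(11)[OF m] in \<open>simp_all add: scale_mult_left scale_mult_right\<close>)
  show "star (multiplier_alg A) m \<in> carrier (multiplier_alg A)"
  proof (rule multiplierI)
    fix x assume x: "x \<in> carrier A"
    show "nrm A (fst (star (multiplier_alg A) m) x) \<le> K * nrm A x"
      using K[of "star A x"] x by simp
  next
    fix x y assume x: "x \<in> carrier A" and y: "y \<in> carrier A"
    have "star A (star A y \<otimes> fst m (star A x)) = star A (snd m (star A y) \<otimes> star A x)"
      using multiplierD(11)[OF m, of "star A y" "star A x"] x y by simp
    then show "x \<otimes> fst (star (multiplier_alg A) m) y = snd (star (multiplier_alg A) m) x \<otimes> y"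
      using x y by (simp add: star_mult star_star)
  qed simp_all
qed

lemma multiplier_zero_one_closed:
  "\<zero>\<^bsub>multiplier_alg A\<^esub> \<in> carrier (multiplier_alg A)"
  "\<one>\<^bsub>multiplier_alg A\<^esub> \<in> carrier (multiplier_alg A)"
  by (rule multiplierI[where K = 0], simp_all add: multiplier_apply multiplier_extensional)
    (rule multiplierI[where K = 1], simp_all add: multiplier_apply multiplier_extensional)

text \<open>
  The C*-identity rests on \<open>\<parallel>L x\<parallel>\<^sup>2 = \<parallel>(L x)\<^sup>* L x\<parallel> = \<parallel>R((L x)\<^sup>*) x\<parallel> \<le> \<parallel>m\<^sup>* m\<parallel> \<parallel>x\<parallel>\<^sup>2\<close>, which gives
  \<open>\<parallel>m\<parallel>\<^sup>2 \<le> \<parallel>m\<^sup>* m\<parallel>\<close>. The other inequality follows once \<open>\<parallel>m\<^sup>*\<parallel> = \<parallel>m\<parallel>\<close>, and that is a formal consequence of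
  the first one and submultiplicativity.
\<close>

lemma pre_cstar_algebra_multiplier: "pre_cstar_algebra (multiplier_alg A)"
proof -
  let ?M = "multiplier_alg A"
  note [simp] = multiplier_apply multiplier_closed multiplier_zero_one_closed multiplierD(3,4)
  have group: "abelian_group ?M"
  proof (rule abelian_groupI)
    fix m assume m: "m \<in> carrier ?M"
    have "((-1) \<odot>\<^bsub>?M\<^esub> m) \<oplus>\<^bsub>?M\<^esub> m = \<zero>\<^bsub>?M\<^esub>"
      by (rule multiplier_eqI[where C = A]) (use m in \<open>simp_all add: l_neg flip: minus_eq_scale\<close>)
    then show "\<exists>n\<in>carrier ?M. n \<oplus>\<^bsub>?M\<^esub> m = \<zero>\<^bsub>?M\<^esub>"
      using m by (intro bexI[of _ "(-1) \<odot>\<^bsub>?M\<^esub> m"]) simp_all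
  next
    show "x \<oplus>\<^bsub>?M\<^esub> y \<oplus>\<^bsub>?M\<^esub> z = x \<oplus>\<^bsub>?M\<^esub> (y \<oplus>\<^bsub>?M\<^esub> z)"
      if "x \<in> carrier ?M" "y \<in> carrier ?M" "z \<in> carrier ?M" for x y z
      by (rule multiplier_eqI[where C = A]) (use that in \<open>simp_all add: a_assoc\<close>)
    show "x \<oplus>\<^bsub>?M\<^esub> y = y \<oplus>\<^bsub>?M\<^esub> x" if "x \<in> carrier ?M" "y \<in> carrier ?M" for x y
      by (rule multiplier_eqI[where C = A]) (use that in \<open>simp_all add: a_comm\<close>)
    show "\<zero>\<^bsub>?M\<^esub> \<oplus>\<^bsub>?M\<^esub> x = x" if "x \<in> carrier ?M" for x
      by (rule multiplier_eqI[where C = A]) (use that in \<open>simp_all\<close>)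
  qed simp_all
  have nrm_mult': "nrm ?M (m \<otimes>\<^bsub>?M\<^esub> n) \<le> nrm ?M m * nrm ?M n"
    if m: "m \<in> carrier ?M" and n: "n \<in> carrier ?M" for m n
  proof (rule multiplier_nrm_le)
    fix x assume x: "x \<in> carrier A"
    have "nrm A (fst m (fst n x)) \<le> nrm ?M m * nrm A (fst n x)"
      using m n x by (simp add: multiplier_bound)
    also have "\<dots> \<le> nrm ?M m * (nrm ?M n * nrm A x)"
      using m n x by (intro mult_left_mono multiplier_bound multiplier_nrm_nonneg) auto
    finally show "nrm A (fst (m \<otimes>\<^bsub>?M\<^esub> n) x) \<le> nrm ?M m * nrm ?M n * nrm A x"
      using x by (simp add: mult.assoc)
  qed (use m n in \<open>simp add: multiplier_nrm_nonneg\<close>)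
  have nrm_scale_le: "nrm ?M (c \<odot>\<^bsub>?M\<^esub> m) \<le> cmod c * nrm ?M m" if m: "m \<in> carrier ?M" for c m
    by (rule multiplier_nrm_le)
      (use m multiplier_bound[OF m] in \<open>simp_all add: nrm_scale mult.assoc mult_left_mono multiplier_nrm_nonneg\<close>)
  have sq_le: "(nrm ?M m)\<^sup>2 \<le> nrm ?M (star ?M m \<otimes>\<^bsub>?M\<^esub> m)" if m: "m \<in> carrier ?M" for m
  proof -
    let ?N = "nrm ?M (star ?M m \<otimes>\<^bsub>?M\<^esub> m)"
    have N: "0 \<le> ?N"
      using m by (intro multiplier_nrm_nonneg) simp
    have "nrm ?M m \<le> sqrt ?N"
    proof (rule multiplier_nrm_le)
      fix x assume x: "x \<in> carrier A"
      have "(nrm A (fst m x))\<^sup>2 = nrm A (star A (fst m x) \<otimes> fst m x)"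
        using m x by (simp add: cstar_identity)
      also have "\<dots> = nrm A (snd m (star A (fst m x)) \<otimes> x)"
        using m x multiplierD(11)[OF m, of "star A (fst m x)" x] by simp
      also have "\<dots> \<le> nrm A (snd m (star A (fst m x))) * nrm A x"
        using m x by (intro nrm_mult) auto
      also have "nrm A (snd m (star A (fst m x))) = nrm A (fst (star ?M m \<otimes>\<^bsub>?M\<^esub> m) x)"
        using m x by simp
      also have "\<dots> * nrm A x \<le> (?N * nrm A x) * nrm A x"
        using m x by (intro mult_right_mono multiplier_bound) (auto simp: nrm_nonneg)
      also have "\<dots> = (sqrt ?N * nrm A x)\<^sup>2"
        unfolding power_mult_distrib real_sqrt_pow2[OF N] by (simp add: power2_eq_square)
      finally have "(nrm A (fst m x))\<^sup>2 \<le> (sqrt ?N * nrm A x)\<^sup>2" .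
      then show "nrm A (fst m x) \<le> sqrt ?N * nrm A x"
        by (rule power2_le_imp_le) (use N x in \<open>simp add: nrm_nonneg\<close>)
    qed (use N in simp)
    then have "(nrm ?M m)\<^sup>2 \<le> (sqrt ?N)\<^sup>2"
      by (rule power_mono) (use m in \<open>simp add: multiplier_nrm_nonneg\<close>)
    then show ?thesis
      using N by simp
  qed
  have star_star': "star ?M (star ?M m) = m" if m: "m \<in> carrier ?M" for m
    by (rule multiplier_eqI[where C = A]) (use m in \<open>simp_all add: star_star\<close>)
  have nrm_star': "nrm ?M (star ?M m) = nrm ?M m" if m: "m \<in> carrier ?M" for m
  proof -
    have le: "nrm ?M n \<le> nrm ?M (star ?M n)" if n: "n \<in> carrier ?M" for n
    proof (rule le_of_square_le_mult)
      show "(nrm ?M n)\<^sup>2 \<le> nrm ?M (star ?M n) * nrm ?M n"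
        using sq_le[OF n] nrm_mult'[of "star ?M n" n] n by (auto intro: order_trans)
    qed (use n in \<open>simp_all add: multiplier_nrm_nonneg\<close>)
    show ?thesis
      using le[OF m] le[of "star ?M m"] m by (simp add: star_star')
  qed
  show ?thesis
  proof (intro pre_cstar_algebra.intro group pre_cstar_algebra_axioms.intro)
    fix m assume m: "m \<in> carrier ?M"
    show "0 \<le> nrm ?M m"
      using m by (rule multiplier_nrm_nonneg)
    show "nrm ?M (star ?M m \<otimes>\<^bsub>?M\<^esub> m) = (nrm ?M m)\<^sup>2"
      using sq_le[OF m] nrm_mult'[of "star ?M m" m] m by (simp add: nrm_star' power2_eq_square)
    show "(nrm ?M m = 0) = (m = \<zero>\<^bsub>?M\<^esub>)"
    proof
      assume *: "nrm ?M m = 0"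
      have L: "fst m x = \<zero>" if "x \<in> carrier A" for x
        using multiplier_bound[OF m that] nrm_nonneg[of "fst m x"] m that * by (simp add: nrm_eq_zero_iff)
      have R: "snd m x = \<zero>" if x: "x \<in> carrier A" for x
        by (rule right_faithful) (use x m L multiplierD(11)[OF m x] in auto)
      show "m = \<zero>\<^bsub>?M\<^esub>"
        by (rule multiplier_eqI[where C = A]) (use m L R in auto)
    next
      assume "m = \<zero>\<^bsub>?M\<^esub>"
      then show "nrm ?M m = 0"
        using multiplier_nrm_le[of 0 m] multiplier_nrm_nonneg[OF m] by auto
    qed
    show "nrm ?M (c \<odot>\<^bsub>?M\<^esub> m) = cmod c * nrm ?M m" for c
    proof (rule homogeneousI[OF nrm_scale_le[OF m]])
      assume "c \<noteq> 0"
      then have "inverse c \<odot>\<^bsub>?M\<^esub> (c \<odot>\<^bsub>?M\<^esub> m) = m"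
        by (intro multiplier_eqI[where C = A]) (use m in \<open>simp_all add: scale_one flip: scale_scale\<close>)
      then show "nrm ?M m \<le> cmod (inverse c) * nrm ?M (c \<odot>\<^bsub>?M\<^esub> m)"
        using nrm_scale_le[of "c \<odot>\<^bsub>?M\<^esub> m" "inverse c"] m by simp
    qed (use m in \<open>simp add: multiplier_nrm_nonneg\<close>)
    show "1 \<odot>\<^bsub>?M\<^esub> m = m"
      by (rule multiplier_eqI[where C = A]) (use m in \<open>simp_all add: scale_one\<close>)
    show "(c + d) \<odot>\<^bsub>?M\<^esub> m = c \<odot>\<^bsub>?M\<^esub> m \<oplus>\<^bsub>?M\<^esub> d \<odot>\<^bsub>?M\<^esub> m" for c d
      by (rule multiplier_eqI[where C = A]) (use m in \<open>simp_all add: scale_add_left\<close>)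
    show "(c * d) \<odot>\<^bsub>?M\<^esub> m = c \<odot>\<^bsub>?M\<^esub> (d \<odot>\<^bsub>?M\<^esub> m)" for c d
      by (rule multiplier_eqI[where C = A]) (use m in \<open>simp_all add: scale_scale\<close>)
    show "star ?M (c \<odot>\<^bsub>?M\<^esub> m) = cnj c \<odot>\<^bsub>?M\<^esub> star ?M m" for c
      by (rule multiplier_eqI[where C = A]) (use m in \<open>simp_all add: star_scale multiplierD(7,8)[OF m]\<close>)
    fix n assume n: "n \<in> carrier ?M"
    show "c \<odot>\<^bsub>?M\<^esub> (m \<oplus>\<^bsub>?M\<^esub> n) = c \<odot>\<^bsub>?M\<^esub> m \<oplus>\<^bsub>?M\<^esub> c \<odot>\<^bsub>?M\<^esub> n" for c
      by (rule multiplier_eqI[where C = A]) (use m n in \<open>simp_all add: scale_add_right\<close>)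
    show "(c \<odot>\<^bsub>?M\<^esub> m) \<otimes>\<^bsub>?M\<^esub> n = c \<odot>\<^bsub>?M\<^esub> (m \<otimes>\<^bsub>?M\<^esub> n)" for c
      by (rule multiplier_eqI[where C = A]) (use m n in \<open>simp_all add: multiplierD(7,8)[OF n]\<close>)
    show "m \<otimes>\<^bsub>?M\<^esub> (c \<odot>\<^bsub>?M\<^esub> n) = c \<odot>\<^bsub>?M\<^esub> (m \<otimes>\<^bsub>?M\<^esub> n)" for c
      by (rule multiplier_eqI[where C = A]) (use m n in \<open>simp_all add: multiplierD(7,8)[OF m]\<close>)
    show "star ?M (m \<oplus>\<^bsub>?M\<^esub> n) = star ?M m \<oplus>\<^bsub>?M\<^esub> star ?M n"
      by (rule multiplier_eqI[where C = A]) (use m n in \<open>simp_all add: star_add\<close>)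
    show "star ?M (m \<otimes>\<^bsub>?M\<^esub> n) = star ?M n \<otimes>\<^bsub>?M\<^esub> star ?M m"
      by (rule multiplier_eqI[where C = A]) (use m n in \<open>simp_all add: star_star\<close>)
    show "nrm ?M (m \<oplus>\<^bsub>?M\<^esub> n) \<le> nrm ?M m + nrm ?M n"
    proof (rule multiplier_nrm_le)
      fix x assume x: "x \<in> carrier A"
      show "nrm A (fst (m \<oplus>\<^bsub>?M\<^esub> n) x) \<le> (nrm ?M m + nrm ?M n) * nrm A x"
        using m n x nrm_triangle[of "fst m x" "fst n x"] multiplier_bound[OF m x] multiplier_bound[OF n x]
        by (simp add: distrib_right)
    qed (use m n in \<open>simp add: multiplier_nrm_nonneg\<close>)
    show "nrm ?M (m \<otimes>\<^bsub>?M\<^esub> n) \<le> nrm ?M m * nrm ?M n"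
      using m n by (rule nrm_mult')
    fix k assume k: "k \<in> carrier ?M"
    show "m \<otimes>\<^bsub>?M\<^esub> n \<otimes>\<^bsub>?M\<^esub> k = m \<otimes>\<^bsub>?M\<^esub> (n \<otimes>\<^bsub>?M\<^esub> k)"
      by (rule multiplier_eqI[where C = A]) (use m n k in simp_all)
    show "(m \<oplus>\<^bsub>?M\<^esub> n) \<otimes>\<^bsub>?M\<^esub> k = m \<otimes>\<^bsub>?M\<^esub> k \<oplus>\<^bsub>?M\<^esub> n \<otimes>\<^bsub>?M\<^esub> k"
      by (rule multiplier_eqI[where C = A]) (use m n k in \<open>simp_all add: multiplierD(5,6)[OF k]\<close>)
    show "m \<otimes>\<^bsub>?M\<^esub> (n \<oplus>\<^bsub>?M\<^esub> k) = m \<otimes>\<^bsub>?M\<^esub> n \<oplus>\<^bsub>?M\<^esub> m \<otimes>\<^bsub>?M\<^esub> k"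
      by (rule multiplier_eqI[where C = A]) (use m n k in \<open>simp_all add: multiplierD(5,6)[OF m]\<close>)
  qed (simp_all add: star_star')
qed

lemma multiplier_minus:
  assumes "m \<in> carrier (multiplier_alg A)" "n \<in> carrier (multiplier_alg A)" "x \<in> carrier A"
  shows "fst (m \<ominus>\<^bsub>multiplier_alg A\<^esub> n) x = fst m x \<ominus> fst n x"
    and "snd (m \<ominus>\<^bsub>multiplier_alg A\<^esub> n) x = snd m x \<ominus> snd n x"
proof -
  interpret M: pre_cstar_algebra "multiplier_alg A"
    by (rule pre_cstar_algebra_multiplier)
  show "fst (m \<ominus>\<^bsub>multiplier_alg A\<^esub> n) x = fst m x \<ominus> fst n x"
    and "snd (m \<ominus>\<^bsub>multiplier_alg A\<^esub> n) x = snd m x \<ominus> snd n x"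
    using assms by (simp_all add: a_minus_def M.minus_eq_scale minus_eq_scale multiplier_apply multiplierD)
qed

lemma multiplier_bound_snd:
  assumes m: "m \<in> carrier (multiplier_alg A)" and x: "x \<in> carrier A"
  shows "nrm A (snd m x) \<le> nrm (multiplier_alg A) m * nrm A x"
proof -
  interpret M: pre_cstar_algebra "multiplier_alg A"
    by (rule pre_cstar_algebra_multiplier)
  show ?thesis
    using multiplier_bound[of "star (multiplier_alg A) m" "star A x"] m x
    by (simp add: multiplier_apply star_star multiplierD)
qed

text \<open>
  The limit of a Cauchy sequence is the pair of pointwise limits of the left and of the right actions; the
  exchange identity passes to the limit.
\<close>

lemma cstar_algebra_multiplier: "cstar_algebra (multiplier_alg A)"
proof -
  let ?M = "multiplier_alg A"
  interpret M: pre_cstar_algebra ?M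
    by (rule pre_cstar_algebra_multiplier)
  show ?thesis
  proof (rule M.cstar_algebraI)
    fix s assume s: "cauchy ?M s"
    then have sc: "s n \<in> carrier ?M" for n
      by (auto simp: cauchy_def)
    have "\<exists>l. tends A (\<lambda>n. fst (s n) x) l" if x: "x \<in> carrier A" for x
    proof (rule cauchy_tends, rule cauchy_comparison[OF s])
      show "nrm A (fst (s m) x \<ominus> fst (s n) x) \<le> nrm A x * nrm ?M (s m \<ominus>\<^bsub>?M\<^esub> s n)" for m n
        using multiplier_bound[of "s m \<ominus>\<^bsub>?M\<^esub> s n" x] sc x
        by (simp add: multiplier_minus mult.commute)
    qed (use sc x in \<open>auto simp: multiplierD nrm_nonneg\<close>)
    then obtain L where L: "\<And>x. x \<in> carrier A \<Longrightarrow> tends A (\<lambda>n. fst (s n) x) (L x)"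
      by metis
    have "\<exists>l. tends A (\<lambda>n. snd (s n) x) l" if x: "x \<in> carrier A" for x
    proof (rule cauchy_tends, rule cauchy_comparison[OF s])
      show "nrm A (snd (s m) x \<ominus> snd (s n) x) \<le> nrm A x * nrm ?M (s m \<ominus>\<^bsub>?M\<^esub> s n)" for m n
        using multiplier_bound_snd[of "s m \<ominus>\<^bsub>?M\<^esub> s n" x] sc x
        by (simp add: multiplier_minus mult.commute)
    qed (use sc x in \<open>auto simp: multiplierD nrm_nonneg\<close>)
    then obtain R where R: "\<And>x. x \<in> carrier A \<Longrightarrow> tends A (\<lambda>n. snd (s n) x) (R x)"
      by metis
    define l where "l = (restrict L (carrier A), restrict R (carrier A))"
    obtain N0 where N0: "\<forall>m\<ge>N0. \<forall>n\<ge>N0. nrm ?M (s m \<ominus>\<^bsub>?M\<^esub> s n) < 1"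
      using s unfolding cauchy_def by (meson zero_less_one)
    have lc: "l \<in> carrier ?M"
    proof (rule multiplierI)
      fix x assume x: "x \<in> carrier A"
      have "nrm A (L x) \<le> (nrm ?M (s N0) + 1) * nrm A x"
      proof (rule LIMSEQ_le_const2[OF tends_nrm[OF L[OF x]]], intro exI allI impI)
        fix n assume "n \<ge> N0"
        with N0 have "nrm ?M (s n \<ominus>\<^bsub>?M\<^esub> s N0) < 1"
          by auto
        then have "nrm ?M (s n) \<le> nrm ?M (s N0) + 1"
          using M.nrm_reverse_triangle[of "s n" "s N0"] sc by simp
        then have "nrm ?M (s n) * nrm A x \<le> (nrm ?M (s N0) + 1) * nrm A x"
          using x by (intro mult_right_mono) (auto simp: nrm_nonneg)
        then show "nrm A (fst (s n) x) \<le> (nrm ?M (s N0) + 1) * nrm A x"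
          using multiplier_bound[OF sc[of n] x] by linarith
      qed
      then show "nrm A (fst l x) \<le> (nrm ?M (s N0) + 1) * nrm A x"
        using x by (simp add: l_def)
    next
      fix x y assume x: "x \<in> carrier A" and y: "y \<in> carrier A"
      have "tends A (\<lambda>n. x \<otimes> fst (s n) y) (x \<otimes> L y)"
        using x y by (intro tends_mult tends_const L)
      moreover have "tends A (\<lambda>n. snd (s n) x \<otimes> y) (R x \<otimes> y)"
        using x y by (intro tends_mult tends_const R)
      ultimately show "x \<otimes> fst l y = snd l x \<otimes> y"
        using multiplierD(11)[OF sc x y] x y tends_unique by (simp add: l_def)
    qed (use L R in \<open>auto simp: l_def dest: tends_closed\<close>)
    have "tends ?M s l"
      unfolding M.tends_iff
    proof (intro conjI allI impI)
      fix e :: real assume "e > 0"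
      then obtain N where N: "\<forall>m\<ge>N. \<forall>n\<ge>N. nrm ?M (s m \<ominus>\<^bsub>?M\<^esub> s n) < e / 2"
        using s unfolding cauchy_def by (meson half_gt_zero)
      show "\<exists>N. \<forall>n\<ge>N. nrm ?M (s n \<ominus>\<^bsub>?M\<^esub> l) < e"
      proof (intro exI allI impI)
        fix n assume n: "n \<ge> N"
        have "nrm ?M (s n \<ominus>\<^bsub>?M\<^esub> l) \<le> e / 2"
        proof (rule multiplier_nrm_le)
          fix x assume x: "x \<in> carrier A"
          have snx: "fst (s n) x \<in> carrier A"
            using sc x by (simp add: multiplierD)
          have "nrm A (fst (s n) x \<ominus> fst (s k) x) \<le> e / 2 * nrm A x" if "k \<ge> N" for k
          proof -
            have "nrm A (fst (s n) x \<ominus> fst (s k) x) \<le> nrm ?M (s n \<ominus>\<^bsub>?M\<^esub> s k) * nrm A x"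
              using multiplier_bound[of "s n \<ominus>\<^bsub>?M\<^esub> s k" x] sc x by (simp add: multiplier_minus)
            also have "\<dots> \<le> e / 2 * nrm A x"
              using N n that x by (intro mult_right_mono) (auto simp: nrm_nonneg less_imp_le)
            finally show ?thesis .
          qed
          moreover have "(\<lambda>k. nrm A (fst (s n) x \<ominus> fst (s k) x)) \<longlonglongrightarrow> nrm A (fst (s n) x \<ominus> L x)"
          proof (rule tends_nrm)
            have "tends A (\<lambda>k. fst (s n) x \<oplus> (-1) \<odot> fst (s k) x) (fst (s n) x \<oplus> (-1) \<odot> L x)"
              by (intro tends_add tends_const tends_scale L x snx)
            then show "tends A (\<lambda>k. fst (s n) x \<ominus> fst (s k) x) (fst (s n) x \<ominus> L x)"
              using sc x tends_closed(1)[OF L[OF x]]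
              by (simp add: a_minus_def minus_eq_scale multiplierD)
          qed
          ultimately have "nrm A (fst (s n) x \<ominus> L x) \<le> e / 2 * nrm A x"
            by (intro LIMSEQ_le_const2) auto
          then show "nrm A (fst (s n \<ominus>\<^bsub>?M\<^esub> l) x) \<le> e / 2 * nrm A x"
            using sc lc x by (simp add: multiplier_minus l_def)
        qed (use \<open>e > 0\<close> in simp)
        then show "nrm ?M (s n \<ominus>\<^bsub>?M\<^esub> l) < e"
          using \<open>e > 0\<close> by simp
      qed
    qed (use lc sc in auto)
    then show "\<exists>l. tends ?M s l"
      by blast
  qed
qed

end

section \<open>Contractivity of *-homomorphisms\<close>

lemma star_homD:
  assumes "\<Phi> \<in> star_hom A D"
  shows "x \<in> carrier A \<Longrightarrow> \<Phi> x \<in> carrier D"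
    and "\<Phi> \<in> extensional (carrier A)"
    and "\<lbrakk>x \<in> carrier A; y \<in> carrier A\<rbrakk> \<Longrightarrow> \<Phi> (x \<oplus>\<^bsub>A\<^esub> y) = \<Phi> x \<oplus>\<^bsub>D\<^esub> \<Phi> y"
    and "\<lbrakk>x \<in> carrier A; y \<in> carrier A\<rbrakk> \<Longrightarrow> \<Phi> (x \<otimes>\<^bsub>A\<^esub> y) = \<Phi> x \<otimes>\<^bsub>D\<^esub> \<Phi> y"
    and "x \<in> carrier A \<Longrightarrow> \<Phi> (c \<odot>\<^bsub>A\<^esub> x) = c \<odot>\<^bsub>D\<^esub> \<Phi> x"
    and "x \<in> carrier A \<Longrightarrow> \<Phi> (star A x) = star D (\<Phi> x)"
  using assms by (auto simp: star_hom_def PiE_def)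

definition unital :: "('a, 'm) cstar_scheme \<Rightarrow> bool" where
  "unital A \<longleftrightarrow> \<one>\<^bsub>A\<^esub> \<in> carrier A \<and> (\<forall>x\<in>carrier A. \<one>\<^bsub>A\<^esub> \<otimes>\<^bsub>A\<^esub> x = x \<and> x \<otimes>\<^bsub>A\<^esub> \<one>\<^bsub>A\<^esub> = x)"

lemma (in cstar_algebra) unital_multiplier: "unital (multiplier_alg A)"
  unfolding unital_def
proof (intro conjI ballI)
  fix m assume m: "m \<in> carrier (multiplier_alg A)"
  note [simp] = multiplier_apply multiplier_closed multiplier_zero_one_closed multiplierD(3,4)[OF m]
  show "\<one>\<^bsub>multiplier_alg A\<^esub> \<otimes>\<^bsub>multiplier_alg A\<^esub> m = m"
    by (rule multiplier_eqI[where C = A]) (use m in simp_all)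
  show "m \<otimes>\<^bsub>multiplier_alg A\<^esub> \<one>\<^bsub>multiplier_alg A\<^esub> = m"
    by (rule multiplier_eqI[where C = A]) (use m in simp_all)
qed (rule multiplier_zero_one_closed)

lemma (in pre_cstar_algebra) add_diff_add_left:
  assumes "x \<in> carrier A" "y \<in> carrier A" "z \<in> carrier A"
  shows "(x \<oplus> y) \<ominus> (x \<oplus> z) = y \<ominus> z"
proof -
  have "(x \<oplus> y) \<ominus> (x \<oplus> z) = (x \<ominus> x) \<oplus> (y \<ominus> z)"
    using assms by (simp add: a_minus_def minus_add a_ac)
  then show ?thesis
    using assms by simp
qed

context cstar_algebra
begin

context
  assumes unital: "unital A"
begin

lemma unital_one [simp]: "\<one> \<in> carrier A" "x \<in> carrier A \<Longrightarrow> \<one> \<otimes> x = x" "x \<in> carrier A \<Longrightarrow> x \<otimes> \<one> = x"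
  using unital by (auto simp: unital_def)

lemma star_one [simp]: "star A \<one> = \<one>"
  using star_mult[of "star A \<one>" \<one>] by (simp add: star_star)

lemma nrm_one_le: "nrm A \<one> \<le> 1"
  using cstar_identity[of \<one>] by (auto simp: power2_eq_square)

text \<open>
  With \<open>k = 1 - z\<close> the equation \<open>k\<^sup>2 = 1 - h\<^sup>2\<close> becomes the fixed point equation \<open>z = (h\<^sup>2 + z\<^sup>2) / 2\<close>. The right
  hand side maps the ball of radius \<open>s = \<parallel>h\<parallel>\<^sup>2 < 1\<close> into itself and contracts it by the factor \<open>s\<close>, so its
  iterates from 0 converge; being polynomials in \<open>h\<close>, they are selfadjoint and commute with \<open>h\<close>.
\<close>

lemma square_root:
  assumes h: "h \<in> carrier A" "star A h = h" "nrm A h < 1"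
  obtains k where "k \<in> carrier A" "star A k = k" "k \<otimes> h = h \<otimes> k" "k \<otimes> k = \<one> \<ominus> h \<otimes> h"
proof -
  define s where "s = (nrm A h)\<^sup>2"
  define y where "y = rec_nat \<zero> (\<lambda>_ z. (1/2) \<odot> (h \<otimes> h \<oplus> z \<otimes> z))"
  have y_0: "y 0 = \<zero>" and y_Suc: "y (Suc n) = (1/2) \<odot> (h \<otimes> h \<oplus> y n \<otimes> y n)" for n
    by (simp_all add: y_def)
  have s: "0 \<le> s" "s < 1"
    using h nrm_nonneg[of h] by (simp_all add: s_def power_less_one_iff)
  have hh: "nrm A (h \<otimes> h) = s"
    using cstar_identity[of h] h by (simp add: s_def)
  have yc [simp]: "y n \<in> carrier A" for n
    by (induction n) (use h in \<open>simp_all add: y_0 y_Suc\<close>)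
  have y_star: "star A (y n) = y n" for n
    by (induction n) (use h in \<open>simp_all add: y_0 y_Suc star_scale star_add star_mult\<close>)
  have y_comm: "y n \<otimes> h = h \<otimes> y n" for n
  proof (induction n)
    case (Suc n)
    have "(y n \<otimes> y n) \<otimes> h = h \<otimes> (y n \<otimes> y n)"
      using h Suc by (metis mult_assoc yc)
    then show ?case
      using h by (simp add: y_Suc scale_mult_left scale_mult_right mult_add_left mult_add_right mult_assoc)
  qed (use h in \<open>simp add: y_0\<close>)
  have y_le: "nrm A (y n) \<le> s" for n
  proof (induction n)
    case (Suc n)
    have "nrm A (y n \<otimes> y n) \<le> nrm A (y n) * nrm A (y n)"
      by (rule nrm_mult) simp_all
    also have "\<dots> \<le> s * 1"
      using Suc s by (intro mult_mono) (auto simp: nrm_nonneg)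
    finally have "nrm A (h \<otimes> h \<oplus> y n \<otimes> y n) \<le> s + s"
      using h nrm_triangle[of "h \<otimes> h" "y n \<otimes> y n"] hh by simp
    then show ?case
      using h by (simp add: y_Suc nrm_scale)
  qed (use s in \<open>simp add: y_0\<close>)
  have contraction: "nrm A (y (Suc m) \<ominus> y (Suc n)) \<le> s * nrm A (y m \<ominus> y n)" for m n
  proof -
    have "y (Suc m) \<ominus> y (Suc n) = (1/2) \<odot> (y m \<otimes> y m \<ominus> y n \<otimes> y n)"
      using h by (simp add: y_Suc add_diff_add_left flip: scale_diff)
    also have "y m \<otimes> y m \<ominus> y n \<otimes> y n = y m \<otimes> (y m \<ominus> y n) \<oplus> (y m \<ominus> y n) \<otimes> y n"
      using diff_diff_telescope[of "y m \<otimes> y m" "y m \<otimes> y n" "y n \<otimes> y n"]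
      by (simp add: mult_diff_left mult_diff_right)
    finally have "nrm A (y (Suc m) \<ominus> y (Suc n))
        \<le> 1/2 * (nrm A (y m \<otimes> (y m \<ominus> y n)) + nrm A ((y m \<ominus> y n) \<otimes> y n))"
      by (simp add: nrm_scale nrm_triangle)
    also have "\<dots> \<le> 1/2 * (nrm A (y m) * nrm A (y m \<ominus> y n) + nrm A (y m \<ominus> y n) * nrm A (y n))"
      by (intro mult_left_mono add_mono nrm_mult) simp_all
    also have "\<dots> \<le> 1/2 * (s * nrm A (y m \<ominus> y n) + nrm A (y m \<ominus> y n) * s)"
      by (intro mult_left_mono add_mono mult_right_mono y_le) (simp_all add: nrm_nonneg)
    finally show ?thesis
      by simp
  qed
  \<comment> \<open>Contracting \<open>n\<close> times reduces the distance of two iterates to that of an iterate from 0.\<close>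
  have geometric: "nrm A (y (n + k) \<ominus> y n) \<le> s ^ n" for n k
  proof (induction n)
    case 0
    then show ?case
      using y_le[of k] s by (simp add: y_0 a_minus_def minus_eq_scale[of \<zero>])
  next
    case (Suc n)
    then show ?case
      using contraction[of "n + k" n] mult_left_mono[OF Suc s(1)] by simp
  qed
  have "cauchy A y"
    unfolding cauchy_def
  proof (intro conjI allI impI)
    fix e :: real assume "e > 0"
    obtain N where N: "s ^ N < e / 2"
      using real_arch_pow_inv[of "e / 2" s] \<open>e > 0\<close> s by auto
    show "\<exists>N. \<forall>m\<ge>N. \<forall>n\<ge>N. nrm A (y m \<ominus> y n) < e"
    proof (intro exI allI impI)
      fix m n assume "m \<ge> N" "n \<ge> N"
      then have "nrm A (y m \<ominus> y N) \<le> s ^ N" "nrm A (y n \<ominus> y N) \<le> s ^ N"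
        using geometric[of N "m - N"] geometric[of N "n - N"] by simp_all
      then show "nrm A (y m \<ominus> y n) < e"
        using N nrm_diff_triangle[of "y m" "y N" "y n"] nrm_diff_commute[of "y n" "y N"] by simp
    qed
  qed auto
  then obtain z where z: "tends A y z"
    using cauchy_tends by blast
  then have zc [simp]: "z \<in> carrier A"
    by (rule tends_closed)
  have "tends A (\<lambda>n. y (Suc n)) z"
    using z LIMSEQ_Suc[OF tends_lim[OF z]] by (auto simp: tends_def)
  moreover have "tends A (\<lambda>n. y (Suc n)) ((1/2) \<odot> (h \<otimes> h \<oplus> z \<otimes> z))"
    unfolding y_Suc using h by (intro tends_scale tends_add tends_mult tends_const z) simp
  ultimately have fix_z: "z = (1/2) \<odot> (h \<otimes> h \<oplus> z \<otimes> z)"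
    by (rule tends_unique)
  have z_star: "star A z = z"
    using tends_unique[OF z, of "star A z"] tends_star[OF z] by (simp add: y_star)
  have z_comm: "z \<otimes> h = h \<otimes> z"
    using tends_unique[of "\<lambda>n. y n \<otimes> h"] tends_mult[OF z tends_const[of h]]
      tends_mult[OF tends_const[of h] z] h by (simp add: y_comm)
  have two_z: "z \<oplus> z = h \<otimes> h \<oplus> z \<otimes> z"
  proof -
    have "z \<oplus> z = (1/2 + 1/2) \<odot> (h \<otimes> h \<oplus> z \<otimes> z)"
      using fix_z h by (metis scale_add_left a_closed mult_closed zc)
    then show ?thesis
      using h by (simp add: scale_one)
  qed
  show ?thesis
  proof (rule that[of "\<one> \<ominus> z"])
    show "(\<one> \<ominus> z) \<otimes> h = h \<otimes> (\<one> \<ominus> z)"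
      using h by (simp add: mult_diff_left mult_diff_right z_comm)
    have "(\<one> \<ominus> z) \<otimes> (\<one> \<ominus> z) = \<one> \<ominus> (z \<oplus> z) \<oplus> z \<otimes> z"
      by (simp add: mult_diff_left mult_diff_right) (simp add: a_minus_def minus_add a_ac)
    also have "\<dots> = (\<one> \<ominus> h \<otimes> h) \<oplus> (z \<otimes> z \<ominus> z \<otimes> z)"
      unfolding two_z using h by (simp add: a_minus_def minus_add a_ac)
    also have "\<dots> = \<one> \<ominus> h \<otimes> h"
      using h by simp
    finally show "(\<one> \<ominus> z) \<otimes> (\<one> \<ominus> z) = \<one> \<ominus> h \<otimes> h" .
  qed (simp_all add: star_diff z_star)
qed

text \<open>
  By the C*-identity it is enough to treat selfadjoint \<open>h\<close>, and by scaling those with \<open>\<parallel>h\<parallel> < 1\<close>. Then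
  \<open>h = (u + u\<^sup>*) / 2\<close> for \<open>u = h + i k\<close> with \<open>k = (1 - h\<^sup>2)\<^sup>1\<^sup>/\<^sup>2\<close>. Since \<open>u\<^sup>* u = 1\<close>, the image of \<open>u\<close> has norm at most 1,
  and so does the image of \<open>h\<close>.
\<close>

lemma star_hom_contractive:
  assumes "cstar_algebra D" and \<Phi>: "\<Phi> \<in> star_hom A D" and a: "a \<in> carrier A"
  shows "nrm D (\<Phi> a) \<le> nrm A a"
proof -
  interpret D: cstar_algebra D by fact
  note hom = star_homD[OF \<Phi>]
  have "(nrm D (\<Phi> \<one>))\<^sup>2 = nrm D (\<Phi> \<one>)"
    using hom(4)[of "star A \<one>" \<one>] hom(6)[of \<one>] D.cstar_identity[of "\<Phi> \<one>"] hom(1) by simp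
  then have one_le: "nrm D (\<Phi> \<one>) \<le> 1"
    by (auto simp: power2_eq_square)
  have unit_ball: "nrm D (\<Phi> h) \<le> 1" if h: "h \<in> carrier A" "star A h = h" "nrm A h < 1" for h
  proof -
    obtain k where k: "k \<in> carrier A" "star A k = k" "k \<otimes> h = h \<otimes> k" "k \<otimes> k = \<one> \<ominus> h \<otimes> h"
      using square_root[OF h] by blast
    define u where "u = h \<oplus> \<i> \<odot> k"
    have u [simp]: "u \<in> carrier A"
      using h k by (simp add: u_def)
    have star_u: "star A u = h \<oplus> (- \<i>) \<odot> k"
      using h k by (simp add: u_def star_add star_scale)
    have "star A u \<otimes> u = h \<otimes> h \<oplus> (\<i> \<odot> (h \<otimes> k) \<oplus> (- \<i>) \<odot> (h \<otimes> k)) \<oplus> k \<otimes> k"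
      unfolding star_u unfolding u_def using h k
      by (simp add: mult_add_left mult_add_right scale_mult_left scale_mult_right scale_add_right a_ac
          scale_one flip: scale_scale)
    also have "\<dots> = \<one>"
      using h k by (simp add: a_minus_def a_ac r_neg r_neg1 r_neg2 flip: scale_add_left)
    finally have "nrm A (star A u \<otimes> u) \<le> 1" "star A u \<otimes> u = \<one>"
      using nrm_one_le by simp_all
    then have "(nrm D (\<Phi> u))\<^sup>2 \<le> 1"
      using D.cstar_identity[of "\<Phi> u"] hom(1,4,6) one_le by (metis star_closed u)
    then have u_le: "nrm D (\<Phi> u) \<le> 1"
      using power2_le_imp_le[of "nrm D (\<Phi> u)" 1] by simp
    have "(1/2) \<odot> (u \<oplus> star A u) = (1/2) \<odot> ((h \<oplus> h) \<oplus> (\<i> \<odot> k \<oplus> (- \<i>) \<odot> k))"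
      unfolding star_u unfolding u_def using h k by (simp add: a_ac)
    also have "\<dots> = h"
      using h k by (simp add: scale_add_right scale_one flip: scale_add_left)
    finally have "\<Phi> h = (1/2) \<odot>\<^bsub>D\<^esub> (\<Phi> u \<oplus>\<^bsub>D\<^esub> star D (\<Phi> u))"
      using hom(3,5,6) by (metis star_closed u a_closed)
    then have "nrm D (\<Phi> h) \<le> 1/2 * (nrm D (\<Phi> u) + nrm D (\<Phi> u))"
      using hom(1)[OF u] D.nrm_triangle[of "\<Phi> u" "star D (\<Phi> u)"] by (simp add: D.nrm_scale)
    then show ?thesis
      using u_le by simp
  qed
  have selfadjoint: "nrm D (\<Phi> h) \<le> nrm A h" if h: "h \<in> carrier A" "star A h = h" for h
  proof (rule dense_ge)
    fix t assume t: "nrm A h < t"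
    then have "t > 0"
      using h nrm_nonneg[of h] by simp
    have "nrm D (\<Phi> (complex_of_real (1/t) \<odot> h)) \<le> 1"
      using h t \<open>t > 0\<close> by (intro unit_ball) (simp_all add: star_scale nrm_scale norm_divide)
    then show "nrm D (\<Phi> h) \<le> t"
      using h hom(1)[of h] \<open>t > 0\<close> by (simp add: hom(5) D.nrm_scale norm_divide field_simps)
  qed
  have "(nrm D (\<Phi> a))\<^sup>2 = nrm D (\<Phi> (star A a \<otimes> a))"
    using a hom D.cstar_identity[of "\<Phi> a"] by simp
  also have "\<dots> \<le> (nrm A a)\<^sup>2"
    using selfadjoint[of "star A a \<otimes> a"] a cstar_identity[of a] by (simp add: star_mult star_star)
  finally show ?thesis
    by (rule power2_le_imp_le) (use a in \<open>simp add: nrm_nonneg\<close>)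
qed

end

end

section \<open>The free *-algebra\<close>

lemma poly_mapping_eq_sum_single:
  fixes f :: "'a \<Rightarrow>\<^sub>0 'b::comm_monoid_add"
  shows "f = (\<Sum>k\<in>Poly_Mapping.keys f. Poly_Mapping.single k (Poly_Mapping.lookup f k))"
  by (rule poly_mapping_eqI)
    (auto simp: lookup_sum lookup_single when_def in_keys_iff sum.delta' sum.delta)

lemma poly_mapping_single_induct [case_names zero single add]:
  fixes f :: "'a \<Rightarrow>\<^sub>0 'b::comm_monoid_add"
  assumes "P 0" "\<And>k c. P (Poly_Mapping.single k c)" "\<And>f g. P f \<Longrightarrow> P g \<Longrightarrow> P (f + g)"
  shows "P f"
proof -
  have "P (\<Sum>k\<in>K. Poly_Mapping.single k (Poly_Mapping.lookup f k))" if "finite K" for K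
    using that by (induction K) (auto intro: assms)
  then show ?thesis
    by (subst poly_mapping_eq_sum_single) simp
qed

lemma letters_zero_plus [simp]: "letters 0 = []" "letters (u + v) = letters u @ letters v"
  by (simp_all add: zero_word_def plus_word_def)

lemma word_star_simps [simp]:
  "word_star (word_star w) = w" "word_star 0 = 0" "word_star (u + v) = word_star v + word_star u"
  by (simp_all add: word_star_def zero_word_def plus_word_def rev_map comp_def split_beta)

lemma lookup_sp_star: "Poly_Mapping.lookup (sp_star f) w = cnj (Poly_Mapping.lookup f (word_star w))"
proof -
  have eq: "word_star v = w \<longleftrightarrow> v = word_star w" for v
    by (metis word_star_simps(1))
  show ?thesis
    by (auto simp: sp_star_def lookup_sum lookup_single when_def eq sum.delta in_keys_iff)
qed

lemma sp_star_add: "sp_star (f + g) = sp_star f + sp_star g"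
  by (rule poly_mapping_eqI) (simp add: lookup_sp_star lookup_add)

lemma sp_star_single: "sp_star (Poly_Mapping.single w c) = Poly_Mapping.single (word_star w) (cnj c)"
  by (rule poly_mapping_eqI) (auto simp: lookup_sp_star lookup_single when_def)

lemma sp_star_zero [simp]: "sp_star 0 = 0"
  by (rule poly_mapping_eqI) (simp add: lookup_sp_star)

lemma sp_star_one [simp]: "sp_star 1 = 1"
  using sp_star_single[of 0 1] by simp

lemma sp_star_star [simp]: "sp_star (sp_star f) = f"
  by (rule poly_mapping_eqI) (simp add: lookup_sp_star)

lemma sp_star_diff: "sp_star (f - g) = sp_star f - sp_star g"
  by (rule poly_mapping_eqI) (simp add: lookup_sp_star lookup_minus)

lemma sp_star_mult: "sp_star (f * g) = sp_star g * sp_star f"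
proof (induction f rule: poly_mapping_single_induct)
  case (single u c)
  show ?case
    by (induction g rule: poly_mapping_single_induct)
      (simp_all add: mult_single sp_star_single sp_star_add distrib_left distrib_right mult.commute)
qed (simp_all add: sp_star_add distrib_left distrib_right)

lemma sp_scale_commute: "f * Poly_Mapping.single 0 c = Poly_Mapping.single 0 c * (f :: 'g star_poly)"
  by (induction f rule: poly_mapping_single_induct)
    (simp_all add: mult_single distrib_left distrib_right mult.commute)

lemma sp_scale_simps:
  "sp_scale c (f + g) = sp_scale c f + sp_scale c g"
  "sp_scale c (f - g) = sp_scale c f - sp_scale c g"
  "sp_scale (c + d) f = sp_scale c f + sp_scale d f"
  "sp_scale (c * d) f = sp_scale c (sp_scale d f)"
  "sp_scale 1 f = f"
  "sp_scale (-1) f = - f"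
  "sp_scale c f * g = sp_scale c (f * g)"
  "f * sp_scale c g = sp_scale c (f * g)"
  "sp_star (sp_scale c f) = sp_scale (cnj c) (sp_star f)"
proof -
  show "f * sp_scale c g = sp_scale c (f * g)"
    unfolding sp_scale_def by (metis mult.assoc sp_scale_commute)
  show "sp_star (sp_scale c f) = sp_scale (cnj c) (sp_star f)"
    unfolding sp_scale_def by (simp add: sp_star_mult sp_star_single sp_scale_commute)
  show "sp_scale (-1) f = - f"
    by (simp add: sp_scale_def single_uminus)
qed (simp_all add: sp_scale_def single_add mult_single algebra_simps flip: mult.assoc)

lemma sp_scale_single: "sp_scale c (Poly_Mapping.single w d) = Poly_Mapping.single w (c * d)"
  by (simp add: sp_scale_def mult_single)

lemma star_polys_single: "fst ` set (letters w) \<subseteq> X \<Longrightarrow> Poly_Mapping.single w c \<in> star_polys X"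
  by (auto simp: star_polys_def)

lemma star_polys_closed [simp, intro]:
  "0 \<in> star_polys X" "1 \<in> star_polys X"
  "f \<in> star_polys X \<Longrightarrow> g \<in> star_polys X \<Longrightarrow> f + g \<in> star_polys X"
  "f \<in> star_polys X \<Longrightarrow> g \<in> star_polys X \<Longrightarrow> f - g \<in> star_polys X"
  "f \<in> star_polys X \<Longrightarrow> g \<in> star_polys X \<Longrightarrow> f * g \<in> star_polys X"
  "f \<in> star_polys X \<Longrightarrow> - f \<in> star_polys X"
  "f \<in> star_polys X \<Longrightarrow> sp_scale c f \<in> star_polys X"
  "f \<in> star_polys X \<Longrightarrow> sp_star f \<in> star_polys X"
  "g' \<in> X \<Longrightarrow> sp_gen g' \<in> star_polys X"
proof -
  show mult: "f * g \<in> star_polys X" if "f \<in> star_polys X" "g \<in> star_polys X" for f g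
  proof -
    have "fst ` set (letters w) \<subseteq> X" if w: "w \<in> Poly_Mapping.keys (f * g)" for w
    proof -
      obtain u v where "w = u + v" "u \<in> Poly_Mapping.keys f" "v \<in> Poly_Mapping.keys g"
        using w keys_mult[of f g] by blast
      with \<open>f \<in> star_polys X\<close> \<open>g \<in> star_polys X\<close> show ?thesis
        by (auto simp: star_polys_def image_Un)
    qed
    then show ?thesis
      by (simp add: star_polys_def)
  qed
  show "f \<in> star_polys X \<Longrightarrow> sp_scale c f \<in> star_polys X"
    unfolding sp_scale_def by (intro mult star_polys_single) auto
  show "sp_star f \<in> star_polys X" if f: "f \<in> star_polys X"
  proof -
    have "fst ` set (letters w) \<subseteq> X" if "w \<in> Poly_Mapping.keys (sp_star f)" for w
    proof -
      have "word_star w \<in> Poly_Mapping.keys f"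
        using that by (simp add: in_keys_iff lookup_sp_star)
      with f have "fst ` set (letters (word_star w)) \<subseteq> X"
        by (auto simp: star_polys_def)
      then show ?thesis
        by (force simp: word_star_def)
    qed
    then show ?thesis
      by (simp add: star_polys_def)
  qed
  show "f \<in> star_polys X \<Longrightarrow> g \<in> star_polys X \<Longrightarrow> f + g \<in> star_polys X"
    "f \<in> star_polys X \<Longrightarrow> g \<in> star_polys X \<Longrightarrow> f - g \<in> star_polys X"
  proof -
    assume fg: "f \<in> star_polys X" "g \<in> star_polys X"
    have "Poly_Mapping.keys (f + g) \<subseteq> Poly_Mapping.keys f \<union> Poly_Mapping.keys g"
      "Poly_Mapping.keys (f - g) \<subseteq> Poly_Mapping.keys f \<union> Poly_Mapping.keys g"
      by (auto simp: in_keys_iff lookup_add lookup_minus)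
    with fg show "f + g \<in> star_polys X" "f - g \<in> star_polys X"
      unfolding star_polys_def by blast+
  qed
  show "f \<in> star_polys X \<Longrightarrow> - f \<in> star_polys X"
    by (auto simp: star_polys_def in_keys_iff)
qed (auto simp: star_polys_def sp_gen_def)

text \<open>
  The *-polynomials over \<open>X\<close> are generated by \<open>X\<close> as a unital *-algebra: a word is a product of letters,
  and a letter is a generator or its adjoint.
\<close>

lemma star_polys_induct [consumes 1, case_names one gen star scale add mult]:
  assumes f: "f \<in> star_polys X"
    and one: "P 1"
    and gen: "\<And>g. g \<in> X \<Longrightarrow> P (sp_gen g)"
    and star: "\<And>f. f \<in> star_polys X \<Longrightarrow> P f \<Longrightarrow> P (sp_star f)"
    and scale: "\<And>f c. f \<in> star_polys X \<Longrightarrow> P f \<Longrightarrow> P (sp_scale c f)"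
    and add: "\<And>f g. f \<in> star_polys X \<Longrightarrow> g \<in> star_polys X \<Longrightarrow> P f \<Longrightarrow> P g \<Longrightarrow> P (f + g)"
    and mult: "\<And>f g. f \<in> star_polys X \<Longrightarrow> g \<in> star_polys X \<Longrightarrow> P f \<Longrightarrow> P g \<Longrightarrow> P (f * g)"
  shows "P f"
proof -
  have word: "P (Poly_Mapping.single (Word ls) 1)" if "fst ` set ls \<subseteq> X" for ls
    using that
  proof (induction ls)
    case Nil
    then show ?case
      using one by (simp flip: zero_word_def)
  next
    case (Cons l ls)
    obtain g s where l: "l = (g, s)"
      by fastforce
    have letter: "P (Poly_Mapping.single (Word [l]) 1)"
    proof (cases s)
      case True
      have "Poly_Mapping.single (Word [l]) 1 = sp_star (sp_gen g)"
        by (simp add: sp_gen_def sp_star_single word_star_def l True)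
      then show ?thesis
        using Cons.prems l star[OF _ gen[of g]] by auto
    next
      case False
      then show ?thesis
        using Cons.prems l gen[of g] by (simp add: sp_gen_def)
    qed
    have eq: "Poly_Mapping.single (Word (l # ls)) (1 :: complex)
        = Poly_Mapping.single (Word [l]) 1 * Poly_Mapping.single (Word ls) 1"
      by (simp add: mult_single plus_word_def)
    show ?case
      unfolding eq
      by (rule mult) (use Cons letter l in \<open>auto intro!: star_polys_single simp: image_subset_iff\<close>)
  qed
  have single: "P (Poly_Mapping.single w c)" if "fst ` set (letters w) \<subseteq> X" for w c
    using scale[OF star_polys_single[of w X 1], of c] word[of "letters w"] that
    by (simp add: sp_scale_single)
  have "P (\<Sum>w\<in>K. Poly_Mapping.single w (Poly_Mapping.lookup f w)) \<and>
      (\<Sum>w\<in>K. Poly_Mapping.single w (Poly_Mapping.lookup f w)) \<in> star_polys X"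
    if "finite K" "K \<subseteq> Poly_Mapping.keys f" for K
    using that
  proof (induction K)
    case empty
    show ?case
      using scale[OF _ one, of 0] by (simp add: sp_scale_def)
  next
    case (insert w K)
    then have "fst ` set (letters w) \<subseteq> X"
      using f by (auto simp: star_polys_def)
    with insert show ?case
      by (auto intro!: add single star_polys_single)
  qed
  then show ?thesis
    by (subst poly_mapping_eq_sum_single) simp
qed

section \<open>The largest C*-seminorm\<close>

lemma cstar_seminormD:
  assumes "cstar_seminorm X R q" "f \<in> star_polys X"
  shows "0 \<le> q f" "q (sp_star f * f) = (q f)\<^sup>2" "q (sp_scale c f) = cmod c * q f"
    and "g \<in> star_polys X \<Longrightarrow> q (f + g) \<le> q f + q g" "g \<in> star_polys X \<Longrightarrow> q (f * g) \<le> q f * q g"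
  using assms by (auto simp: cstar_seminorm_def)

lemma cstar_seminorm_star:
  assumes q: "cstar_seminorm X R q" and f: "f \<in> star_polys X"
  shows "q (sp_star f) = q f"
proof -
  have le: "q f \<le> q (sp_star f)" if f: "f \<in> star_polys X" for f
    by (rule le_of_square_le_mult)
      (use cstar_seminormD(5)[OF q, of "sp_star f" f] f in \<open>simp_all add: cstar_seminormD(1,2)[OF q]\<close>)
  show ?thesis
    using le[OF f] le[of "sp_star f"] f by simp
qed

lemma cstar_seminorm_zero: "cstar_seminorm X R (\<lambda>_. 0)"
  by (simp add: cstar_seminorm_def)

text \<open>
  The supremum that defines \<open>univ_nrm\<close> is meaningful only if the C*-seminorms vanishing on the relators are
  bounded at each *-polynomial.
\<close>

locale universal_cstar =
  fixes X :: "'g set" and R :: "'g star_poly set"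
  assumes bounded: "f \<in> star_polys X \<Longrightarrow> bdd_above {q f | q. cstar_seminorm X R q}"
begin

abbreviation N :: "'g star_poly \<Rightarrow> real" where "N \<equiv> univ_nrm X R"

lemma seminorm_le_N: "\<lbrakk>f \<in> star_polys X; cstar_seminorm X R q\<rbrakk> \<Longrightarrow> q f \<le> N f"
  unfolding univ_nrm_def by (rule cSup_upper[OF _ bounded]) auto

lemma N_least: "(\<And>q. cstar_seminorm X R q \<Longrightarrow> q f \<le> K) \<Longrightarrow> N f \<le> K"
  unfolding univ_nrm_def by (rule cSup_least) (use cstar_seminorm_zero in auto)

lemma N_nonneg: "f \<in> star_polys X \<Longrightarrow> 0 \<le> N f"
  using seminorm_le_N[OF _ cstar_seminorm_zero] .

text \<open>
  A supremum of C*-seminorms is again one, because squaring commutes with suprema of nonnegative numbers. So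
  the largest C*-seminorm is attained.
\<close>

lemma cstar_seminorm_N: "cstar_seminorm X R N"
  unfolding cstar_seminorm_def
proof (intro conjI ballI allI)
  fix f assume f: "f \<in> star_polys X"
  show "0 \<le> N f"
    using f by (rule N_nonneg)
  show "N (sp_star f * f) = (N f)\<^sup>2"
  proof (rule antisym)
    show "N (sp_star f * f) \<le> (N f)\<^sup>2"
      by (rule N_least) (use f in \<open>simp add: cstar_seminormD seminorm_le_N power_mono\<close>)
    have "N f \<le> sqrt (N (sp_star f * f))"
      by (rule N_least) (use f seminorm_le_N[of "sp_star f * f"] in \<open>auto intro!: real_le_rsqrt simp: cstar_seminormD\<close>)
    then have "(N f)\<^sup>2 \<le> (sqrt (N (sp_star f * f)))\<^sup>2"
      using N_nonneg[OF f] by (rule power_mono)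
    then show "(N f)\<^sup>2 \<le> N (sp_star f * f)"
      using N_nonneg[of "sp_star f * f"] f by simp
  qed
  have le: "N (sp_scale c g) \<le> cmod c * N g" if "g \<in> star_polys X" for c g
    by (rule N_least) (use that in \<open>simp add: cstar_seminormD seminorm_le_N mult_left_mono\<close>)
  show "N (sp_scale c f) = cmod c * N f" for c
  proof (rule homogeneousI[OF le[OF f]])
    assume "c \<noteq> 0"
    then show "N f \<le> cmod (inverse c) * N (sp_scale c f)"
      using le[of "sp_scale c f" "inverse c"] f by (simp add: sp_scale_simps flip: sp_scale_simps(4))
  qed (use f in \<open>simp add: N_nonneg\<close>)
  fix g assume g: "g \<in> star_polys X"
  show "N (f + g) \<le> N f + N g"
    by (rule N_least) (use f g cstar_seminormD(4)[OF _ f g] in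
      \<open>meson add_mono order_trans seminorm_le_N\<close>)
  show "N (f * g) \<le> N f * N g"
  proof (rule N_least)
    fix q assume q: "cstar_seminorm X R q"
    have "q (f * g) \<le> q f * q g"
      using q f g by (rule cstar_seminormD)
    also have "\<dots> \<le> N f * N g"
      using q f g by (intro mult_mono seminorm_le_N N_nonneg cstar_seminormD(1)[OF q])
    finally show "q (f * g) \<le> N f * N g" .
  qed
next
  fix r assume r: "r \<in> R"
  have "{q r | q. cstar_seminorm X R q} = {0}"
    using r cstar_seminorm_zero by (fastforce simp: cstar_seminorm_def)
  then show "N r = 0"
    by (simp add: univ_nrm_def)
qed

lemmas N_simps = cstar_seminormD[OF cstar_seminorm_N]

lemma N_zero [simp]: "N 0 = 0"
  using N_simps(3)[of 0 0] by (simp add: sp_scale_def)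

lemma N_minus [simp]: "f \<in> star_polys X \<Longrightarrow> N (- f) = N f"
  using N_simps(3)[of f "-1"] by (simp add: sp_scale_simps)

lemma N_star [simp]: "f \<in> star_polys X \<Longrightarrow> N (sp_star f) = N f"
  by (rule cstar_seminorm_star[OF cstar_seminorm_N])

lemma N_diff_commute: "\<lbrakk>f \<in> star_polys X; g \<in> star_polys X\<rbrakk> \<Longrightarrow> N (f - g) = N (g - f)"
  using N_minus[of "f - g"] by simp

lemma N_triangle: 
  "\<lbrakk>f \<in> star_polys X; g \<in> star_polys X; h \<in> star_polys X\<rbrakk> \<Longrightarrow> N (f - h) \<le> N (f - g) + N (g - h)"
  using N_simps(4)[of "f - g" "g - h"] by simp

lemma N_reverse_triangle: "\<lbrakk>f \<in> star_polys X; g \<in> star_polys X\<rbrakk> \<Longrightarrow> \<bar>N f - N g\<bar> \<le> N (f - g)"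
  using N_triangle[of f g 0] N_triangle[of g f 0] N_diff_commute[of f g] by simp


section \<open>The completion\<close>

abbreviation U :: "(nat \<Rightarrow> 'g star_poly) set" where "U \<equiv> univ_cauchy X R"
abbreviation cl :: "(nat \<Rightarrow> 'g star_poly) \<Rightarrow> (nat \<Rightarrow> 'g star_poly) set" where "cl \<equiv> univ_class X R"
abbreviation rep :: "(nat \<Rightarrow> 'g star_poly) set \<Rightarrow> nat \<Rightarrow> 'g star_poly" where "rep \<equiv> univ_rep"
abbreviation A :: "(nat \<Rightarrow> 'g star_poly) set cstar" where "A \<equiv> univ_cstar X R"

lemma U_closed: "s \<in> U \<Longrightarrow> s n \<in> star_polys X"
  by (auto simp: univ_cauchy_def)

lemma U_D: "\<lbrakk>s \<in> U; e > 0\<rbrakk> \<Longrightarrow> \<exists>M. \<forall>m\<ge>M. \<forall>n\<ge>M. N (s m - s n) < e"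
  by (simp add: univ_cauchy_def)

text \<open>
  The form of the bound covers sums, multiples and adjoints, and also products, for which \<open>K\<close> bounds both
  Cauchy sequences.
\<close>

lemma U_comparison2:
  assumes s: "s \<in> U" and t: "t \<in> U" and u: "\<And>n. u n \<in> star_polys X" and K: "0 < K"
    and le: "\<And>m n. N (u m - u n) \<le> K * N (s m - s n) + K * N (t m - t n)"
  shows "u \<in> U"
  unfolding univ_cauchy_def
proof (intro CollectI conjI allI impI)
  fix e :: real assume "e > 0"
  then have e: "e / (2 * K) > 0"
    using K by simp
  obtain M1 where M1: "\<forall>m\<ge>M1. \<forall>n\<ge>M1. N (s m - s n) < e / (2 * K)"
    using U_D[OF s e] by blast
  obtain M2 where M2: "\<forall>m\<ge>M2. \<forall>n\<ge>M2. N (t m - t n) < e / (2 * K)"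
    using U_D[OF t e] by blast
  show "\<exists>M. \<forall>m\<ge>M. \<forall>n\<ge>M. N (u m - u n) < e"
  proof (intro exI allI impI)
    fix m n assume "m \<ge> max M1 M2" "n \<ge> max M1 M2"
    then have "N (s m - s n) < e / (2 * K)" "N (t m - t n) < e / (2 * K)"
      using M1 M2 by auto
    then have "K * N (s m - s n) < e / 2" "K * N (t m - t n) < e / 2"
      using K by (simp_all add: field_simps)
    then show "N (u m - u n) < e"
      using le[of m n] by linarith
  qed
qed (use u in auto)

lemma U_const: "f \<in> star_polys X \<Longrightarrow> (\<lambda>_. f) \<in> U"
  by (auto simp: univ_cauchy_def)

lemma N_convergent:
  assumes "s \<in> U"
  shows "convergent (\<lambda>n. N (s n))"
proof -
  have "Cauchy (\<lambda>n. N (s n))"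
    unfolding Cauchy_def dist_real_def
    using U_D[OF assms] N_reverse_triangle[OF U_closed[OF assms] U_closed[OF assms]]
    by (meson le_less_trans)
  then show ?thesis
    by (simp add: Cauchy_convergent_iff)
qed

lemma N_bounded:
  assumes "s \<in> U"
  obtains K where "0 < K" "\<And>n. N (s n) \<le> K"
proof -
  have "Bseq (\<lambda>n. N (s n))"
    using N_convergent[OF assms] by (rule convergent_imp_Bseq)
  then obtain K where "0 < K" "\<And>n. \<bar>N (s n)\<bar> \<le> K"
    unfolding Bseq_def by auto
  then show ?thesis
    by (intro that) (auto simp: abs_le_iff)
qed

lemma N_mult_diff_le:
  assumes "f \<in> star_polys X" "g \<in> star_polys X" "f' \<in> star_polys X" "g' \<in> star_polys X"
  shows "N (f * g - f' * g') \<le> N (f - f') * N g + N f' * N (g - g')"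
proof -
  have "f * g - f' * g' = (f - f') * g + f' * (g - g')"
    by (simp add: algebra_simps)
  then show ?thesis
    using assms N_simps(4)[of "(f - f') * g" "f' * (g - g')"] N_simps(5)[of "f - f'" g]
      N_simps(5)[of f' "g - g'"] by simp
qed

lemma U_add: "\<lbrakk>s \<in> U; t \<in> U\<rbrakk> \<Longrightarrow> (\<lambda>n. s n + t n) \<in> U"
  by (rule U_comparison2[of s t _ 1])
    (use N_simps(4)[of "s _ - s _" "t _ - t _"] in \<open>auto simp: U_closed algebra_simps\<close>)

lemma U_scale: "s \<in> U \<Longrightarrow> (\<lambda>n. sp_scale c (s n)) \<in> U"
proof (rule U_comparison2[of s s _ "cmod c + 1"])
  fix m n assume "s \<in> U"
  then show "N (sp_scale c (s m) - sp_scale c (s n))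
      \<le> (cmod c + 1) * N (s m - s n) + (cmod c + 1) * N (s m - s n)"
    by (simp add: N_simps(3) U_closed N_nonneg add_increasing2 distrib_right flip: sp_scale_simps(2))
qed (simp_all add: U_closed add_nonneg_pos)

lemma U_star: "s \<in> U \<Longrightarrow> (\<lambda>n. sp_star (s n)) \<in> U"
  by (rule U_comparison2[of s s _ 1]) (auto simp: U_closed N_nonneg simp flip: sp_star_diff)

lemma U_mult:
  assumes s: "s \<in> U" and t: "t \<in> U"
  shows "(\<lambda>n. s n * t n) \<in> U"
proof -
  obtain K1 where K1: "0 < K1" "\<And>n. N (s n) \<le> K1"
    using N_bounded[OF s] by blast
  obtain K2 where K2: "0 < K2" "\<And>n. N (t n) \<le> K2"
    using N_bounded[OF t] by blast
  show ?thesis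
  proof (rule U_comparison2[OF s t, of _ "max K1 K2"])
    fix m n
    have "N (s m * t m - s n * t n) \<le> N (s m - s n) * N (t m) + N (s n) * N (t m - t n)"
      using s t by (simp add: N_mult_diff_le U_closed)
    also have "\<dots> \<le> N (s m - s n) * max K1 K2 + max K1 K2 * N (t m - t n)"
      using s t K1(2)[of n] K2(2)[of m]
      by (intro add_mono mult_mono mult_left_mono mult_right_mono) (auto simp: U_closed N_nonneg)
    finally show "N (s m * t m - s n * t n)
        \<le> max K1 K2 * N (s m - s n) + max K1 K2 * N (t m - t n)"
      by (simp add: mult.commute)
  qed (use s t K1 in \<open>auto simp: U_closed\<close>)
qed

text \<open>
  The relation whose classes are the elements of the completion. The operations of \<open>univ_cstar\<close> use
  arbitrarily chosen representatives; \<open>add_cl\<close>, \<open>scale_cl\<close>, \<open>star_cl\<close> and \<open>mult_cl\<close> show that every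
  representative gives the same result, after which the axioms are checked on sequences.
\<close>

definition eqv :: "(nat \<Rightarrow> 'g star_poly) \<Rightarrow> (nat \<Rightarrow> 'g star_poly) \<Rightarrow> bool" where
  "eqv s t \<longleftrightarrow> s \<in> U \<and> t \<in> U \<and> (\<lambda>n. N (s n - t n)) \<longlonglongrightarrow> 0"

lemma eqvI:
  assumes "s \<in> U" "t \<in> U" "\<And>n. N (s n - t n) \<le> g n" "g \<longlonglongrightarrow> 0"
  shows "eqv s t"
  unfolding eqv_def
proof (intro conjI assms(1,2))
  show "(\<lambda>n. N (s n - t n)) \<longlonglongrightarrow> 0"
    by (rule tendsto_sandwich[OF _ _ tendsto_const assms(4)])
      (use assms in \<open>auto simp: N_nonneg U_closed\<close>)
qed

lemma eqv_refl: "s \<in> U \<Longrightarrow> eqv s s"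
  by (simp add: eqv_def)

lemma eqv_sym: "eqv s t \<Longrightarrow> eqv t s"
  by (rule eqvI[where g = "\<lambda>n. N (s n - t n)"])
    (auto simp: eqv_def U_closed N_diff_commute[of "t _" "s _"])

lemma eqv_trans: "\<lbrakk>eqv s t; eqv t u\<rbrakk> \<Longrightarrow> eqv s u"
  by (rule eqvI[where g = "\<lambda>n. N (s n - t n) + N (t n - u n)"])
    (auto simp: eqv_def U_closed N_triangle intro: tendsto_add_zero)

lemma cl_eq: "cl s = {t. eqv s t}" if "s \<in> U"
  using that by (auto simp: univ_class_def eqv_def)

lemma cl_eq_iff: "\<lbrakk>s \<in> U; t \<in> U\<rbrakk> \<Longrightarrow> cl s = cl t \<longleftrightarrow> eqv s t"
  by (simp add: cl_eq set_eq_iff) (metis eqv_refl eqv_sym eqv_trans)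

lemma rep_cl: "s \<in> U \<Longrightarrow> eqv s (rep (cl s))"
  unfolding univ_rep_def by (rule someI2[of _ s]) (simp_all add: cl_eq eqv_refl)

lemma carrier_A: "carrier A = cl ` U"
  by (simp add: univ_cstar_def)

lemma carrier_cases:
  assumes "S \<in> carrier A"
  obtains s where "s \<in> U" "S = cl s"
  using assms by (auto simp: carrier_A)

lemma cl_closed: "s \<in> U \<Longrightarrow> cl s \<in> carrier A"
  by (simp add: carrier_A)

lemma add_cl:
  assumes s: "s \<in> U" and t: "t \<in> U"
  shows "cl s \<oplus>\<^bsub>A\<^esub> cl t = cl (\<lambda>n. s n + t n)"
proof -
  define s' t' where "s' = rep (cl s)" and "t' = rep (cl t)"
  have e: "eqv s s'" "eqv t t'"
    using rep_cl s t by (simp_all add: s'_def t'_def)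
  have "eqv (\<lambda>n. s n + t n) (\<lambda>n. s' n + t' n)"
  proof (rule eqvI[where g = "\<lambda>n. N (s n - s' n) + N (t n - t' n)"])
    show "N (s n + t n - (s' n + t' n)) \<le> N (s n - s' n) + N (t n - t' n)" for n
      using N_simps(4)[of "s n - s' n" "t n - t' n"] e by (simp add: eqv_def U_closed algebra_simps)
  qed (use e in \<open>auto simp: eqv_def intro: U_add tendsto_add_zero\<close>)
  then have "cl (\<lambda>n. s' n + t' n) = cl (\<lambda>n. s n + t n)"
    by (metis cl_eq_iff eqv_def)
  then show ?thesis
    by (simp add: univ_cstar_def s'_def t'_def)
qed

lemma scale_cl:
  assumes s: "s \<in> U"
  shows "c \<odot>\<^bsub>A\<^esub> cl s = cl (\<lambda>n. sp_scale c (s n))"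
proof -
  define s' where "s' = rep (cl s)"
  have e: "eqv s s'"
    using rep_cl s by (simp add: s'_def)
  have "eqv (\<lambda>n. sp_scale c (s n)) (\<lambda>n. sp_scale c (s' n))"
  proof (rule eqvI[where g = "\<lambda>n. cmod c * N (s n - s' n)"])
    show "N (sp_scale c (s n) - sp_scale c (s' n)) \<le> cmod c * N (s n - s' n)" for n
      using e by (simp add: eqv_def U_closed N_simps(3) flip: sp_scale_simps(2))
  qed (use e in \<open>auto simp: eqv_def intro: U_scale tendsto_mult_right_zero\<close>)
  then have "cl (\<lambda>n. sp_scale c (s' n)) = cl (\<lambda>n. sp_scale c (s n))"
    by (metis cl_eq_iff eqv_def)
  then show ?thesis
    by (simp add: univ_cstar_def s'_def)
qed

lemma star_cl:
  assumes s: "s \<in> U"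
  shows "star A (cl s) = cl (\<lambda>n. sp_star (s n))"
proof -
  define s' where "s' = rep (cl s)"
  have e: "eqv s s'"
    using rep_cl s by (simp add: s'_def)
  have "eqv (\<lambda>n. sp_star (s n)) (\<lambda>n. sp_star (s' n))"
  proof (rule eqvI[where g = "\<lambda>n. N (s n - s' n)"])
    show "N (sp_star (s n) - sp_star (s' n)) \<le> N (s n - s' n)" for n
      using e by (simp add: eqv_def U_closed flip: sp_star_diff)
  qed (use e in \<open>auto simp: eqv_def intro: U_star\<close>)
  then have "cl (\<lambda>n. sp_star (s' n)) = cl (\<lambda>n. sp_star (s n))"
    by (metis cl_eq_iff eqv_def)
  then show ?thesis
    by (simp add: univ_cstar_def s'_def)
qed

lemma mult_cl:
  assumes s: "s \<in> U" and t: "t \<in> U"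
  shows "cl s \<otimes>\<^bsub>A\<^esub> cl t = cl (\<lambda>n. s n * t n)"
proof -
  define s' t' where "s' = rep (cl s)" and "t' = rep (cl t)"
  have e: "eqv s s'" "eqv t t'"
    using rep_cl s t by (simp_all add: s'_def t'_def)
  then have U': "s' \<in> U" "t' \<in> U"
    by (simp_all add: eqv_def)
  obtain K1 where K1: "0 < K1" "\<And>n. N (s' n) \<le> K1"
    using N_bounded[OF U'(1)] by blast
  obtain K2 where K2: "0 < K2" "\<And>n. N (t n) \<le> K2"
    using N_bounded[OF t] by blast
  have "eqv (\<lambda>n. s n * t n) (\<lambda>n. s' n * t' n)"
  proof (rule eqvI[where g = "\<lambda>n. N (s n - s' n) * K2 + K1 * N (t n - t' n)"])
    fix n
    have "N (s n * t n - s' n * t' n) \<le> N (s n - s' n) * N (t n) + N (s' n) * N (t n - t' n)"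
      using s t U' by (simp add: N_mult_diff_le U_closed)
    also have "\<dots> \<le> N (s n - s' n) * K2 + K1 * N (t n - t' n)"
      using s t U' K1(2)[of n] K2(2)[of n]
      by (intro add_mono mult_left_mono mult_right_mono) (auto simp: U_closed N_nonneg)
    finally show "N (s n * t n - s' n * t' n) \<le> N (s n - s' n) * K2 + K1 * N (t n - t' n)" .
  next
    show "(\<lambda>n. N (s n - s' n) * K2 + K1 * N (t n - t' n)) \<longlonglongrightarrow> 0"
      using e by (auto simp: eqv_def intro!: tendsto_add_zero tendsto_mult_left_zero tendsto_mult_right_zero)
  qed (use s t U' in \<open>auto intro: U_mult\<close>)
  then have "cl (\<lambda>n. s' n * t' n) = cl (\<lambda>n. s n * t n)"
    by (metis cl_eq_iff eqv_def)
  then show ?thesis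
    by (simp add: univ_cstar_def s'_def t'_def)
qed

lemma zero_A: "\<zero>\<^bsub>A\<^esub> = cl (\<lambda>_. 0)" and one_A: "\<one>\<^bsub>A\<^esub> = cl (\<lambda>_. 1)"
  by (simp_all add: univ_cstar_def)

lemma nrm_cl:
  assumes s: "s \<in> U"
  shows "(\<lambda>n. N (s n)) \<longlonglongrightarrow> nrm A (cl s)"
proof -
  define s' where "s' = rep (cl s)"
  have e: "eqv s s'"
    using rep_cl s by (simp add: s'_def)
  then have U': "s' \<in> U" and lim: "(\<lambda>n. N (s n - s' n)) \<longlonglongrightarrow> 0"
    by (simp_all add: eqv_def)
  have "(\<lambda>n. N (s n) - N (s' n)) \<longlonglongrightarrow> 0"
    by (rule Lim_null_comparison[OF _ lim]) (use s U' N_reverse_triangle in \<open>auto simp: U_closed\<close>)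
  moreover have "(\<lambda>n. N (s' n)) \<longlonglongrightarrow> nrm A (cl s)"
    using N_convergent[OF U'] by (simp add: univ_cstar_def s'_def convergent_LIMSEQ_iff)
  ultimately show ?thesis
    using tendsto_add by fastforce
qed

lemma nrm_cl_eqI: "\<lbrakk>s \<in> U; (\<lambda>n. N (s n)) \<longlonglongrightarrow> x\<rbrakk> \<Longrightarrow> nrm A (cl s) = x"
  using nrm_cl LIMSEQ_unique by blast

lemma pre_cstar_algebra_A: "pre_cstar_algebra A"
proof -
  note [simp] = add_cl mult_cl scale_cl star_cl zero_A cl_closed U_add U_mult U_scale U_star U_const
  have group: "abelian_group A"
  proof (rule abelian_groupI)
    fix S assume "S \<in> carrier A"
    then obtain s where s: "s \<in> U" "S = cl s"
      by (rule carrier_cases)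
    then have "((-1) \<odot>\<^bsub>A\<^esub> S) \<oplus>\<^bsub>A\<^esub> S = \<zero>\<^bsub>A\<^esub>"
      using U_scale[OF s(1), of "-1"] by (simp add: sp_scale_simps)
    then show "\<exists>T\<in>carrier A. T \<oplus>\<^bsub>A\<^esub> S = \<zero>\<^bsub>A\<^esub>"
      using s by (metis scale_cl cl_closed U_scale)
  qed (auto elim!: carrier_cases simp: ac_simps)
  show ?thesis
  proof (intro pre_cstar_algebra.intro group pre_cstar_algebra_axioms.intro)
    fix S assume "S \<in> carrier A"
    then obtain s where s [simp]: "s \<in> U" and S: "S = cl s"
      by (rule carrier_cases)
    show "0 \<le> nrm A S"
      unfolding S by (rule LIMSEQ_le_const[OF nrm_cl]) (auto simp: U_closed N_nonneg)
    show "nrm A (star A S \<otimes>\<^bsub>A\<^esub> S) = (nrm A S)\<^sup>2"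
      unfolding S using tendsto_power[OF nrm_cl[OF s], of 2]
      by (simp add: nrm_cl_eqI N_simps(2) U_closed)
    show "(nrm A S = 0) = (S = \<zero>\<^bsub>A\<^esub>)"
      unfolding S using nrm_cl[OF s] nrm_cl_eqI[OF s, of 0] by (auto simp: cl_eq_iff eqv_def)
    show "nrm A (c \<odot>\<^bsub>A\<^esub> S) = cmod c * nrm A S" for c
      unfolding S using tendsto_mult_left[OF nrm_cl[OF s], of "cmod c"]
      by (simp add: nrm_cl_eqI N_simps(3) U_closed)
    fix T assume "T \<in> carrier A"
    then obtain t where t [simp]: "t \<in> U" and T: "T = cl t"
      by (rule carrier_cases)
    show "nrm A (S \<oplus>\<^bsub>A\<^esub> T) \<le> nrm A S + nrm A T"
      unfolding S T add_cl[OF s t]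
      by (rule LIMSEQ_le[OF nrm_cl tendsto_add[OF nrm_cl[OF s] nrm_cl[OF t]]])
        (auto simp: N_simps(4) U_closed)
    show "nrm A (S \<otimes>\<^bsub>A\<^esub> T) \<le> nrm A S * nrm A T"
      unfolding S T mult_cl[OF s t]
      by (rule LIMSEQ_le[OF nrm_cl tendsto_mult[OF nrm_cl[OF s] nrm_cl[OF t]]])
        (auto simp: N_simps(5) U_closed)
  qed (auto elim!: carrier_cases simp: sp_scale_simps sp_star_add sp_star_mult
      distrib_left distrib_right mult.assoc)
qed

end

context universal_cstar
begin

lemma minus_cl:
  assumes "s \<in> U" "t \<in> U"
  shows "cl s \<ominus>\<^bsub>A\<^esub> cl t = cl (\<lambda>n. s n - t n)" "(\<lambda>n. s n - t n) \<in> U"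
proof -
  interpret A: pre_cstar_algebra A
    by (rule pre_cstar_algebra_A)
  have U: "(\<lambda>n. - t n) \<in> U"
    using U_scale[OF assms(2), of "-1"] by (simp add: sp_scale_simps)
  then show "(\<lambda>n. s n - t n) \<in> U"
    using U_add[OF assms(1)] by fastforce
  show "cl s \<ominus>\<^bsub>A\<^esub> cl t = cl (\<lambda>n. s n - t n)"
    using assms U by (simp add: a_minus_def A.minus_eq_scale cl_closed scale_cl sp_scale_simps(6) add_cl)
qed

text \<open>
  The classes of constant sequences are dense: every class is the limit of the constants formed from the
  terms of a representative.
\<close>

lemma tends_const_cl:
  assumes f: "f \<in> U"
  shows "tends A (\<lambda>k. cl (\<lambda>_. f k)) (cl f)"
proof -
  interpret A: pre_cstar_algebra A
    by (rule pre_cstar_algebra_A)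
  have fk: "(\<lambda>_. f k) \<in> U" for k
    using f by (simp add: U_const U_closed)
  show ?thesis
    unfolding A.tends_iff
  proof (intro conjI allI impI)
    fix e :: real assume "e > 0"
    then obtain M where M: "\<forall>m\<ge>M. \<forall>n\<ge>M. N (f m - f n) < e / 2"
      using U_D[OF f, of "e / 2"] by auto
    show "\<exists>M. \<forall>k\<ge>M. nrm A (cl (\<lambda>_. f k) \<ominus>\<^bsub>A\<^esub> cl f) < e"
    proof (intro exI allI impI)
      fix k assume "k \<ge> M"
      have "nrm A (cl (\<lambda>_. f k) \<ominus>\<^bsub>A\<^esub> cl f) \<le> e / 2"
        unfolding minus_cl(1)[OF fk f]
        by (rule LIMSEQ_le_const2[OF nrm_cl[OF minus_cl(2)[OF fk f]]])
          (use M \<open>k \<ge> M\<close> in \<open>auto intro!: exI[of _ M] less_imp_le\<close>)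
      then show "nrm A (cl (\<lambda>_. f k) \<ominus>\<^bsub>A\<^esub> cl f) < e"
        using \<open>e > 0\<close> by simp
    qed
  qed (use f fk in \<open>auto simp: cl_closed\<close>)
qed

lemma nrm_const_cl: "f \<in> star_polys X \<Longrightarrow> nrm A (cl (\<lambda>_. f)) = N f"
  by (rule nrm_cl_eqI) (simp_all add: U_const)

text \<open>
  Each term \<open>S k\<close> of a Cauchy sequence of classes is within \<open>1 / (k + 1)\<close> of a constant \<open>f k\<close>. The
  *-polynomials \<open>f k\<close> form a Cauchy sequence, and its class is the limit of \<open>S\<close>.
\<close>

lemma cstar_algebra_A: "cstar_algebra A"
proof -
  interpret A: pre_cstar_algebra A
    by (rule pre_cstar_algebra_A)
  show ?thesis
  proof (rule A.cstar_algebraI)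
    fix S assume S: "cauchy A S"
    then have Sc: "S k \<in> carrier A" for k
      by (auto simp: cauchy_def)
    have "\<exists>f\<in>star_polys X. nrm A (cl (\<lambda>_. f) \<ominus>\<^bsub>A\<^esub> S k) < inverse (real (Suc k))" for k
    proof -
      obtain s where s: "s \<in> U" "S k = cl s"
        using Sc by (rule carrier_cases)
      have "inverse (real (Suc k)) > 0"
        by simp
      then obtain m where "nrm A (cl (\<lambda>_. s m) \<ominus>\<^bsub>A\<^esub> S k) < inverse (real (Suc k))"
        using tends_const_cl[OF s(1)] s(2) unfolding A.tends_iff by (metis order_refl)
      then show ?thesis
        using U_closed[OF s(1)] by blast
    qed
    then obtain f where f: "\<And>k. f k \<in> star_polys X"
        and close: "\<And>k. nrm A (cl (\<lambda>_. f k) \<ominus>\<^bsub>A\<^esub> S k) < inverse (real (Suc k))"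
      by metis
    have fc [simp]: "cl (\<lambda>_. f k) \<in> carrier A" for k
      by (simp add: cl_closed U_const f)
    have "f \<in> U"
      unfolding univ_cauchy_def
    proof (intro CollectI conjI allI impI)
      fix e :: real assume "e > 0"
      then obtain M1 where M1: "\<forall>m\<ge>M1. \<forall>n\<ge>M1. nrm A (S m \<ominus>\<^bsub>A\<^esub> S n) < e / 3"
        using S unfolding cauchy_def by (meson divide_pos_pos zero_less_numeral)
      obtain M2 where M2: "inverse (real (Suc M2)) < e / 3"
        using reals_Archimedean[of "e / 3"] \<open>e > 0\<close> by auto
      show "\<exists>M. \<forall>m\<ge>M. \<forall>n\<ge>M. N (f m - f n) < e"
      proof (intro exI allI impI)
        fix m n assume mn: "m \<ge> max M1 M2" "n \<ge> max M1 M2"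
        have small: "nrm A (cl (\<lambda>_. f k) \<ominus>\<^bsub>A\<^esub> S k) < e / 3" if "k \<ge> M2" for k
        proof -
          have "inverse (real (Suc k)) \<le> inverse (real (Suc M2))"
            using that by (intro le_imp_inverse_le) auto
          with close[of k] M2 show ?thesis
            by linarith
        qed
        have "N (f m - f n) = nrm A (cl (\<lambda>_. f m) \<ominus>\<^bsub>A\<^esub> cl (\<lambda>_. f n))"
          using f by (simp add: minus_cl U_const nrm_const_cl)
        also have "\<dots> \<le> nrm A (cl (\<lambda>_. f m) \<ominus>\<^bsub>A\<^esub> S m) + (nrm A (S m \<ominus>\<^bsub>A\<^esub> S n) + nrm A (S n \<ominus>\<^bsub>A\<^esub> cl (\<lambda>_. f n)))"
          using A.nrm_diff_triangle[of "cl (\<lambda>_. f m)" "S m" "cl (\<lambda>_. f n)"]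
            A.nrm_diff_triangle[of "S m" "S n" "cl (\<lambda>_. f n)"] Sc by simp
        also have "\<dots> < e"
        proof -
          have "nrm A (S m \<ominus>\<^bsub>A\<^esub> S n) < e / 3" "nrm A (cl (\<lambda>_. f m) \<ominus>\<^bsub>A\<^esub> S m) < e / 3"
            "nrm A (cl (\<lambda>_. f n) \<ominus>\<^bsub>A\<^esub> S n) < e / 3"
            using M1 mn small by auto
          then show ?thesis
            using A.nrm_diff_commute[OF Sc fc, of n n] by linarith
        qed
        finally show "N (f m - f n) < e" .
      qed
    qed (use f in auto)
    have "tends A S (cl f)"
    proof (rule A.tendsI)
      show "nrm A (S k \<ominus>\<^bsub>A\<^esub> cl f) \<le> inverse (real (Suc k)) + nrm A (cl (\<lambda>_. f k) \<ominus>\<^bsub>A\<^esub> cl f)" for k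
        using A.nrm_diff_triangle[of "S k" "cl (\<lambda>_. f k)" "cl f"] close[of k]
          A.nrm_diff_commute[of "S k" "cl (\<lambda>_. f k)"] Sc \<open>f \<in> U\<close> by (simp add: cl_closed)
      show "(\<lambda>k. inverse (real (Suc k)) + nrm A (cl (\<lambda>_. f k) \<ominus>\<^bsub>A\<^esub> cl f)) \<longlonglongrightarrow> 0"
        by (intro tendsto_add_zero LIMSEQ_inverse_real_of_nat A.tends_lim tends_const_cl \<open>f \<in> U\<close>)
    qed (use Sc \<open>f \<in> U\<close> in \<open>auto simp: cl_closed\<close>)
    then show "\<exists>l. tends A S l"
      by blast
  qed
qed

lemma unital_A: "unital A"
  unfolding unital_def
  by (auto elim!: carrier_cases simp: one_A cl_closed U_const mult_cl)

text \<open>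
  Extension by continuity: the value on the class of \<open>s\<close> is the limit of \<open>\<rho> (s n)\<close>.
\<close>

lemma extend_hom:
  assumes "cstar_algebra D"
    and closed: "\<And>f. f \<in> star_polys X \<Longrightarrow> \<rho> f \<in> carrier D"
    and add: "\<And>f g. f \<in> star_polys X \<Longrightarrow> g \<in> star_polys X \<Longrightarrow> \<rho> (f + g) = \<rho> f \<oplus>\<^bsub>D\<^esub> \<rho> g"
    and mult: "\<And>f g. f \<in> star_polys X \<Longrightarrow> g \<in> star_polys X \<Longrightarrow> \<rho> (f * g) = \<rho> f \<otimes>\<^bsub>D\<^esub> \<rho> g"
    and scale: "\<And>c f. f \<in> star_polys X \<Longrightarrow> \<rho> (sp_scale c f) = c \<odot>\<^bsub>D\<^esub> \<rho> f"
    and star: "\<And>f. f \<in> star_polys X \<Longrightarrow> \<rho> (sp_star f) = star D (\<rho> f)"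
    and contractive: "\<And>f. f \<in> star_polys X \<Longrightarrow> nrm D (\<rho> f) \<le> N f"
  obtains \<Theta> where "\<Theta> \<in> star_hom A D" "\<And>f. f \<in> star_polys X \<Longrightarrow> \<Theta> (cl (\<lambda>_. f)) = \<rho> f"
proof -
  interpret D: cstar_algebra D by fact
  have diff: "\<rho> (f - g) = \<rho> f \<ominus>\<^bsub>D\<^esub> \<rho> g" if "f \<in> star_polys X" "g \<in> star_polys X" for f g
    using add[of f "- g"] scale[of g "-1"] that closed[of g]
    by (simp add: sp_scale_simps(6) a_minus_def D.minus_eq_scale)
  have "\<exists>l. tends D (\<lambda>n. \<rho> (s n)) l" if s: "s \<in> U" for s
  proof (rule D.cauchy_tends)
    show "cauchy D (\<lambda>n. \<rho> (s n))"
      unfolding cauchy_def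
    proof (intro conjI allI impI)
      fix e :: real assume "e > 0"
      then obtain M where "\<forall>m\<ge>M. \<forall>n\<ge>M. N (s m - s n) < e"
        using U_D[OF s] by blast
      moreover have "nrm D (\<rho> (s m) \<ominus>\<^bsub>D\<^esub> \<rho> (s n)) \<le> N (s m - s n)" for m n
        using contractive[of "s m - s n"] s by (simp add: U_closed diff)
      ultimately show "\<exists>M. \<forall>m\<ge>M. \<forall>n\<ge>M. nrm D (\<rho> (s m) \<ominus>\<^bsub>D\<^esub> \<rho> (s n)) < e"
        by (meson le_less_trans)
    qed (use s in \<open>auto simp: closed U_closed\<close>)
  qed
  then obtain L where L: "\<And>s. s \<in> U \<Longrightarrow> tends D (\<lambda>n. \<rho> (s n)) (L s)"
    by metis
  have L_cong: "L s = L t" if e: "eqv s t" for s t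
  proof (rule D.tends_unique)
    have st: "s \<in> U" "t \<in> U" and lim: "(\<lambda>n. N (s n - t n)) \<longlonglongrightarrow> 0"
      using e by (auto simp: eqv_def)
    show "tends D (\<lambda>n. \<rho> (s n)) (L s)"
      using L st by blast
    have Lc: "L t \<in> carrier D"
      using D.tends_closed(1)[OF L[OF st(2)]] .
    show "tends D (\<lambda>n. \<rho> (s n)) (L t)"
    proof (rule D.tendsI[OF Lc])
      show "nrm D (\<rho> (s n) \<ominus>\<^bsub>D\<^esub> L t) \<le> N (s n - t n) + nrm D (\<rho> (t n) \<ominus>\<^bsub>D\<^esub> L t)" for n
        using D.nrm_diff_triangle[of "\<rho> (s n)" "\<rho> (t n)" "L t"] contractive[of "s n - t n"]
          diff[of "s n" "t n"] st Lc by (simp add: closed U_closed)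
      show "(\<lambda>n. N (s n - t n) + nrm D (\<rho> (t n) \<ominus>\<^bsub>D\<^esub> L t)) \<longlonglongrightarrow> 0"
        by (intro tendsto_add_zero lim D.tends_lim L st)
    qed (use st in \<open>auto simp: closed U_closed\<close>)
  qed
  define \<Theta> where "\<Theta> = (\<lambda>S\<in>carrier A. L (rep S))"
  have \<Theta>_cl: "\<Theta> (cl s) = L s" if s: "s \<in> U" for s
    using L_cong[OF rep_cl[OF s]] s by (simp add: \<Theta>_def cl_closed)
  note U_simps = cl_closed U_add U_mult U_scale U_star U_const
  show ?thesis
  proof (rule that[of \<Theta>])
    show "\<Theta> (cl (\<lambda>_. f)) = \<rho> f" if f: "f \<in> star_polys X" for f
      unfolding \<Theta>_cl[OF U_const[OF f]]
      using D.tends_unique[OF L[OF U_const[OF f]] D.tends_const] f by (simp add: closed)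
    show "\<Theta> \<in> star_hom A D"
      unfolding star_hom_def
    proof (intro CollectI conjI ballI allI)
      show "\<Theta> \<in> carrier A \<rightarrow>\<^sub>E carrier D"
        using \<Theta>_cl D.tends_closed(1)[OF L]
        by (auto simp: PiE_def elim!: carrier_cases) (simp add: \<Theta>_def)
      fix S assume "S \<in> carrier A"
      then obtain s where s: "s \<in> U" and S: "S = cl s"
        by (rule carrier_cases)
      show "\<Theta> (c \<odot>\<^bsub>A\<^esub> S) = c \<odot>\<^bsub>D\<^esub> \<Theta> S" for c
      proof -
        have "tends D (\<lambda>n. \<rho> (sp_scale c (s n))) (c \<odot>\<^bsub>D\<^esub> L s)"
          using D.tends_scale[OF L[OF s], of c] s by (simp add: scale U_closed)
        then have "L (\<lambda>n. sp_scale c (s n)) = c \<odot>\<^bsub>D\<^esub> L s"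
          using D.tends_unique[OF L[OF U_scale[OF s]]] by blast
        then show ?thesis
          using s by (simp add: S scale_cl \<Theta>_cl U_scale)
      qed
      show "\<Theta> (star A S) = star D (\<Theta> S)"
      proof -
        have "tends D (\<lambda>n. \<rho> (sp_star (s n))) (star D (L s))"
          using D.tends_star[OF L[OF s]] s by (simp add: star U_closed)
        then have "L (\<lambda>n. sp_star (s n)) = star D (L s)"
          using D.tends_unique[OF L[OF U_star[OF s]]] by blast
        then show ?thesis
          using s by (simp add: S star_cl \<Theta>_cl U_star)
      qed
      fix T assume "T \<in> carrier A"
      then obtain t where t: "t \<in> U" and T: "T = cl t"
        by (rule carrier_cases)
      show "\<Theta> (S \<oplus>\<^bsub>A\<^esub> T) = \<Theta> S \<oplus>\<^bsub>D\<^esub> \<Theta> T"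
      proof -
        have "tends D (\<lambda>n. \<rho> (s n + t n)) (L s \<oplus>\<^bsub>D\<^esub> L t)"
          using D.tends_add[OF L[OF s] L[OF t]] s t by (simp add: add U_closed)
        then have "L (\<lambda>n. s n + t n) = L s \<oplus>\<^bsub>D\<^esub> L t"
          using D.tends_unique[OF L[OF U_add[OF s t]]] by blast
        then show ?thesis
          using s t by (simp add: S T add_cl \<Theta>_cl U_add)
      qed
      show "\<Theta> (S \<otimes>\<^bsub>A\<^esub> T) = \<Theta> S \<otimes>\<^bsub>D\<^esub> \<Theta> T"
      proof -
        have "tends D (\<lambda>n. \<rho> (s n * t n)) (L s \<otimes>\<^bsub>D\<^esub> L t)"
          using D.tends_mult[OF L[OF s] L[OF t]] s t by (simp add: mult U_closed)
        then have "L (\<lambda>n. s n * t n) = L s \<otimes>\<^bsub>D\<^esub> L t"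
          using D.tends_unique[OF L[OF U_mult[OF s t]]] by blast
        then show ?thesis
          using s t by (simp add: S T mult_cl \<Theta>_cl U_mult)
      qed
    qed
  qed
qed

text \<open>
  Agreement on generators and unit spreads to all constants by induction over *-polynomials. It passes to
  limits because both homomorphisms are contractive, and constants are dense.
\<close>

lemma hom_unique:
  assumes D: "cstar_algebra D" and \<Theta>: "\<Theta> \<in> star_hom A D" and \<Theta>': "\<Theta>' \<in> star_hom A D"
    and one: "\<Theta> \<one>\<^bsub>A\<^esub> = \<Theta>' \<one>\<^bsub>A\<^esub>"
    and gen: "\<And>g. g \<in> X \<Longrightarrow> \<Theta> (univ_gen X R g) = \<Theta>' (univ_gen X R g)"
  shows "\<Theta> = \<Theta>'"
proof -
  interpret A: cstar_algebra A
    by (rule cstar_algebra_A)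
  interpret D: cstar_algebra D by fact
  note hom = star_homD[OF \<Theta>] and hom' = star_homD[OF \<Theta>']
  have const: "\<Theta> (cl (\<lambda>_. f)) = \<Theta>' (cl (\<lambda>_. f))" if "f \<in> star_polys X" for f
    using that
  proof (induction f rule: star_polys_induct)
    case one
    then show ?case
      using assms(4) by (simp add: one_A)
  next
    case (gen g)
    then show ?case
      using assms(5)[OF gen] by (simp add: univ_gen_def)
  next
    case (star f)
    then show ?case
      using hom(6)[of "cl (\<lambda>_. f)"] hom'(6)[of "cl (\<lambda>_. f)"] by (simp add: star_cl U_const cl_closed)
  next
    case (scale f c)
    then show ?case
      using hom(5)[of "cl (\<lambda>_. f)" c] hom'(5)[of "cl (\<lambda>_. f)" c] by (simp add: scale_cl U_const cl_closed)
  next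
    case (add f g)
    then show ?case
      using hom(3)[of "cl (\<lambda>_. f)" "cl (\<lambda>_. g)"] hom'(3)[of "cl (\<lambda>_. f)" "cl (\<lambda>_. g)"]
      by (simp add: add_cl U_const cl_closed)
  next
    case (mult f g)
    then show ?case
      using hom(4)[of "cl (\<lambda>_. f)" "cl (\<lambda>_. g)"] hom'(4)[of "cl (\<lambda>_. f)" "cl (\<lambda>_. g)"]
      by (simp add: mult_cl U_const cl_closed)
  qed
  have continuous: "tends D (\<lambda>n. \<Phi> (s n)) (\<Phi> l)" if \<Phi>: "\<Phi> \<in> star_hom A D" and s: "tends A s l" for \<Phi> s l
  proof (rule D.tendsI[OF _ _ _ A.tends_lim[OF s]])
    fix n
    have c: "s n \<in> carrier A" "l \<in> carrier A"
      using A.tends_closed[OF s] by auto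
    then show "\<Phi> (s n) \<in> carrier D" "\<Phi> l \<in> carrier D"
      using star_homD(1)[OF \<Phi>] by auto
    have "\<Phi> (s n \<ominus>\<^bsub>A\<^esub> l) = \<Phi> (s n) \<ominus>\<^bsub>D\<^esub> \<Phi> l"
      using c star_homD(1,3,5)[OF \<Phi>] by (simp add: a_minus_def A.minus_eq_scale D.minus_eq_scale)
    then show "nrm D (\<Phi> (s n) \<ominus>\<^bsub>D\<^esub> \<Phi> l) \<le> nrm A (s n \<ominus>\<^bsub>A\<^esub> l)"
      using A.star_hom_contractive[OF unital_A D \<Phi>, of "s n \<ominus>\<^bsub>A\<^esub> l"] c by simp
  qed
  have "\<Theta> S = \<Theta>' S" if S: "S \<in> carrier A" for S
  proof -
    obtain s where s: "s \<in> U" "S = cl s"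
      using S by (rule carrier_cases)
    show ?thesis
      using continuous[OF \<Theta> tends_const_cl[OF s(1)]] continuous[OF \<Theta>' tends_const_cl[OF s(1)]]
        D.tends_unique s by (simp add: const U_closed)
  qed
  then show ?thesis
    using hom(2) hom'(2) by (auto intro: extensionalityI)
qed

end

text \<open>
  A bound on the generators propagates to all *-polynomials, because a C*-seminorm is subadditive,
  submultiplicative and invariant under adjoints, and takes only the values 0 and 1 at \<open>1 = 1\<^sup>* 1\<close>.
\<close>

lemma universal_cstarI:
  assumes "\<And>g. g \<in> X \<Longrightarrow> \<exists>K. \<forall>q. cstar_seminorm X R q \<longrightarrow> q (sp_gen g) \<le> K"
  shows "universal_cstar X R"
proof
  fix f assume "f \<in> star_polys X"
  then have "\<exists>K. \<forall>q. cstar_seminorm X R q \<longrightarrow> q f \<le> K"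
  proof (induction f rule: star_polys_induct)
    case one
    have "q 1 \<le> 1" if "cstar_seminorm X R q" for q
      using cstar_seminormD(2)[OF that, of 1] by (auto simp: power2_eq_square)
    then show ?case
      by blast
  next
    case (star f)
    then show ?case
      by (metis cstar_seminorm_star)
  next
    case (scale f c)
    then show ?case
      by (metis cstar_seminormD(3) mult_left_mono norm_ge_zero)
  next
    case (add f g)
    then obtain K L where "\<forall>q. cstar_seminorm X R q \<longrightarrow> q f \<le> K" "\<forall>q. cstar_seminorm X R q \<longrightarrow> q g \<le> L"
      by blast
    then have "q (f + g) \<le> K + L" if q: "cstar_seminorm X R q" for q
      using cstar_seminormD(4)[OF q add.hyps(1,2)] q by fastforce
    then show ?case
      by blast
  next
    case (mult f g)
    then obtain K L where KL: "\<forall>q. cstar_seminorm X R q \<longrightarrow> q f \<le> K" "\<forall>q. cstar_seminorm X R q \<longrightarrow> q g \<le> L"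
      by blast
    have "q (f * g) \<le> K * L" if q: "cstar_seminorm X R q" for q
    proof -
      have "q (f * g) \<le> q f * q g"
        using q mult.hyps by (rule cstar_seminormD)
      also have "\<dots> \<le> K * L"
        using KL q cstar_seminormD(1)[OF q mult.hyps(1)] cstar_seminormD(1)[OF q mult.hyps(2)]
        by (intro mult_mono) (auto intro: order_trans)
      finally show ?thesis .
    qed
    then show ?case
      by blast
  qed (rule assms)
  then obtain K where "\<forall>q. cstar_seminorm X R q \<longrightarrow> q f \<le> K"
    by blast
  then show "bdd_above {q f | q. cstar_seminorm X R q}"
    by (intro bdd_aboveI[of _ K]) auto
qed


section \<open>Evaluation of *-polynomials and the universal property\<close>

lemma star_hom_finsum:
  assumes "abelian_group A" "abelian_group D" "\<Phi> \<in> star_hom A D" "\<Phi> \<zero>\<^bsub>A\<^esub> = \<zero>\<^bsub>D\<^esub>"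
    and "finite S" "f \<in> S \<rightarrow> carrier A"
  shows "\<Phi> (\<Oplus>\<^bsub>A\<^esub>i\<in>S. f i) = (\<Oplus>\<^bsub>D\<^esub>i\<in>S. \<Phi> (f i))"
proof -
  interpret A: abelian_group A by fact
  interpret D: abelian_group D by fact
  show ?thesis
    using assms(5,6)
  proof (induction S)
    case (insert i S)
    then show ?case
      using star_homD(1,3)[OF assms(3)] by (simp add: Pi_iff A.finsum_closed)
  qed (simp add: assms(4))
qed

lemma star_hom_zero:
  assumes "pre_cstar_algebra A" "pre_cstar_algebra D" "\<Phi> \<in> star_hom A D"
  shows "\<Phi> \<zero>\<^bsub>A\<^esub> = \<zero>\<^bsub>D\<^esub>"
proof -
  interpret A: pre_cstar_algebra A by fact
  interpret D: pre_cstar_algebra D by fact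
  show ?thesis
    using star_homD(1)[OF assms(3), of "\<zero>\<^bsub>A\<^esub>"]
      star_homD(5)[OF assms(3), of "\<zero>\<^bsub>A\<^esub>" 0] by simp
qed

context cstar_algebra
begin

definition word_val :: "('g \<Rightarrow> 'a) \<Rightarrow> 'g word \<Rightarrow> 'a" where
  "word_val G w = foldr (\<lambda>(g, s) z. (if s then star A (G g) else G g) \<otimes> z) (letters w) \<one>"

definition star_poly_val :: "('g \<Rightarrow> 'a) \<Rightarrow> 'g star_poly \<Rightarrow> 'a" where
  "star_poly_val G f = (\<Oplus>w\<in>Poly_Mapping.keys f. Poly_Mapping.lookup f w \<odot> word_val G w)"

context
  fixes G :: "'g \<Rightarrow> 'a"
  assumes unital: "unital A" and G [simp]: "\<And>g. G g \<in> carrier A"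
begin

lemmas unital_simps [simp] = unital_one[OF unital] star_one[OF unital]

lemma word_val_Cons:
  "word_val G (Word ((g, s) # ls)) = (if s then star A (G g) else G g) \<otimes> word_val G (Word ls)"
  by (simp add: word_val_def)

lemma word_val_closed [simp]: "word_val G w \<in> carrier A"
proof -
  have "word_val G (Word ls) \<in> carrier A" for ls
    by (induction ls) (auto simp: word_val_def)
  from this[of "letters w"] show ?thesis
    by simp
qed

lemma word_val_zero [simp]: "word_val G 0 = \<one>"
  by (simp add: word_val_def)

lemma word_val_plus: "word_val G (u + v) = word_val G u \<otimes> word_val G v"
proof -
  have "word_val G (Word (ls @ letters v)) = word_val G (Word ls) \<otimes> word_val G v" for ls
  proof (induction ls)
    case Nil
    then show ?case
      using word_val_closed[of v] by (simp add: word_val_def)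
  next
    case (Cons l ls)
    then show ?case
      by (cases l) (simp add: word_val_Cons mult_assoc)
  qed
  from this[of "letters u"] show ?thesis
    by (simp add: plus_word_def)
qed

lemma word_val_star: "word_val G (word_star w) = star A (word_val G w)"
proof -
  have "word_val G (word_star (Word ls)) = star A (word_val G (Word ls))" for ls
  proof (induction ls)
    case Nil
    then show ?case
      by (simp add: word_val_def word_star_def)
  next
    case (Cons l ls)
    obtain g s where l: "l = (g, s)"
      by fastforce
    have "Word (l # ls) = Word [l] + Word ls"
      by (simp add: plus_word_def)
    then have "word_val G (word_star (Word (l # ls)))
        = star A (word_val G (Word ls)) \<otimes> word_val G (word_star (Word [l]))"
      by (simp add: word_val_plus Cons)
    also have "word_val G (word_star (Word [l])) = star A (if s then star A (G g) else G g)"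
      by (simp add: l word_star_def word_val_def star_star)
    finally show ?case
      by (simp add: l word_val_Cons star_mult)
  qed
  from this[of "letters w"] show ?thesis
    by simp
qed

lemma star_poly_val_superset:
  assumes "finite K" "Poly_Mapping.keys f \<subseteq> K"
  shows "star_poly_val G f = (\<Oplus>w\<in>K. Poly_Mapping.lookup f w \<odot> word_val G w)"
  unfolding star_poly_val_def
  by (rule add.finprod_mono_neutral_cong_left) (use assms in \<open>auto simp: in_keys_iff\<close>)

lemma star_poly_val_closed [simp]: "star_poly_val G f \<in> carrier A"
  unfolding star_poly_val_def by (rule finsum_closed) simp

lemma star_poly_val_add: "star_poly_val G (f + g) = star_poly_val G f \<oplus> star_poly_val G g"
proof -
  let ?K = "Poly_Mapping.keys f \<union> Poly_Mapping.keys g"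
  have "star_poly_val G (f + g) = (\<Oplus>w\<in>?K. Poly_Mapping.lookup (f + g) w \<odot> word_val G w)"
    by (rule star_poly_val_superset) (auto simp: in_keys_iff lookup_add)
  also have "\<dots> = (\<Oplus>w\<in>?K. Poly_Mapping.lookup f w \<odot> word_val G w \<oplus> Poly_Mapping.lookup g w \<odot> word_val G w)"
    by (simp add: lookup_add scale_add_left)
  also have "\<dots> = (\<Oplus>w\<in>?K. Poly_Mapping.lookup f w \<odot> word_val G w) \<oplus> (\<Oplus>w\<in>?K. Poly_Mapping.lookup g w \<odot> word_val G w)"
    by (rule finsum_addf) auto
  finally show ?thesis
    by (simp add: star_poly_val_superset[of ?K])
qed

lemma star_poly_val_single: "star_poly_val G (Poly_Mapping.single w c) = c \<odot> word_val G w"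
  by (subst star_poly_val_superset[of "{w}"]) simp_all

lemma star_poly_val_zero [simp]: "star_poly_val G 0 = \<zero>"
  by (simp add: star_poly_val_def)

lemma star_poly_val_one [simp]: "star_poly_val G 1 = \<one>"
  using star_poly_val_single[of 0 1] by (simp add: scale_one)

lemma star_poly_val_mult: "star_poly_val G (f * g) = star_poly_val G f \<otimes> star_poly_val G g"
proof (induction f rule: poly_mapping_single_induct)
  case (single u c)
  show ?case
    by (induction g rule: poly_mapping_single_induct)
      (simp_all add: mult_single star_poly_val_single star_poly_val_add distrib_left mult_add_right
        word_val_plus scale_mult_left scale_mult_right mult.commute flip: scale_scale)
qed (simp_all add: star_poly_val_add distrib_right mult_add_left)

lemma star_poly_val_scale: "star_poly_val G (sp_scale c f) = c \<odot> star_poly_val G f"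
  unfolding sp_scale_def by (simp add: star_poly_val_mult star_poly_val_single scale_mult_left)

lemma star_poly_val_star: "star_poly_val G (sp_star f) = star A (star_poly_val G f)"
  by (induction f rule: poly_mapping_single_induct)
    (simp_all add: sp_star_single sp_star_add star_poly_val_single star_poly_val_add
      star_add star_scale word_val_star)

lemma star_poly_val_gen: "star_poly_val G (sp_gen g) = G g"
  unfolding sp_gen_def by (simp add: star_poly_val_single scale_one word_val_def)

lemma star_poly_val_diff: "star_poly_val G (f - g) = star_poly_val G f \<ominus> star_poly_val G g"
  using star_poly_val_add[of f "sp_scale (-1) g"]
  by (simp add: star_poly_val_scale a_minus_def minus_eq_scale) (simp add: sp_scale_simps)

lemma star_poly_val_sum:
  "finite S \<Longrightarrow> star_poly_val G (\<Sum>i\<in>S. f i) = (\<Oplus>i\<in>S. star_poly_val G (f i))"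
  by (induction S rule: finite_induct) (simp_all add: star_poly_val_add)

text \<open>
  This seminorm competes in the supremum \<open>univ_nrm\<close>; therefore evaluation at elements that satisfy the
  relations is contractive.
\<close>

lemma cstar_seminorm_star_poly_val:
  assumes "\<And>r. r \<in> R \<Longrightarrow> star_poly_val G r = \<zero>"
  shows "cstar_seminorm X R (\<lambda>f. nrm A (star_poly_val G f))"
  unfolding cstar_seminorm_def
  by (simp add: assms star_poly_val_mult star_poly_val_star star_poly_val_scale star_poly_val_add
      cstar_identity nrm_scale nrm_triangle nrm_mult nrm_nonneg)

end

end

lemma (in universal_cstar) universal_property:
  assumes "cstar_algebra D" "unital D" "\<And>g. G g \<in> carrier D"
    and "\<And>r. r \<in> R \<Longrightarrow> cstar_algebra.star_poly_val D G r = \<zero>\<^bsub>D\<^esub>"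
  obtains \<Theta> where "\<Theta> \<in> star_hom A D" "\<Theta> \<one>\<^bsub>A\<^esub> = \<one>\<^bsub>D\<^esub>"
    "\<And>g. g \<in> X \<Longrightarrow> \<Theta> (univ_gen X R g) = G g"
proof -
  interpret D: cstar_algebra D by fact
  note D_val = D.star_poly_val_closed[OF assms(2,3)] D.star_poly_val_add[OF assms(2,3)]
    D.star_poly_val_mult[OF assms(2,3)] D.star_poly_val_scale[OF assms(2,3)]
    D.star_poly_val_star[OF assms(2,3)]
  have le: "nrm D (D.star_poly_val G f) \<le> N f" if "f \<in> star_polys X" for f
    using seminorm_le_N[OF that D.cstar_seminorm_star_poly_val[OF assms(2,3,4)]] .
  obtain \<Theta> where \<Theta>: "\<Theta> \<in> star_hom A D"
      "\<And>f. f \<in> star_polys X \<Longrightarrow> \<Theta> (cl (\<lambda>_. f)) = D.star_poly_val G f"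
    by (rule extend_hom[OF assms(1), of "D.star_poly_val G"]) (assumption | rule D_val le | blast)+
  show ?thesis
  proof (rule that[OF \<Theta>(1)])
    show "\<Theta> \<one>\<^bsub>A\<^esub> = \<one>\<^bsub>D\<^esub>"
      using \<Theta>(2)[of 1] by (simp add: one_A D.star_poly_val_one[OF assms(2,3)])
    show "\<Theta> (univ_gen X R g) = G g" if "g \<in> X" for g
      using \<Theta>(2)[of "sp_gen g"] that by (simp add: univ_gen_def D.star_poly_val_gen[OF assms(2,3)])
  qed
qed

section \<open>Multipliers of an algebra of functions\<close>

definition point_mass :: "'x set \<Rightarrow> ('b, 'm) cstar_scheme \<Rightarrow> 'x \<Rightarrow> 'b \<Rightarrow> 'x \<Rightarrow> 'b" where
  "point_mass X B x b = (\<lambda>y\<in>X. if y = x then b else \<zero>\<^bsub>B\<^esub>)"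

text \<open>
  The action of a multiplier of the functions at the point \<open>x\<close>, tested on functions supported at \<open>x\<close>. It is
  evaluation at \<open>x\<close>, extended to multipliers, and inverse to \<open>family\<close>.
\<close>

definition fibre :: "'x set \<Rightarrow> ('b, 'm) cstar_scheme \<Rightarrow>
    (('x \<Rightarrow> 'b) \<Rightarrow> 'x \<Rightarrow> 'b) \<times> (('x \<Rightarrow> 'b) \<Rightarrow> 'x \<Rightarrow> 'b) \<Rightarrow> 'x \<Rightarrow> ('b \<Rightarrow> 'b) \<times> ('b \<Rightarrow> 'b)" where
  "fibre X B m x = (\<lambda>b\<in>carrier B. fst m (point_mass X B x b) x, \<lambda>b\<in>carrier B. snd m (point_mass X B x b) x)"

text \<open>
  The values of \<open>id_tensor\<close>, which are multipliers of functions, are of this form (\<open>id_tensor_eq_family\<close>).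
\<close>

definition family :: "'x set \<Rightarrow> ('b, 'm) cstar_scheme \<Rightarrow> ('x \<Rightarrow> ('b \<Rightarrow> 'b) \<times> ('b \<Rightarrow> 'b)) \<Rightarrow>
    (('x \<Rightarrow> 'b) \<Rightarrow> 'x \<Rightarrow> 'b) \<times> (('x \<Rightarrow> 'b) \<Rightarrow> 'x \<Rightarrow> 'b)" where
  "family X B \<mu> = (\<lambda>g\<in>carrier (fun_tensor X B). \<lambda>x\<in>X. fst (\<mu> x) (g x),
     \<lambda>g\<in>carrier (fun_tensor X B). \<lambda>x\<in>X. snd (\<mu> x) (g x))"

lemma family_apply:
  assumes "g \<in> X \<rightarrow>\<^sub>E carrier B"
  shows "fst (family X B \<mu>) g = (\<lambda>x\<in>X. fst (\<mu> x) (g x))"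
    and "snd (family X B \<mu>) g = (\<lambda>x\<in>X. snd (\<mu> x) (g x))"
  using assms by (simp_all add: family_def)

lemma family_cong: "(\<And>x. x \<in> X \<Longrightarrow> \<mu> x = \<nu> x) \<Longrightarrow> family X B \<mu> = family X B \<nu>"
  by (simp add: family_def cong: restrict_cong)

lemma point_mass_apply:
  "x \<in> X \<Longrightarrow> point_mass X B x b x = b"
  "\<lbrakk>y \<in> X; y \<noteq> x\<rbrakk> \<Longrightarrow> point_mass X B x b y = \<zero>\<^bsub>B\<^esub>"
  by (simp_all add: point_mass_def)

lemma fibre_apply:
  "b \<in> carrier B \<Longrightarrow> fst (fibre X B m x) b = fst m (point_mass X B x b) x"
  "b \<in> carrier B \<Longrightarrow> snd (fibre X B m x) b = snd m (point_mass X B x b) x"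
  by (simp_all add: fibre_def)

lemma (in pre_cstar_algebra) add_diff_cancel: "\<lbrakk>x \<in> carrier A; y \<in> carrier A\<rbrakk> \<Longrightarrow> x \<oplus> (y \<ominus> x) = y"
  by (simp add: a_minus_def a_lcomm[of x y] r_neg)

context cstar_algebra
begin

lemma multiplier_eqI_snd:
  assumes m: "m \<in> carrier (multiplier_alg A)" and n: "n \<in> carrier (multiplier_alg A)"
    and eq: "\<And>x. x \<in> carrier A \<Longrightarrow> snd m x = snd n x"
  shows "m = n"
proof (rule multiplier_eqI[OF m n _ eq])
  fix y assume y: "y \<in> carrier A"
  have "fst m y \<ominus> fst n y = \<zero>"
    by (rule left_faithful)
      (use y m n eq in \<open>simp_all add: mult_diff_right multiplierD(3) multiplierD(11)[OF m] multiplierD(11)[OF n] multiplierD(4)\<close>)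
  then show "fst m y = fst n y"
    using y m n by (simp add: diff_eq_zero_iff multiplierD)
qed

lemma multiplier_eqI_fst:
  assumes m: "m \<in> carrier (multiplier_alg A)" and n: "n \<in> carrier (multiplier_alg A)"
    and eq: "\<And>x. x \<in> carrier A \<Longrightarrow> fst m x = fst n x"
  shows "m = n"
proof (rule multiplier_eqI_snd[OF m n])
  fix x assume x: "x \<in> carrier A"
  have "snd m x \<ominus> snd n x = \<zero>"
    by (rule right_faithful)
      (use x m n eq in \<open>simp_all add: mult_diff_left multiplierD(3,4) multiplierD(11)[OF m, symmetric] multiplierD(11)[OF n, symmetric]\<close>)
  then show "snd m x = snd n x"
    using x m n by (simp add: diff_eq_zero_iff multiplierD)
qed

lemma mult_embed_closed:
  assumes "a \<in> carrier A"
  shows "mult_embed A a \<in> carrier (multiplier_alg A)"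
  by (rule multiplierI[where K = "nrm A a"])
    (use assms in \<open>auto simp: mult_embed_def mult_assoc nrm_mult\<close>)

lemma mult_embed_apply:
  "x \<in> carrier A \<Longrightarrow> fst (mult_embed A a) x = a \<otimes> x"
  "x \<in> carrier A \<Longrightarrow> snd (mult_embed A a) x = x \<otimes> a"
  by (simp_all add: mult_embed_def)

lemma mult_mult_embed:
  assumes n: "n \<in> carrier (multiplier_alg A)" and a: "a \<in> carrier A"
  shows "n \<otimes>\<^bsub>multiplier_alg A\<^esub> mult_embed A a = mult_embed A (fst n a)"
  by (rule multiplier_eqI_fst)
    (use n a in \<open>auto simp: multiplier_closed mult_embed_closed multiplier_apply multiplierD mult_embed_apply\<close>)

text \<open>
  Two multipliers with the defining property of the extension differ, in their right action, by elements that
  every \<open>\<Phi> a\<close> annihilates. So the extension is unique as soon as the right actions of the \<open>\<Phi> a\<close> are jointly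
  injective, and a right action determines the multiplier.
\<close>

lemma mor_ext_eqI:
  assumes "\<And>a. a \<in> carrier C \<Longrightarrow> \<Phi> a \<in> carrier (multiplier_alg A)"
    and n: "n \<in> carrier (multiplier_alg A)"
    and ext: "\<And>a. a \<in> carrier C \<Longrightarrow> n \<otimes>\<^bsub>multiplier_alg A\<^esub> \<Phi> a = \<Phi> (fst m a)"
    and faithful: "\<And>d. d \<in> carrier A \<Longrightarrow> (\<And>a. a \<in> carrier C \<Longrightarrow> snd (\<Phi> a) d = \<zero>) \<Longrightarrow> d = \<zero>"
  shows "mor_ext C A \<Phi> m = n"
  unfolding mor_ext_def
proof (rule the_equality)
  fix n' assume *: "n' \<in> carrier (multiplier_alg A) \<and>
    (\<forall>a\<in>carrier C. n' \<otimes>\<^bsub>multiplier_alg A\<^esub> \<Phi> a = \<Phi> (fst m a))"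
  then have n': "n' \<in> carrier (multiplier_alg A)"
    by blast
  show "n' = n"
  proof (rule multiplier_eqI_snd[OF n' n])
    fix d assume d: "d \<in> carrier A"
    have "snd n' d \<ominus> snd n d = \<zero>"
    proof (rule faithful)
      fix a assume a: "a \<in> carrier C"
      have "n' \<otimes>\<^bsub>multiplier_alg A\<^esub> \<Phi> a = n \<otimes>\<^bsub>multiplier_alg A\<^esub> \<Phi> a"
        using * ext a by simp
      then have eq: "snd (\<Phi> a) (snd n' d) = snd (\<Phi> a) (snd n d)"
        using multiplier_apply(2)[OF d, of n' "\<Phi> a"] multiplier_apply(2)[OF d, of n "\<Phi> a"] by simp
      have "snd (\<Phi> a) (snd n' d \<ominus> snd n d) = snd (\<Phi> a) (snd n' d) \<ominus> snd (\<Phi> a) (snd n d)"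
        using n n' d assms(1)[OF a] by (simp add: a_minus_def minus_eq_scale multiplierD)
      then show "snd (\<Phi> a) (snd n' d \<ominus> snd n d) = \<zero>"
        using n n' d assms(1)[OF a] by (simp add: eq multiplierD)
    qed (use n n' d in \<open>simp add: multiplierD\<close>)
    then show "snd n' d = snd n d"
      using n n' d by (simp add: diff_eq_zero_iff multiplierD)
  qed
qed (use n ext in blast)

lemma mor_ext_mor_of:
  assumes f: "\<And>a. a \<in> carrier C \<Longrightarrow> f a \<in> carrier A"
    and m: "\<And>a. a \<in> carrier C \<Longrightarrow> fst m a \<in> carrier C"
    and n: "n \<in> carrier (multiplier_alg A)"
    and ext: "\<And>a. a \<in> carrier C \<Longrightarrow> fst n (f a) = f (fst m a)"
    and faithful: "\<And>d. d \<in> carrier A \<Longrightarrow> (\<And>a. a \<in> carrier C \<Longrightarrow> d \<otimes> f a = \<zero>) \<Longrightarrow> d = \<zero>"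
  shows "mor_ext C A (mor_of C A f) m = n"
proof (rule mor_ext_eqI[OF _ n])
  fix d assume d: "d \<in> carrier A" "\<And>a. a \<in> carrier C \<Longrightarrow> snd (mor_of C A f a) d = \<zero>"
  show "d = \<zero>"
    by (rule faithful) (use d in \<open>auto simp: mor_of_def mult_embed_apply\<close>)
qed (use f m n ext in \<open>auto simp: mor_of_def mult_embed_closed mult_mult_embed\<close>)

context
  fixes X :: "'x set"
  assumes X: "finite X"
begin

lemma point_mass_closed [simp]: "b \<in> carrier A \<Longrightarrow> point_mass X A x b \<in> X \<rightarrow>\<^sub>E carrier A"
  by (auto simp: point_mass_def)

lemma nrm_point_mass: "b \<in> carrier A \<Longrightarrow> nrm (fun_tensor X A) (point_mass X A x b) \<le> nrm A b"
  by (auto simp: nrm_fun_tensor_le_iff[OF X] point_mass_def nrm_nonneg)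

lemma family_closed:
  assumes \<mu>: "\<And>x. x \<in> X \<Longrightarrow> \<mu> x \<in> carrier (multiplier_alg A)"
  shows "family X A \<mu> \<in> carrier (multiplier_alg (fun_tensor X A))"
proof -
  interpret C: cstar_algebra "fun_tensor X A"
    using X by (rule cstar_algebra_fun_tensor)
  let ?K = "\<Sum>x\<in>X. nrm (multiplier_alg A) (\<mu> x)"
  have K: "0 \<le> ?K"
    using \<mu> by (intro sum_nonneg multiplier_nrm_nonneg)
  show ?thesis
  proof (rule C.multiplierI)
    fix g assume g: "g \<in> carrier (fun_tensor X A)"
    then have gx: "g x \<in> carrier A" if "x \<in> X" for x
      using that by auto
    show "fst (family X A \<mu>) g \<in> carrier (fun_tensor X A)" "snd (family X A \<mu>) g \<in> carrier (fun_tensor X A)"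
      using g gx \<mu> by (auto simp: family_apply multiplierD)
    show "nrm (fun_tensor X A) (fst (family X A \<mu>) g) \<le> ?K * nrm (fun_tensor X A) g"
      unfolding nrm_fun_tensor_le_iff[OF X]
    proof (intro conjI ballI)
      fix x assume x: "x \<in> X"
      have "nrm A (fst (\<mu> x) (g x)) \<le> nrm (multiplier_alg A) (\<mu> x) * nrm A (g x)"
        using x \<mu> gx by (intro multiplier_bound)
      also have "\<dots> \<le> ?K * nrm (fun_tensor X A) g"
        using x \<mu> X gx K member_le_sum[of x X "\<lambda>x. nrm (multiplier_alg A) (\<mu> x)"]
        by (intro mult_mono nrm_fun_tensor_ge) (auto simp: multiplier_nrm_nonneg nrm_nonneg)
      finally show "nrm A (fst (family X A \<mu>) g x) \<le> ?K * nrm (fun_tensor X A) g"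
        using g x by (simp add: family_apply)
    qed (use K X in \<open>simp add: nrm_fun_tensor_ge\<close>)
    fix h assume h: "h \<in> carrier (fun_tensor X A)"
    then have hx: "h x \<in> carrier A" if "x \<in> X" for x
      using that by auto
    show "g \<otimes>\<^bsub>fun_tensor X A\<^esub> fst (family X A \<mu>) h = snd (family X A \<mu>) g \<otimes>\<^bsub>fun_tensor X A\<^esub> h"
      using g h gx hx multiplierD(11)[OF \<mu>] by (auto simp: family_apply intro!: restrict_ext)
  qed (auto simp: family_def)
qed

context
  fixes m
  assumes m: "m \<in> carrier (multiplier_alg (fun_tensor X A))"
begin

lemma multiplier_mem:
  "\<lbrakk>f \<in> X \<rightarrow>\<^sub>E carrier A; x \<in> X\<rbrakk> \<Longrightarrow> fst m f x \<in> carrier A"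
  "\<lbrakk>f \<in> X \<rightarrow>\<^sub>E carrier A; x \<in> X\<rbrakk> \<Longrightarrow> snd m f x \<in> carrier A"
  using multiplierD(3,4)[OF m, of f] by auto

lemma fibre_closed:
  assumes x: "x \<in> X"
  shows "fibre X A m x \<in> carrier (multiplier_alg A)"
proof (rule multiplierI)
  interpret C: cstar_algebra "fun_tensor X A"
    using X by (rule cstar_algebra_fun_tensor)
  fix b assume b: "b \<in> carrier A"
  show "fst (fibre X A m x) b \<in> carrier A" "snd (fibre X A m x) b \<in> carrier A"
    using b x by (simp_all add: fibre_def multiplier_mem)
  have "nrm A (fst m (point_mass X A x b) x) \<le> nrm (fun_tensor X A) (fst m (point_mass X A x b))"
    using X x by (rule nrm_fun_tensor_ge)
  also have "\<dots> \<le> nrm (multiplier_alg (fun_tensor X A)) m * nrm (fun_tensor X A) (point_mass X A x b)"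
    using m b by (intro C.multiplier_bound) simp_all
  also have "\<dots> \<le> nrm (multiplier_alg (fun_tensor X A)) m * nrm A b"
    using m b by (intro mult_left_mono nrm_point_mass C.multiplier_nrm_nonneg)
  finally show "nrm A (fst (fibre X A m x) b) \<le> nrm (multiplier_alg (fun_tensor X A)) m * nrm A b"
    using b by (simp add: fibre_def)
  fix c assume c: "c \<in> carrier A"
  have "point_mass X A x b \<otimes>\<^bsub>fun_tensor X A\<^esub> fst m (point_mass X A x c)
      = snd m (point_mass X A x b) \<otimes>\<^bsub>fun_tensor X A\<^esub> point_mass X A x c"
    using multiplierD(11)[OF m] b c by simp
  from fun_cong[OF this, of x] show "b \<otimes> fst (fibre X A m x) c = snd (fibre X A m x) b \<otimes> c"
    using x b c by (simp add: fibre_def point_mass_apply)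
qed (simp_all add: fibre_def)

text \<open>
  By linearity it is enough that a function \<open>d\<close> vanishing at \<open>x\<close> is sent to one that vanishes at \<open>x\<close>. For every
  \<open>b\<close>, \<open>b (m d)(x)\<close> is the value at \<open>x\<close> of \<open>(b at x) (m d) = ((b at x) m) d\<close>, which is 0; faithfulness gives
  \<open>(m d)(x) = 0\<close>.
\<close>

lemma multiplier_pointwise:
  assumes f: "f \<in> X \<rightarrow>\<^sub>E carrier A" and x: "x \<in> X"
  shows "fst m f x = fst (fibre X A m x) (f x)" "snd m f x = snd (fibre X A m x) (f x)"
proof -
  interpret C: cstar_algebra "fun_tensor X A"
    using X by (rule cstar_algebra_fun_tensor)
  have fx: "f x \<in> carrier A"
    using f x by auto
  define d where "d = f \<ominus>\<^bsub>fun_tensor X A\<^esub> point_mass X A x (f x)"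
  have dc: "d \<in> carrier (fun_tensor X A)"
    unfolding d_def using f fx by (intro C.minus_closed) simp_all
  have dx: "d x = \<zero>"
    using f fx x fun_tensor_minus[OF X, of f "point_mass X A x (f x)" x] by (simp add: d_def point_mass_apply)
  have pc: "point_mass X A x b \<in> carrier (fun_tensor X A)" if "b \<in> carrier A" for b
    using that by simp
  have f_eq: "f = point_mass X A x (f x) \<oplus>\<^bsub>fun_tensor X A\<^esub> d"
    unfolding d_def using f by (intro C.add_diff_cancel[symmetric] pc fx) simp
  have L: "fst m d x = \<zero>"
  proof (rule left_faithful)
    fix b assume b: "b \<in> carrier A"
    have "point_mass X A x b \<otimes>\<^bsub>fun_tensor X A\<^esub> fst m d = snd m (point_mass X A x b) \<otimes>\<^bsub>fun_tensor X A\<^esub> d"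
      using multiplierD(11)[OF m pc[OF b] dc] .
    from fun_cong[OF this, of x] show "b \<otimes> fst m d x = \<zero>"
      using x b dx dc by (simp add: point_mass_apply multiplier_mem)
  qed (use x dc in \<open>simp add: multiplier_mem\<close>)
  have R: "snd m d x = \<zero>"
  proof (rule right_faithful)
    fix b assume b: "b \<in> carrier A"
    have "d \<otimes>\<^bsub>fun_tensor X A\<^esub> fst m (point_mass X A x b) = snd m d \<otimes>\<^bsub>fun_tensor X A\<^esub> point_mass X A x b"
      using multiplierD(11)[OF m dc pc[OF b]] .
    from fun_cong[OF this, of x] show "snd m d x \<otimes> b = \<zero>"
      using x b dx dc by (simp add: point_mass_apply multiplier_mem)
  qed (use x dc in \<open>simp add: multiplier_mem\<close>)
  have "fst m f = fst m (point_mass X A x (f x)) \<oplus>\<^bsub>fun_tensor X A\<^esub> fst m d"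
    "snd m f = snd m (point_mass X A x (f x)) \<oplus>\<^bsub>fun_tensor X A\<^esub> snd m d"
    by (subst f_eq, rule multiplierD(5,6)[OF m pc[OF fx] dc])+
  then show "fst m f x = fst (fibre X A m x) (f x)" "snd m f x = snd (fibre X A m x) (f x)"
    using x fx L R by (simp_all add: fibre_def multiplier_mem)
qed

lemma family_fibre: "family X A (fibre X A m) = m"
proof -
  interpret C: cstar_algebra "fun_tensor X A"
    using X by (rule cstar_algebra_fun_tensor)
  show ?thesis
  proof (rule C.multiplier_eqI_fst)
    fix f assume f: "f \<in> carrier (fun_tensor X A)"
    then have "fst m f \<in> X \<rightarrow>\<^sub>E carrier A"
      using multiplierD(3)[OF m f] by simp
    then show "fst (family X A (fibre X A m)) f = fst m f"
      using f by (intro fun_eqI_on[where X = X and Y = "carrier A"])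
        (auto simp: family_apply multiplier_mem simp flip: multiplier_pointwise)
  qed (use m in \<open>auto intro: family_closed fibre_closed\<close>)
qed

end

lemma fibre_family:
  assumes "\<And>x. x \<in> X \<Longrightarrow> \<mu> x \<in> carrier (multiplier_alg A)" "x \<in> X"
  shows "fibre X A (family X A \<mu>) x = \<mu> x"
  by (rule multiplier_eqI_fst)
    (use assms in \<open>auto intro!: fibre_closed family_closed simp: fibre_apply family_apply point_mass_apply\<close>)

lemma fibre_star_hom:
  assumes x: "x \<in> X"
  shows "(\<lambda>m\<in>carrier (multiplier_alg (fun_tensor X A)). fibre X A m x)
    \<in> star_hom (multiplier_alg (fun_tensor X A)) (multiplier_alg A)"
proof -
  interpret C: cstar_algebra "fun_tensor X A"
    using X by (rule cstar_algebra_fun_tensor)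
  interpret M: cstar_algebra "multiplier_alg A"
    by (rule cstar_algebra_multiplier)
  let ?MC = "multiplier_alg (fun_tensor X A)"
  have pc: "point_mass X A x b \<in> carrier (fun_tensor X A)" if "b \<in> carrier A" for b
    using that by simp
  note closed = fibre_closed[OF _ x]
  show ?thesis
    unfolding star_hom_def
  proof (intro CollectI conjI ballI allI)
    fix m assume m: "m \<in> carrier ?MC"
    show "(\<lambda>m\<in>carrier ?MC. fibre X A m x) (c \<odot>\<^bsub>?MC\<^esub> m)
        = c \<odot>\<^bsub>multiplier_alg A\<^esub> (\<lambda>m\<in>carrier ?MC. fibre X A m x) m" for c
      using m by (simp add: C.multiplier_closed, intro multiplier_eqI_fst)
        (auto simp: closed C.multiplier_closed multiplier_apply fibre_apply x)
    have "fibre X A (star ?MC m) x = star (multiplier_alg A) (fibre X A m x)"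
    proof (rule multiplier_eqI_fst)
      fix b assume b: "b \<in> carrier A"
      have "star (fun_tensor X A) (point_mass X A x b) = point_mass X A x (star A b)"
        by (auto simp: point_mass_def intro!: restrict_ext)
      then show "fst (fibre X A (star ?MC m) x) b = fst (star (multiplier_alg A) (fibre X A m x)) b"
        using b x by (simp add: fibre_apply multiplier_apply(7)[OF pc[OF b]] multiplier_apply(7)[OF b])
    qed (use m in \<open>auto intro: closed C.multiplier_closed multiplier_closed\<close>)
    then show "(\<lambda>m\<in>carrier ?MC. fibre X A m x) (star ?MC m)
        = star (multiplier_alg A) ((\<lambda>m\<in>carrier ?MC. fibre X A m x) m)"
      using m by (simp only: restrict_apply' C.multiplier_closed(4))
    fix n assume n: "n \<in> carrier ?MC"
    show "(\<lambda>m\<in>carrier ?MC. fibre X A m x) (m \<oplus>\<^bsub>?MC\<^esub> n)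
        = (\<lambda>m\<in>carrier ?MC. fibre X A m x) m \<oplus>\<^bsub>multiplier_alg A\<^esub> (\<lambda>m\<in>carrier ?MC. fibre X A m x) n"
      using m n by (simp add: C.multiplier_closed, intro multiplier_eqI_fst)
        (auto simp: closed C.multiplier_closed multiplier_apply fibre_apply x)
    have "fibre X A (m \<otimes>\<^bsub>?MC\<^esub> n) x = fibre X A m x \<otimes>\<^bsub>multiplier_alg A\<^esub> fibre X A n x"
    proof (rule multiplier_eqI_fst)
      fix b assume b: "b \<in> carrier A"
      have "fst n (point_mass X A x b) \<in> X \<rightarrow>\<^sub>E carrier A"
        using multiplierD(3)[OF n pc[OF b]] by simp
      then show "fst (fibre X A (m \<otimes>\<^bsub>?MC\<^esub> n) x) b
          = fst (fibre X A m x \<otimes>\<^bsub>multiplier_alg A\<^esub> fibre X A n x) b"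
        using b x m by (simp add: fibre_apply[OF b] multiplier_apply multiplier_pointwise(1)[OF m])
    qed (use m n in \<open>auto intro: closed C.multiplier_closed multiplier_closed\<close>)
    then show "(\<lambda>m\<in>carrier ?MC. fibre X A m x) (m \<otimes>\<^bsub>?MC\<^esub> n)
        = (\<lambda>m\<in>carrier ?MC. fibre X A m x) m \<otimes>\<^bsub>multiplier_alg A\<^esub> (\<lambda>m\<in>carrier ?MC. fibre X A m x) n"
      using m n by (simp only: restrict_apply' C.multiplier_closed(1))
  qed (auto simp: closed)
qed

lemma fibre_one:
  assumes x: "x \<in> X"
  shows "fibre X A \<one>\<^bsub>multiplier_alg (fun_tensor X A)\<^esub> x = \<one>\<^bsub>multiplier_alg A\<^esub>"
proof -
  interpret C: cstar_algebra "fun_tensor X A"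
    using X by (rule cstar_algebra_fun_tensor)
  show ?thesis
    by (rule multiplier_eqI_fst)
      (use x in \<open>auto intro!: fibre_closed C.multiplier_zero_one_closed multiplier_zero_one_closed
        simp: multiplier_apply fibre_apply point_mass_apply\<close>)
qed

lemma fibre_mult:
  assumes "x \<in> X" "m \<in> carrier (multiplier_alg (fun_tensor X A))" "n \<in> carrier (multiplier_alg (fun_tensor X A))"
  shows "fibre X A (m \<otimes>\<^bsub>multiplier_alg (fun_tensor X A)\<^esub> n) x
    = fibre X A m x \<otimes>\<^bsub>multiplier_alg A\<^esub> fibre X A n x"
proof -
  interpret C: cstar_algebra "fun_tensor X A"
    using X by (rule cstar_algebra_fun_tensor)
  show ?thesis
    using star_homD(4)[OF fibre_star_hom[OF assms(1)] assms(2,3)] assms by (simp add: C.multiplier_closed)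
qed

end

end

section \<open>Leg numbering\<close>

context pre_cstar_algebra
begin

lemma finsum_fun_tensor:
  assumes "finite X" "finite S" "f \<in> S \<rightarrow> carrier (fun_tensor X A)" "x \<in> X"
  shows "(\<Oplus>\<^bsub>fun_tensor X A\<^esub>i\<in>S. f i) x = (\<Oplus>i\<in>S. f i x)"
proof -
  interpret C: pre_cstar_algebra "fun_tensor X A"
    using assms(1) by (rule pre_cstar_algebra_fun_tensor)
  show ?thesis
    using assms(2,3)
  proof (induction S)
    case (insert i S)
    then have "f i x \<in> carrier A" "(\<lambda>i. f i x) \<in> S \<rightarrow> carrier A"
      using \<open>x \<in> X\<close> by (auto simp: Pi_iff)
    moreover have "(\<Oplus>\<^bsub>fun_tensor X A\<^esub>i\<in>insert i S. f i) = f i \<oplus>\<^bsub>fun_tensor X A\<^esub> (\<Oplus>\<^bsub>fun_tensor X A\<^esub>i\<in>S. f i)"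
      using insert by (intro C.finsum_insert) (auto simp: Pi_iff)
    ultimately show ?case
      using insert \<open>x \<in> X\<close> by (simp add: Pi_iff)
  qed (use \<open>x \<in> X\<close> in simp)
qed

end

lemma fun_tensor2_zeroI:
  assumes d: "d \<in> carrier (fun_tensor X (fun_tensor Y B))" and zero: "\<And>x y. \<lbrakk>x \<in> X; y \<in> Y\<rbrakk> \<Longrightarrow> d x y = \<zero>\<^bsub>B\<^esub>"
  shows "d = \<zero>\<^bsub>fun_tensor X (fun_tensor Y B)\<^esub>"
proof (rule extensionalityI[of _ X])
  fix x assume x: "x \<in> X"
  with d have "d x \<in> extensional Y"
    by (auto simp: PiE_def)
  then have "d x = (\<lambda>y\<in>Y. \<zero>\<^bsub>B\<^esub>)"
    using zero x by (intro extensionalityI[of _ Y]) auto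
  with x show "d x = \<zero>\<^bsub>fun_tensor X (fun_tensor Y B)\<^esub> x"
    by simp
qed (use d in \<open>auto simp: PiE_def\<close>)

context cstar_algebra
begin

context
  fixes X :: "'x set"
  assumes X: "finite X"
begin

text \<open>
  By uniqueness of the extension it is enough to compare the two sides on the functions \<open>incl13 X f\<close>, where both
  have the value \<open>(m f)(x)\<close> at \<open>(x, y)\<close>.
\<close>

lemma leg13_eq:
  assumes m: "m \<in> carrier (multiplier_alg (fun_tensor X A))"
  shows "leg13 X A m = family X (fun_tensor X A) (\<lambda>x. family X A (\<lambda>_. fibre X A m x))"
proof -
  let ?C = "fun_tensor X A" and ?D = "fun_tensor X (fun_tensor X A)"
  interpret C: cstar_algebra ?C
    using X by (rule cstar_algebra_fun_tensor)
  interpret D: cstar_algebra ?D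
    using X by (rule C.cstar_algebra_fun_tensor)
  show ?thesis
    unfolding leg13_def Let_def
  proof (rule D.mor_ext_mor_of)
    show "family X ?C (\<lambda>x. family X A (\<lambda>_. fibre X A m x)) \<in> carrier (multiplier_alg ?D)"
      using X m by (intro C.family_closed family_closed fibre_closed)
  next
    fix f assume f: "f \<in> carrier ?C"
    then show "incl13 X f \<in> carrier ?D"
      by (auto simp: incl13_def)
    show "fst m f \<in> carrier ?C"
      using m f by (rule multiplierD)
    have fx: "f x \<in> carrier A" if "x \<in> X" for x
      using f that by auto
    have "(\<lambda>y\<in>X. f x) \<in> X \<rightarrow>\<^sub>E carrier A" if "x \<in> X" for x
      using fx that by auto
    then have "(\<lambda>x\<in>X. \<lambda>y\<in>X. f x) \<in> X \<rightarrow>\<^sub>E carrier ?C"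
      by auto
    then show "fst (family X ?C (\<lambda>x. family X A (\<lambda>_. fibre X A m x))) (incl13 X f) = incl13 X (fst m f)"
      using f fx by (auto simp: incl13_def family_apply multiplier_pointwise[OF X m] intro!: restrict_ext)
  next
    fix d assume d: "d \<in> carrier ?D" and *: "\<And>f. f \<in> carrier ?C \<Longrightarrow> d \<otimes>\<^bsub>?D\<^esub> incl13 X f = \<zero>\<^bsub>?D\<^esub>"
    have "d x y = \<zero>" if x: "x \<in> X" and y: "y \<in> X" for x y
    proof (rule right_faithful)
      show "d x y \<in> carrier A"
        using d x y by auto
      fix z assume z: "z \<in> carrier A"
      have "(d \<otimes>\<^bsub>?D\<^esub> incl13 X (point_mass X A x z)) x y = \<zero>\<^bsub>?D\<^esub> x y"
        using *[of "point_mass X A x z"] z X by (simp add: point_mass_closed)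
      then show "d x y \<otimes> z = \<zero>"
        using x y by (simp add: incl13_def point_mass_apply)
    qed
    then show "d = \<zero>\<^bsub>?D\<^esub>"
      using d by (intro fun_tensor2_zeroI) auto
  qed
qed

lemma leg23_eq:
  assumes m: "m \<in> carrier (multiplier_alg (fun_tensor X A))"
  shows "leg23 X A m = family X (fun_tensor X A) (\<lambda>_. m)"
proof -
  let ?C = "fun_tensor X A" and ?D = "fun_tensor X (fun_tensor X A)"
  interpret C: cstar_algebra ?C
    using X by (rule cstar_algebra_fun_tensor)
  interpret D: cstar_algebra ?D
    using X by (rule C.cstar_algebra_fun_tensor)
  have incl: "incl23 X f = (\<lambda>x\<in>X. f)" if "f \<in> carrier ?C" for f
    using that by (auto simp: incl23_def PiE_def extensional_restrict intro!: restrict_ext)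
  show ?thesis
    unfolding leg23_def Let_def
  proof (rule D.mor_ext_mor_of)
    show "family X ?C (\<lambda>_. m) \<in> carrier (multiplier_alg ?D)"
      using X m by (intro C.family_closed)
  next
    fix f assume f: "f \<in> carrier ?C"
    then show "incl23 X f \<in> carrier ?D"
      by (auto simp: incl23_def)
    show mf: "fst m f \<in> carrier ?C"
      using m f by (rule multiplierD)
    have "(\<lambda>x\<in>X. f) \<in> X \<rightarrow>\<^sub>E carrier ?C"
      using f by auto
    then show "fst (family X ?C (\<lambda>_. m)) (incl23 X f) = incl23 X (fst m f)"
      unfolding incl[OF f] incl[OF mf] by (auto simp: family_apply intro!: restrict_ext)
  next
    fix d assume d: "d \<in> carrier ?D" and *: "\<And>f. f \<in> carrier ?C \<Longrightarrow> d \<otimes>\<^bsub>?D\<^esub> incl23 X f = \<zero>\<^bsub>?D\<^esub>"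
    have "d x y = \<zero>" if x: "x \<in> X" and y: "y \<in> X" for x y
    proof (rule right_faithful)
      show "d x y \<in> carrier A"
        using d x y by auto
      fix z assume z: "z \<in> carrier A"
      have "(d \<otimes>\<^bsub>?D\<^esub> incl23 X (point_mass X A y z)) x y = \<zero>\<^bsub>?D\<^esub> x y"
        using *[of "point_mass X A y z"] z X by (simp add: point_mass_closed)
      then show "d x y \<otimes> z = \<zero>"
        using x y by (simp add: incl23_def point_mass_apply)
    qed
    then show "d = \<zero>\<^bsub>?D\<^esub>"
      using d by (intro fun_tensor2_zeroI) auto
  qed
qed

lemma eval2_eq:
  assumes n: "n \<in> carrier (multiplier_alg (fun_tensor X (fun_tensor X A)))" and x: "x \<in> X" and y: "y \<in> X"
  shows "eval2 X A x y n = fibre X A (fibre X (fun_tensor X A) n x) y"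
proof -
  let ?C = "fun_tensor X A" and ?D = "fun_tensor X (fun_tensor X A)"
  interpret C: cstar_algebra ?C
    using X by (rule cstar_algebra_fun_tensor)
  interpret D: cstar_algebra ?D
    using X by (rule C.cstar_algebra_fun_tensor)
  have n': "fibre X ?C n x \<in> carrier (multiplier_alg ?C)"
    using X n x by (rule C.fibre_closed)
  show ?thesis
    unfolding eval2_def Let_def
  proof (rule mor_ext_mor_of)
    show "fibre X A (fibre X ?C n x) y \<in> carrier (multiplier_alg A)"
      using X n' y by (rule fibre_closed)
  next
    fix F assume F: "F \<in> carrier ?D"
    then have Fx: "F x \<in> X \<rightarrow>\<^sub>E carrier A"
      using x by auto
    then show "F x y \<in> carrier A"
      using y by auto
    show "fst n F \<in> carrier ?D"
      using n F by (rule multiplierD)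
    show "fst (fibre X A (fibre X ?C n x) y) (F x y) = fst n F x y"
      using F Fx by (simp add: C.multiplier_pointwise[OF X n _ x] multiplier_pointwise[OF X n' _ y])
  next
    fix d assume d: "d \<in> carrier A" and *: "\<And>F. F \<in> carrier ?D \<Longrightarrow> d \<otimes> F x y = \<zero>"
    show "d = \<zero>"
    proof (rule right_faithful[OF d])
      fix z assume "z \<in> carrier A"
      then have "point_mass X A y z \<in> carrier ?C"
        using X by (simp add: point_mass_closed)
      then have "point_mass X ?C x (point_mass X A y z) \<in> carrier ?D"
        using C.point_mass_closed[OF X] unfolding fun_tensor_simps(1)[of X ?C] by blast
      from *[OF this] show "d \<otimes> z = \<zero>"
        using x y by (simp add: point_mass_apply)
    qed
  qed
qed

text \<open>
  Evaluation at \<open>(x, y)\<close> is multiplicative, and it picks the fibre at \<open>x\<close> from the leg 13 and the fibre at \<open>y\<close>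
  from the leg 23.
\<close>

lemma eval2_legs:
  assumes m: "m \<in> carrier (multiplier_alg (fun_tensor X A))"
    and n: "n \<in> carrier (multiplier_alg (fun_tensor X A))" and x: "x \<in> X" and y: "y \<in> X"
  shows "eval2 X A x y (leg13 X A m \<otimes>\<^bsub>multiplier_alg (fun_tensor X (fun_tensor X A))\<^esub> leg23 X A n)
    = fibre X A m x \<otimes>\<^bsub>multiplier_alg A\<^esub> fibre X A n y"
proof -
  let ?C = "fun_tensor X A" and ?D = "fun_tensor X (fun_tensor X A)"
  interpret C: cstar_algebra ?C
    using X by (rule cstar_algebra_fun_tensor)
  interpret D: cstar_algebra ?D
    using X by (rule C.cstar_algebra_fun_tensor)
  have const: "family X A (\<lambda>_. fibre X A m x) \<in> carrier (multiplier_alg ?C)" if "x \<in> X" for x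
    using X m that by (intro family_closed fibre_closed)
  have legs: "leg13 X A m \<in> carrier (multiplier_alg ?D)" "leg23 X A n \<in> carrier (multiplier_alg ?D)"
    unfolding leg13_eq[OF m] leg23_eq[OF n] using X n const by (auto intro: C.family_closed)
  have "fibre X ?C (leg13 X A m) x = family X A (\<lambda>_. fibre X A m x)" "fibre X ?C (leg23 X A n) x = n"
    unfolding leg13_eq[OF m] leg23_eq[OF n]
    by (rule C.fibre_family[OF X _ x]; use n const in blast)+
  moreover have "fibre X A (family X A (\<lambda>_. fibre X A m x)) y = fibre X A m x"
    using X m x y by (intro fibre_family fibre_closed)
  ultimately show ?thesis
    using X legs x y n const[OF x]
    by (simp add: eval2_eq D.multiplier_closed C.fibre_mult fibre_mult)
qed

end

end

section \<open>Units and non-degeneracy\<close>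

text \<open>
  The multiplier \<open>\<Phi> 1\<close> fixes every \<open>\<Phi>(a) c\<close>. These elements are dense and \<open>\<Phi> 1\<close> is bounded, so it fixes
  everything.
\<close>

lemma Mor_one:
  assumes "cstar_algebra C" "unital A" and \<Phi>: "\<Phi> \<in> Mor A C"
  shows "\<Phi> \<one>\<^bsub>A\<^esub> = \<one>\<^bsub>multiplier_alg C\<^esub>"
proof -
  interpret C: cstar_algebra C by fact
  let ?M = "multiplier_alg C"
  define S where "S = {fst (\<Phi> a) c | a c. a \<in> carrier A \<and> c \<in> carrier C}"
  have hom: "\<Phi> \<in> star_hom A ?M" and dense: "Metric_space.mtopology (carrier C) (cdist C) closure_of S = carrier C"
    using \<Phi> by (simp_all add: Mor_def S_def)
  have one: "\<one>\<^bsub>A\<^esub> \<in> carrier A" "\<And>a. a \<in> carrier A \<Longrightarrow> \<one>\<^bsub>A\<^esub> \<otimes>\<^bsub>A\<^esub> a = a"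
    using assms(2) by (auto simp: unital_def)
  define p where "p = \<Phi> \<one>\<^bsub>A\<^esub>"
  have p: "p \<in> carrier ?M"
    using star_homD(1)[OF hom one(1)] by (simp add: p_def)
  have fix_S: "fst p y = y" "y \<in> carrier C" if yS: "y \<in> S" for y
  proof -
    obtain a c where y: "y = fst (\<Phi> a) c" "a \<in> carrier A" "c \<in> carrier C"
      using yS unfolding S_def by blast
    have "p \<otimes>\<^bsub>?M\<^esub> \<Phi> a = \<Phi> a"
      using star_homD(4)[OF hom one(1) y(2)] one(2)[OF y(2)] by (simp add: p_def)
    then show "fst p y = y"
      using multiplier_apply(1)[OF y(3), of p "\<Phi> a"] y(1) by simp
    show "y \<in> carrier C"
      using y multiplierD(3)[OF star_homD(1)[OF hom y(2)] y(3)] by simp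
  qed
  have "fst p c = c" if c: "c \<in> carrier C" for c
  proof -
    have pc: "fst p c \<in> carrier C"
      using p c by (rule multiplierD)
    have "nrm C (fst p c \<ominus>\<^bsub>C\<^esub> c) \<le> 0"
    proof (rule dense_ge)
      fix e :: real assume "0 < e"
      define K where "K = nrm ?M p + 1"
      have K: "K > 0"
        using C.multiplier_nrm_nonneg[OF p] by (simp add: K_def)
      have "c \<in> Metric_space.mtopology (carrier C) (cdist C) closure_of S"
        using c dense by simp
      then obtain y where "y \<in> S" "y \<in> Metric_space.mball (carrier C) (cdist C) c (e / K)"
        using divide_pos_pos[OF \<open>0 < e\<close> K] unfolding Metric_space.metric_closure_of[OF C.metric] by blast
      then have y: "y \<in> carrier C" "fst p y = y" "nrm C (c \<ominus>\<^bsub>C\<^esub> y) < e / K"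
        using fix_S c by (simp_all add: Metric_space.in_mball[OF C.metric] cdist_def)
      have "fst p c \<ominus>\<^bsub>C\<^esub> y = fst p (c \<ominus>\<^bsub>C\<^esub> y)"
        using p c y(1,2) by (simp add: a_minus_def C.minus_eq_scale multiplierD)
      then have "nrm C (fst p c \<ominus>\<^bsub>C\<^esub> y) \<le> nrm ?M p * nrm C (c \<ominus>\<^bsub>C\<^esub> y)"
        using C.multiplier_bound[OF p, of "c \<ominus>\<^bsub>C\<^esub> y"] c y by simp
      then have "nrm C (fst p c \<ominus>\<^bsub>C\<^esub> c) \<le> K * nrm C (c \<ominus>\<^bsub>C\<^esub> y)"
        using C.nrm_diff_triangle[OF pc y(1) c] C.nrm_diff_commute[OF c y(1)] by (simp add: K_def distrib_right)
      also have "\<dots> \<le> e"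
        using y(3) K by (simp add: field_simps)
      finally show "nrm C (fst p c \<ominus>\<^bsub>C\<^esub> c) \<le> e" .
    qed
    then have "nrm C (fst p c \<ominus>\<^bsub>C\<^esub> c) = 0"
      using C.nrm_nonneg[of "fst p c \<ominus>\<^bsub>C\<^esub> c"] c pc by simp
    then show ?thesis
      using c pc by (simp add: C.nrm_eq_zero_iff C.diff_eq_zero_iff)
  qed
  then show ?thesis
    unfolding p_def[symmetric]
    by (intro C.multiplier_eqI_fst) (simp_all add: p C.multiplier_zero_one_closed multiplier_apply)
qed

lemma MorI:
  assumes "cstar_algebra C" "\<one>\<^bsub>A\<^esub> \<in> carrier A" and \<Phi>: "\<Phi> \<in> star_hom A (multiplier_alg C)"
    and one: "\<Phi> \<one>\<^bsub>A\<^esub> = \<one>\<^bsub>multiplier_alg C\<^esub>"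
  shows "\<Phi> \<in> Mor A C"
proof -
  interpret C: cstar_algebra C by fact
  let ?T = "Metric_space.mtopology (carrier C) (cdist C)"
  let ?S = "{fst (\<Phi> a) c | a c. a \<in> carrier A \<and> c \<in> carrier C}"
  have "carrier C \<subseteq> ?S"
  proof
    fix c assume c: "c \<in> carrier C"
    then have "c = fst (\<Phi> \<one>\<^bsub>A\<^esub>) c"
      by (simp add: one multiplier_apply)
    with c assms(2) show "c \<in> ?S"
      unfolding mem_Collect_eq by (intro exI conjI)
  qed
  moreover have "?S \<subseteq> carrier C"
    using multiplierD(3)[OF star_homD(1)[OF \<Phi>]] by auto
  ultimately have S: "?S = carrier C"
    by blast
  have "?T closure_of carrier C = carrier C"
    using closure_of_topspace[of ?T] by (simp add: Metric_space.topspace_mtopology[OF C.metric])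
  then show ?thesis
    using \<Phi> S by (simp add: Mor_def)
qed


lemma star_hom_comp:
  assumes \<Phi>: "\<Phi> \<in> star_hom A C" and \<Psi>: "\<Psi> \<in> star_hom C D"
    and A: "pre_cstar_algebra A"
  shows "(\<lambda>a\<in>carrier A. \<Psi> (\<Phi> a)) \<in> star_hom A D"
proof -
  interpret A: pre_cstar_algebra A by fact
  show ?thesis
    unfolding star_hom_def
    by (simp add: star_homD(1,3-6)[OF \<Phi>] star_homD(1,3-6)[OF \<Psi>])
qed

lemma id_tensor_eq_family:
  "f \<in> carrier (fun_tensor X A) \<Longrightarrow> id_tensor X A B \<Theta> f = family X B (\<lambda>x. \<Theta> (f x))"
  by (simp add: id_tensor_def family_def)

text \<open>
  For \<open>\<phi>\<close> with values in \<open>fun_tensor X A\<close> itself, the composition in the sense of morphisms is the naive one,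
  since \<open>(id \<otimes> \<Theta>) (\<phi> v) (id \<otimes> \<Theta>) f = (id \<otimes> \<Theta>) (\<phi> v f)\<close>.
\<close>

lemma mor_comp_id_tensor:
  assumes A: "cstar_algebra A" "unital A" and B: "cstar_algebra B" and X: "finite X"
    and \<Theta>: "\<Theta> \<in> star_hom A (multiplier_alg B)" "\<Theta> \<one>\<^bsub>A\<^esub> = \<one>\<^bsub>multiplier_alg B\<^esub>"
    and v: "v \<in> carrier F" and \<phi>v: "\<phi> v \<in> carrier (fun_tensor X A)"
  shows "mor_comp F (fun_tensor X A) (fun_tensor X B) (id_tensor X A B \<Theta>)
      (mor_of F (fun_tensor X A) \<phi>) v = family X B (\<lambda>x. \<Theta> (\<phi> v x))"
proof -
  interpret A: cstar_algebra A by fact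
  interpret B: cstar_algebra B by fact
  interpret CA: cstar_algebra "fun_tensor X A"
    using X by (rule A.cstar_algebra_fun_tensor)
  interpret CB: cstar_algebra "fun_tensor X B"
    using X by (rule B.cstar_algebra_fun_tensor)
  let ?M = "multiplier_alg (fun_tensor X B)"
  note hom = star_homD[OF \<Theta>(1)]
  have closed: "id_tensor X A B \<Theta> f \<in> carrier ?M" if f: "f \<in> carrier (fun_tensor X A)" for f
    unfolding id_tensor_eq_family[OF f] using X f hom(1) by (intro B.family_closed) auto
  have "mor_ext (fun_tensor X A) (fun_tensor X B) (id_tensor X A B \<Theta>)
      (mult_embed (fun_tensor X A) (\<phi> v)) = id_tensor X A B \<Theta> (\<phi> v)"
  proof (rule CB.mor_ext_eqI[where C = "fun_tensor X A" and \<Phi> = "id_tensor X A B \<Theta>"])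
    fix f assume f: "f \<in> carrier (fun_tensor X A)"
    have prod: "\<phi> v \<otimes>\<^bsub>fun_tensor X A\<^esub> f \<in> carrier (fun_tensor X A)"
      using \<phi>v f by (rule CA.mult_closed)
    have "id_tensor X A B \<Theta> (\<phi> v) \<otimes>\<^bsub>?M\<^esub> id_tensor X A B \<Theta> f
        = id_tensor X A B \<Theta> (\<phi> v \<otimes>\<^bsub>fun_tensor X A\<^esub> f)"
    proof (rule CB.multiplier_eqI_fst)
      fix g assume g: "g \<in> carrier (fun_tensor X B)"
      have mem: "\<phi> v x \<in> carrier A" "f x \<in> carrier A" "g x \<in> carrier B" if "x \<in> X" for x
        using that \<phi>v f g by auto
      then have fg: "(\<lambda>x\<in>X. fst (\<Theta> (f x)) (g x)) \<in> X \<rightarrow>\<^sub>E carrier B"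
        using multiplierD(3)[OF hom(1)] by auto
      have "fst (id_tensor X A B \<Theta> (\<phi> v) \<otimes>\<^bsub>?M\<^esub> id_tensor X A B \<Theta> f) g
          = (\<lambda>x\<in>X. fst (\<Theta> (\<phi> v x)) (fst (\<Theta> (f x)) (g x)))"
        using g family_apply(1)[OF fg]
        unfolding multiplier_apply(1)[OF g] id_tensor_eq_family[OF f] id_tensor_eq_family[OF \<phi>v]
        by (simp add: family_apply(1)[of g] cong: restrict_cong)
      also have "\<dots> = (\<lambda>x\<in>X. fst (\<Theta> (\<phi> v x \<otimes>\<^bsub>A\<^esub> f x)) (g x))"
        using mem by (intro restrict_ext) (simp add: hom(4) multiplier_apply)
      also have "\<dots> = fst (id_tensor X A B \<Theta> (\<phi> v \<otimes>\<^bsub>fun_tensor X A\<^esub> f)) g"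
        using g unfolding id_tensor_eq_family[OF prod] by (simp add: family_apply cong: restrict_cong)
      finally show "fst (id_tensor X A B \<Theta> (\<phi> v) \<otimes>\<^bsub>?M\<^esub> id_tensor X A B \<Theta> f) g
          = fst (id_tensor X A B \<Theta> (\<phi> v \<otimes>\<^bsub>fun_tensor X A\<^esub> f)) g" .
    qed (intro CB.multiplier_closed closed f \<phi>v prod)+
    then show "id_tensor X A B \<Theta> (\<phi> v) \<otimes>\<^bsub>?M\<^esub> id_tensor X A B \<Theta> f
        = id_tensor X A B \<Theta> (fst (mult_embed (fun_tensor X A) (\<phi> v)) f)"
      by (simp only: CA.mult_embed_apply(1)[OF f])
  next
    fix d assume d: "d \<in> carrier (fun_tensor X B)"
      and zero: "\<And>f. f \<in> carrier (fun_tensor X A) \<Longrightarrow> snd (id_tensor X A B \<Theta> f) d = \<zero>\<^bsub>fun_tensor X B\<^esub>"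
    have one: "\<one>\<^bsub>fun_tensor X A\<^esub> \<in> carrier (fun_tensor X A)"
    proof -
      have "\<one>\<^bsub>A\<^esub> \<in> carrier A"
        using A(2) unfolding unital_def by (rule conjunct1)
      then show ?thesis
        by simp
    qed
    have dx: "d x \<in> carrier B" if "x \<in> X" for x
      using d that by auto
    have "snd (id_tensor X A B \<Theta> \<one>\<^bsub>fun_tensor X A\<^esub>) d = (\<lambda>x\<in>X. snd (\<Theta> \<one>\<^bsub>A\<^esub>) (d x))"
      unfolding id_tensor_eq_family[OF one] using d by (simp add: family_apply cong: restrict_cong)
    also have "\<dots> = (\<lambda>x\<in>X. d x)"
      using dx by (intro restrict_ext) (simp add: \<Theta>(2) multiplier_apply)
    also have "\<dots> = d"
      using d by (auto simp: PiE_def extensional_restrict)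
    finally have "snd (id_tensor X A B \<Theta> \<one>\<^bsub>fun_tensor X A\<^esub>) d = d" .
    then show "d = \<zero>\<^bsub>fun_tensor X B\<^esub>"
      using zero[OF one] by simp
  qed (use closed \<phi>v in auto)
  then show ?thesis
    using v id_tensor_eq_family[OF \<phi>v] by (simp add: mor_comp_def mor_of_def)
qed

section \<open>The commutative algebra of functions\<close>

lemma complex_cstar_simps [simp]:
  "carrier complex_cstar = UNIV" "x \<otimes>\<^bsub>complex_cstar\<^esub> y = x * y" "x \<oplus>\<^bsub>complex_cstar\<^esub> y = x + y"
  "\<zero>\<^bsub>complex_cstar\<^esub> = 0" "\<one>\<^bsub>complex_cstar\<^esub> = 1" "c \<odot>\<^bsub>complex_cstar\<^esub> x = c * x"
  "star complex_cstar x = cnj x" "nrm complex_cstar x = cmod x"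
  by (simp_all add: complex_cstar_def)

lemma pre_cstar_algebra_complex: "pre_cstar_algebra complex_cstar"
proof (intro pre_cstar_algebra.intro pre_cstar_algebra_axioms.intro abelian_groupI)
  show "\<exists>y\<in>carrier complex_cstar. y \<oplus>\<^bsub>complex_cstar\<^esub> x = \<zero>\<^bsub>complex_cstar\<^esub>" for x
    by (rule bexI[of _ "- x"]) simp_all
qed (simp_all add: algebra_simps norm_mult norm_triangle_ineq power2_eq_square)

lemma unital_fun_alg: "unital (fun_alg X)"
  by (auto simp: unital_def fun_alg_def PiE_def intro!: extensionalityI[of _ X])

context
  fixes X :: "'x set"
  assumes X: "finite X"
begin

lemma fun_alg_expand:
  assumes v: "v \<in> carrier (fun_alg X)"
  shows "v = (\<Oplus>\<^bsub>fun_alg X\<^esub>a\<in>X. v a \<odot>\<^bsub>fun_alg X\<^esub> unit_vec X a)"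
proof -
  interpret \<C>: pre_cstar_algebra complex_cstar
    by (rule pre_cstar_algebra_complex)
  interpret F: pre_cstar_algebra "fun_alg X"
    unfolding fun_alg_def using X by (rule \<C>.pre_cstar_algebra_fun_tensor)
  have unit: "unit_vec X a \<in> carrier (fun_alg X)" for a
    by (simp add: unit_vec_def fun_alg_def)
  show ?thesis
  proof (rule extensionalityI[of _ X])
    have "(\<Oplus>\<^bsub>fun_alg X\<^esub>a\<in>X. v a \<odot>\<^bsub>fun_alg X\<^esub> unit_vec X a) \<in> carrier (fun_alg X)"
      by (rule F.finsum_closed) (simp add: unit F.scale_closed)
    then show "(\<Oplus>\<^bsub>fun_alg X\<^esub>a\<in>X. v a \<odot>\<^bsub>fun_alg X\<^esub> unit_vec X a) \<in> extensional X"
      by (simp add: fun_alg_def PiE_def)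
    fix b assume b: "b \<in> X"
    have "(\<Oplus>\<^bsub>fun_alg X\<^esub>a\<in>X. v a \<odot>\<^bsub>fun_alg X\<^esub> unit_vec X a) b
        = (\<Oplus>\<^bsub>complex_cstar\<^esub>a\<in>X. (v a \<odot>\<^bsub>fun_alg X\<^esub> unit_vec X a) b)"
      unfolding fun_alg_def using X b by (intro \<C>.finsum_fun_tensor) (auto simp: unit_vec_def)
    also have "\<dots> = (\<Oplus>\<^bsub>complex_cstar\<^esub>a\<in>X. if b = a then v a else \<zero>\<^bsub>complex_cstar\<^esub>)"
      using b by (intro \<C>.finsum_cong') (auto simp: unit_vec_def fun_alg_def)
    also have "\<dots> = v b"
      using X b by (intro \<C>.finsum_singleton) auto
    finally show "v b = (\<Oplus>\<^bsub>fun_alg X\<^esub>a\<in>X. v a \<odot>\<^bsub>fun_alg X\<^esub> unit_vec X a) b" ..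
  qed (use v in \<open>simp add: fun_alg_def PiE_def\<close>)
qed

lemma star_hom_fun_alg_expand:
  assumes "pre_cstar_algebra D" and h: "h \<in> star_hom (fun_alg X) D" and v: "v \<in> carrier (fun_alg X)"
  shows "h v = (\<Oplus>\<^bsub>D\<^esub>a\<in>X. v a \<odot>\<^bsub>D\<^esub> h (unit_vec X a))"
proof -
  interpret D: pre_cstar_algebra D by fact
  interpret \<C>: pre_cstar_algebra complex_cstar
    by (rule pre_cstar_algebra_complex)
  interpret F: pre_cstar_algebra "fun_alg X"
    unfolding fun_alg_def using X by (rule \<C>.pre_cstar_algebra_fun_tensor)
  have unit: "unit_vec X a \<in> carrier (fun_alg X)" for a
    by (simp add: unit_vec_def fun_alg_def)
  have "h v = h (\<Oplus>\<^bsub>fun_alg X\<^esub>a\<in>X. v a \<odot>\<^bsub>fun_alg X\<^esub> unit_vec X a)"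
    using fun_alg_expand[OF v] by simp
  also have "\<dots> = (\<Oplus>\<^bsub>D\<^esub>a\<in>X. h (v a \<odot>\<^bsub>fun_alg X\<^esub> unit_vec X a))"
  proof (rule star_hom_finsum[where \<Phi> = h and A = "fun_alg X" and D = D and S = X and f = "\<lambda>a. v a \<odot>\<^bsub>fun_alg X\<^esub> unit_vec X a"])
    show "h \<zero>\<^bsub>fun_alg X\<^esub> = \<zero>\<^bsub>D\<^esub>"
      using F.pre_cstar_algebra_axioms D.pre_cstar_algebra_axioms h by (rule star_hom_zero)
  qed (use X h unit in \<open>auto simp: F.abelian_group_axioms D.abelian_group_axioms F.scale_closed\<close>)
  also have "\<dots> = (\<Oplus>\<^bsub>D\<^esub>a\<in>X. v a \<odot>\<^bsub>D\<^esub> h (unit_vec X a))"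
    using star_homD(1,5)[OF h] unit by (intro D.finsum_cong') (auto simp: D.scale_closed)
  finally show ?thesis .
qed

end

section \<open>The algebra of a synchronous game\<close>

text \<open>
  The function \<open>\<phi>\<close> is the image of \<open>v\<close> under the linear map \<open>e\<^sub>a \<mapsto> \<Sum>\<^sub>x e\<^sub>x \<otimes> p\<^sub>x\<^sub>a\<close>, in the form in which it occurs
  in \<open>game_mor\<close>.
\<close>

lemma (in pre_cstar_algebra) finsum_tens:
  fixes v :: "'s \<Rightarrow> complex"
  assumes X: "finite X" and S: "finite S" and p: "\<And>x a. \<lbrakk>x \<in> X; a \<in> S\<rbrakk> \<Longrightarrow> p x a \<in> carrier A"
  defines "\<phi> \<equiv> \<Oplus>\<^bsub>fun_tensor X A\<^esub>a\<in>S. v a \<odot>\<^bsub>fun_tensor X A\<^esub>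
      (\<Oplus>\<^bsub>fun_tensor X A\<^esub>x\<in>X. tens X A (unit_vec X x) (p x a))"
  shows "\<phi> \<in> carrier (fun_tensor X A)"
    and "x \<in> X \<Longrightarrow> \<phi> x = (\<Oplus>a\<in>S. v a \<odot> p x a)"
proof -
  let ?C = "fun_tensor X A"
  interpret C: pre_cstar_algebra ?C
    using X by (rule pre_cstar_algebra_fun_tensor)
  define s where "s a = (\<Oplus>\<^bsub>?C\<^esub>x\<in>X. tens X A (unit_vec X x) (p x a))" for a
  have tens: "tens X A (unit_vec X x) (p x a) \<in> carrier ?C" if "x \<in> X" "a \<in> S" for x a
    using p[OF that] by (simp add: tens_def)
  have s_closed: "s a \<in> carrier ?C" if "a \<in> S" for a
    unfolding s_def using tens[OF _ that] by (intro C.finsum_closed) blast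
  have s_apply: "s a x = p x a" if x: "x \<in> X" and a: "a \<in> S" for x a
  proof -
    have "s a x = (\<Oplus>y\<in>X. tens X A (unit_vec X y) (p y a) x)"
      unfolding s_def using X tens[OF _ a] x by (intro finsum_fun_tensor) blast+
    also have "\<dots> = (\<Oplus>y\<in>X. if x = y then p y a else \<zero>)"
      using x p[OF _ a] by (intro finsum_cong') (auto simp: tens_def unit_vec_def scale_one)
    also have "\<dots> = p x a"
      using x X p[OF _ a] by (intro add.finprod_singleton) auto
    finally show ?thesis .
  qed
  have \<phi>: "\<phi> = (\<Oplus>\<^bsub>?C\<^esub>a\<in>S. v a \<odot>\<^bsub>?C\<^esub> s a)"
    by (simp only: \<phi>_def s_def)
  have vs: "(\<lambda>a. v a \<odot>\<^bsub>?C\<^esub> s a) \<in> S \<rightarrow> carrier ?C"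
    using s_closed C.scale_closed by blast
  show "\<phi> \<in> carrier ?C"
    unfolding \<phi> using vs by (rule C.finsum_closed)
  show "\<phi> x = (\<Oplus>a\<in>S. v a \<odot> p x a)" if x: "x \<in> X"
  proof -
    have "\<phi> x = (\<Oplus>a\<in>S. (v a \<odot>\<^bsub>?C\<^esub> s a) x)"
      unfolding \<phi> using X S vs x by (rule finsum_fun_tensor)
    also have "\<dots> = (\<Oplus>a\<in>S. v a \<odot> p x a)"
      using x p by (intro finsum_cong') (auto simp: s_apply)
    finally show ?thesis .
  qed
qed

text \<open>
  A C*-seminorm \<open>q\<close> that vanishes on \<open>p\<^sup>* p - p\<close> satisfies \<open>q(p)\<^sup>2 = q(p\<^sup>* p) \<le> q(p)\<close>, so \<open>q(p) \<le> 1\<close>.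
\<close>

lemma game_universal_cstar: "universal_cstar (I \<times> Out) (game_relators I Out lam)"
proof (rule universal_cstarI, intro exI[of _ 1] allI impI)
  fix g q assume g: "g \<in> I \<times> Out" and q: "cstar_seminorm (I \<times> Out) (game_relators I Out lam) q"
  then have p: "sp_gen g \<in> star_polys (I \<times> Out)"
    by simp
  have "sp_star (sp_gen g) * sp_gen g - sp_gen g \<in> game_relators I Out lam"
    using g by (auto simp: game_relators_def)
  then have "q (sp_star (sp_gen g) * sp_gen g - sp_gen g) = 0"
    using q by (simp add: cstar_seminorm_def)
  moreover have "q ((sp_star (sp_gen g) * sp_gen g - sp_gen g) + sp_gen g)
      \<le> q (sp_star (sp_gen g) * sp_gen g - sp_gen g) + q (sp_gen g)"
    using p by (intro cstar_seminormD(4)[OF q]) auto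
  ultimately have "(q (sp_gen g))\<^sup>2 \<le> q (sp_gen g)"
    using cstar_seminormD(2)[OF q p] by simp
  then show "q (sp_gen g) \<le> 1"
    using cstar_seminormD(1)[OF q p] by (cases "q (sp_gen g) = 0") (auto simp: power2_eq_square)
qed

theorem proposition2p4:
  fixes I :: "'i set" and Out :: "'o set" and lam :: "'o \<Rightarrow> 'o \<Rightarrow> 'i \<Rightarrow> 'i \<Rightarrow> nat"
    and B :: "'b cstar"
    and \<Psi> :: "('o \<Rightarrow> complex) \<Rightarrow> (('i \<Rightarrow> 'b) \<Rightarrow> 'i \<Rightarrow> 'b) \<times> (('i \<Rightarrow> 'b) \<Rightarrow> 'i \<Rightarrow> 'b)"
  assumes "synchronous_game I Out lam"
    and "cstar_algebra B"
    and "\<Psi> \<in> Mor (fun_alg Out) (fun_tensor I B)"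
    and "\<And>x y a b. \<lbrakk>x \<in> I; y \<in> I; a \<in> Out; b \<in> Out\<rbrakk> \<Longrightarrow>
      eval2 I B x y
        (leg13 I B (\<Psi> (unit_vec Out a))
           \<otimes>\<^bsub>multiplier_alg (fun_tensor I (fun_tensor I B))\<^esub> leg23 I B (\<Psi> (unit_vec Out b)))
      = of_nat (lam a b x y) \<odot>\<^bsub>multiplier_alg B\<^esub>
        eval2 I B x y
          (leg13 I B (\<Psi> (unit_vec Out a))
             \<otimes>\<^bsub>multiplier_alg (fun_tensor I (fun_tensor I B))\<^esub> leg23 I B (\<Psi> (unit_vec Out b)))"
  shows "\<exists>!\<Theta>. \<Theta> \<in> Mor (game_cstar I Out lam) B \<and>
    \<Psi> = mor_comp (fun_alg Out) (fun_tensor I (game_cstar I Out lam)) (fun_tensor I B)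
          (id_tensor I (game_cstar I Out lam) B \<Theta>) (game_mor I Out lam)"
proof -
  have I: "finite I" and Out: "finite Out"
    using assms(1) by (simp_all add: synchronous_game_def)
  let ?F = "fun_alg Out" and ?C = "fun_tensor I B" and ?M = "multiplier_alg B"
  define R where "R = game_relators I Out lam"
  define G where "G = game_cstar I Out lam"
  define p where "p = game_proj I Out lam"
  interpret B: cstar_algebra B
    by fact
  interpret C: cstar_algebra ?C
    using I by (rule B.cstar_algebra_fun_tensor)
  interpret M: cstar_algebra ?M
    by (rule B.cstar_algebra_multiplier)
  interpret \<C>: pre_cstar_algebra complex_cstar
    by (rule pre_cstar_algebra_complex)
  interpret F: pre_cstar_algebra ?F
    unfolding fun_alg_def using Out by (rule \<C>.pre_cstar_algebra_fun_tensor)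
  interpret U: universal_cstar "I \<times> Out" R
    unfolding R_def by (rule game_universal_cstar)
  have G_eq: "G = U.A" and p_eq: "p x a = univ_gen (I \<times> Out) R (x, a)" for x a
    by (simp_all add: G_def p_def R_def game_cstar_def game_proj_def)
  interpret G: cstar_algebra G
    unfolding G_eq by (rule U.cstar_algebra_A)
  have G_unital: "unital G"
    unfolding G_eq by (rule U.unital_A)
  then have G_one: "\<one>\<^bsub>G\<^esub> \<in> carrier G"
    unfolding unital_def by (rule conjunct1)
  have M_unital: "unital ?M"
    by (rule B.unital_multiplier)
  have unit: "unit_vec Out a \<in> carrier ?F" for a
    by (simp add: unit_vec_def fun_alg_def)

  have \<Psi>: "\<Psi> \<in> star_hom ?F (multiplier_alg ?C)"
    using assms(3) by (simp add: Mor_def)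
  have \<Psi>_one: "\<Psi> \<one>\<^bsub>?F\<^esub> = \<one>\<^bsub>multiplier_alg ?C\<^esub>"
    by (rule Mor_one[OF C.cstar_algebra_axioms unital_fun_alg assms(3)])
  define h where "h x = (\<lambda>v\<in>carrier ?F. fibre I B (\<Psi> v) x)" for x
  have h: "h x \<in> star_hom ?F ?M" if "x \<in> I" for x
  proof -
    have "(\<lambda>v\<in>carrier ?F. (\<lambda>m\<in>carrier (multiplier_alg ?C). fibre I B m x) (\<Psi> v)) = h x"
      unfolding h_def using star_homD(1)[OF \<Psi>] by (intro restrict_ext) simp
    then show ?thesis
      using star_hom_comp[OF \<Psi> B.fibre_star_hom[OF I that] F.pre_cstar_algebra_axioms] by simp
  qed
  \<comment> \<open>The only possible values of \<open>\<Theta>\<close> on the generators.\<close>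
  define P where "P x a = h x (unit_vec Out a)" for x a
  have P_eq: "P x a = fibre I B (\<Psi> (unit_vec Out a)) x" for x a
    by (simp add: P_def h_def unit)
  have P_closed: "P x a \<in> carrier ?M" if "x \<in> I" for x a
    unfolding P_def using star_homD(1)[OF h[OF that] unit] .
  have h_expand: "h x v = (\<Oplus>\<^bsub>?M\<^esub>a\<in>Out. v a \<odot>\<^bsub>?M\<^esub> P x a)" if "x \<in> I" "v \<in> carrier ?F" for x v
    unfolding P_def using star_hom_fun_alg_expand[OF Out M.pre_cstar_algebra_axioms h[OF that(1)] that(2)] .
  have P_projection: "star ?M (P x a) \<otimes>\<^bsub>?M\<^esub> P x a = P x a" if x: "x \<in> I" for x a
  proof -
    have "star ?F (unit_vec Out a) \<otimes>\<^bsub>?F\<^esub> unit_vec Out a = unit_vec Out a"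
      by (auto simp: unit_vec_def fun_alg_def intro!: restrict_ext)
    then show ?thesis
      unfolding P_def using star_homD(4,6)[OF h[OF x]] unit F.star_closed by metis
  qed
  have P_sum: "(\<Oplus>\<^bsub>?M\<^esub>a\<in>Out. P x a) = \<one>\<^bsub>?M\<^esub>" if x: "x \<in> I" for x
  proof -
    have one: "\<one>\<^bsub>?F\<^esub> \<in> carrier ?F"
      using unital_fun_alg unfolding unital_def by (rule conjunct1)
    have "(\<Oplus>\<^bsub>?M\<^esub>a\<in>Out. P x a) = (\<Oplus>\<^bsub>?M\<^esub>a\<in>Out. \<one>\<^bsub>?F\<^esub> a \<odot>\<^bsub>?M\<^esub> P x a)"
      using P_closed[OF x] by (intro M.finsum_cong') (auto simp: fun_alg_def M.scale_one)
    also have "\<dots> = h x \<one>\<^bsub>?F\<^esub>"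
      using h_expand[OF x one] ..
    also have "\<dots> = \<one>\<^bsub>?M\<^esub>"
      using B.fibre_one[OF I x] one by (simp only: h_def restrict_apply' \<Psi>_one)
    finally show ?thesis .
  qed
  have P_game: "P x a \<otimes>\<^bsub>?M\<^esub> P y b = of_nat (lam a b x y) \<odot>\<^bsub>?M\<^esub> (P x a \<otimes>\<^bsub>?M\<^esub> P y b)"
    if "x \<in> I" "y \<in> I" "a \<in> Out" "b \<in> Out" for x y a b
    using assms(4)[OF that] that
    by (simp only: B.eval2_legs[OF I star_homD(1)[OF \<Psi> unit] star_homD(1)[OF \<Psi> unit]] P_eq)

  \<comment> \<open>\<open>P x a\<close> is a multiplier only for \<open>x \<in> I\<close>, but evaluation wants a multiplier for every letter.\<close>
  define gen where "gen g = (if fst g \<in> I then P (fst g) (snd g) else \<zero>\<^bsub>?M\<^esub>)" for g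
  have gen_closed: "gen g \<in> carrier ?M" for g
    by (simp add: gen_def P_closed)
  note val = M.star_poly_val_add[OF M_unital gen_closed] M.star_poly_val_mult[OF M_unital gen_closed]
    M.star_poly_val_scale[OF M_unital gen_closed] M.star_poly_val_star[OF M_unital gen_closed]
    M.star_poly_val_diff[OF M_unital gen_closed] M.star_poly_val_gen[OF M_unital gen_closed]
    M.star_poly_val_one[OF M_unital gen_closed] M.star_poly_val_sum[OF M_unital gen_closed Out]
  have gen_P: "gen (x, a) = P x a" if "x \<in> I" for x a
    using that by (simp add: gen_def)
  have relators: "M.star_poly_val gen r = \<zero>\<^bsub>?M\<^esub>" if r: "r \<in> R" for r
  proof -
    consider (projection) x a where "x \<in> I" "r = sp_star (sp_gen (x, a)) * sp_gen (x, a) - sp_gen (x, a)"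
      | (sum) x where "x \<in> I" "r = (\<Sum>a\<in>Out. sp_gen (x, a)) - 1"
      | (game) x y a b where "x \<in> I" "y \<in> I" "a \<in> Out" "b \<in> Out"
          "r = sp_gen (x, a) * sp_gen (y, b) - sp_scale (of_nat (lam a b x y)) (sp_gen (x, a) * sp_gen (y, b))"
      using r unfolding R_def game_relators_def Let_def by blast
    then show ?thesis
    proof cases
      case projection
      then show ?thesis
        by (simp add: val gen_P P_projection P_closed)
    next
      case sum
      then show ?thesis
        using M.unital_one(1)[OF M_unital] by (simp add: val gen_P P_sum)
    next
      case game
      then show ?thesis
        using P_game[OF game(1-4)] by (simp add: val gen_P M.diff_eq_zero_iff P_closed)
    qed
  qed
  obtain \<Theta> where \<Theta>: "\<Theta> \<in> star_hom G ?M" "\<Theta> \<one>\<^bsub>G\<^esub> = \<one>\<^bsub>?M\<^esub>"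
      and \<Theta>_gen: "\<And>g. g \<in> I \<times> Out \<Longrightarrow> \<Theta> (univ_gen (I \<times> Out) R g) = gen g"
    using U.universal_property[OF M.cstar_algebra_axioms M_unital gen_closed relators] unfolding G_eq
    by blast

  have p_closed: "p x a \<in> carrier G" if "x \<in> I" "a \<in> Out" for x a
    unfolding p_eq G_eq univ_gen_def using that by (intro U.cl_closed U.U_const) simp
  define \<phi> where "\<phi> v = (\<Oplus>\<^bsub>fun_tensor I G\<^esub>a\<in>Out. v a \<odot>\<^bsub>fun_tensor I G\<^esub>
      (\<Oplus>\<^bsub>fun_tensor I G\<^esub>x\<in>I. tens I G (unit_vec I x) (p x a)))" for v
  have game_mor: "game_mor I Out lam = mor_of ?F (fun_tensor I G) \<phi>"
    unfolding game_mor_def Let_def \<phi>_def[abs_def] G_def p_def ..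
  have \<phi>_closed: "\<phi> v \<in> carrier (fun_tensor I G)" for v
    unfolding \<phi>_def by (rule G.finsum_tens(1)[OF I Out p_closed])
  have \<phi>_apply: "\<phi> v x = (\<Oplus>\<^bsub>G\<^esub>a\<in>Out. v a \<odot>\<^bsub>G\<^esub> p x a)" if "x \<in> I" for v x
    unfolding \<phi>_def by (rule G.finsum_tens(2)[OF I Out p_closed that])
  have \<phi>_unit: "\<phi> (unit_vec Out a) x = p x a" if "x \<in> I" "a \<in> Out" for x a
  proof -
    have "\<phi> (unit_vec Out a) x = (\<Oplus>\<^bsub>G\<^esub>b\<in>Out. if a = b then p x b else \<zero>\<^bsub>G\<^esub>)"
      unfolding \<phi>_apply[OF that(1)] using p_closed that
      by (intro G.finsum_cong') (auto simp: unit_vec_def G.scale_one)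
    also have "\<dots> = p x a"
      using that p_closed Out by (intro G.add.finprod_singleton) auto
    finally show ?thesis .
  qed
  have comp: "mor_comp ?F (fun_tensor I G) ?C (id_tensor I G B \<Theta>') (game_mor I Out lam) v
      = family I B (\<lambda>x. \<Theta>' (\<phi> v x))"
    if "\<Theta>' \<in> star_hom G ?M" "\<Theta>' \<one>\<^bsub>G\<^esub> = \<one>\<^bsub>?M\<^esub>" "v \<in> carrier ?F" for \<Theta>' v
    unfolding game_mor
    by (rule mor_comp_id_tensor[OF G.cstar_algebra_axioms G_unital B.cstar_algebra_axioms I that \<phi>_closed])
  \<comment> \<open>By linearity \<open>\<Theta>' \<circ> \<phi>\<close> depends only on the values of \<open>\<Theta>'\<close> on the generators.\<close>
  have hom_\<phi>: "\<Theta>' (\<phi> v x) = (\<Oplus>\<^bsub>?M\<^esub>a\<in>Out. v a \<odot>\<^bsub>?M\<^esub> \<Theta>' (p x a))"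
    if \<Theta>': "\<Theta>' \<in> star_hom G ?M" and x: "x \<in> I" for \<Theta>' v x
  proof -
    have "\<Theta>' (\<phi> v x) = (\<Oplus>\<^bsub>?M\<^esub>a\<in>Out. \<Theta>' (v a \<odot>\<^bsub>G\<^esub> p x a))"
      unfolding \<phi>_apply[OF x]
    proof (rule star_hom_finsum[OF G.abelian_group_axioms M.abelian_group_axioms \<Theta>' _ Out])
      show "\<Theta>' \<zero>\<^bsub>G\<^esub> = \<zero>\<^bsub>?M\<^esub>"
        by (rule star_hom_zero[OF G.pre_cstar_algebra_axioms M.pre_cstar_algebra_axioms \<Theta>'])
    qed (use p_closed[OF x] in auto)
    also have "\<dots> = (\<Oplus>\<^bsub>?M\<^esub>a\<in>Out. v a \<odot>\<^bsub>?M\<^esub> \<Theta>' (p x a))"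
      using p_closed[OF x] star_homD(1,5)[OF \<Theta>'] by (intro M.finsum_cong') auto
    finally show ?thesis .
  qed

  show ?thesis
    unfolding G_def[symmetric]
  proof (rule ex1I, rule conjI)
    show "\<Theta> \<in> Mor G B"
      by (rule MorI[OF B.cstar_algebra_axioms G_one \<Theta>])
    have \<Theta>_p: "\<Theta> (p x a) = P x a" if "x \<in> I" "a \<in> Out" for x a
      using \<Theta>_gen[of "(x, a)"] that by (simp add: p_eq gen_P)
    have "\<Psi> v = mor_comp ?F (fun_tensor I G) ?C (id_tensor I G B \<Theta>) (game_mor I Out lam) v"
      if v: "v \<in> carrier ?F" for v
    proof -
      have "\<Psi> v = family I B (fibre I B (\<Psi> v))"
        using B.family_fibre[OF I star_homD(1)[OF \<Psi> v]] ..
      also have "\<dots> = family I B (\<lambda>x. \<Theta> (\<phi> v x))"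
      proof (rule family_cong)
        fix x assume x: "x \<in> I"
        have "fibre I B (\<Psi> v) x = h x v"
          using v by (simp add: h_def)
        also have "\<dots> = (\<Oplus>\<^bsub>?M\<^esub>a\<in>Out. v a \<odot>\<^bsub>?M\<^esub> \<Theta> (p x a))"
          unfolding h_expand[OF x v] using P_closed[OF x] by (intro M.finsum_cong') (auto simp: \<Theta>_p x)
        finally show "fibre I B (\<Psi> v) x = \<Theta> (\<phi> v x)"
          using hom_\<phi>[OF \<Theta>(1) x] by simp
      qed
      finally show ?thesis
        using comp[OF \<Theta> v] by simp
    qed
    then show "\<Psi> = mor_comp ?F (fun_tensor I G) ?C (id_tensor I G B \<Theta>) (game_mor I Out lam)"
      using star_homD(2)[OF \<Psi>] by (intro extensionalityI[of _ "carrier ?F"]) (simp_all add: mor_comp_def)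
  next
    fix \<Theta>' assume "\<Theta>' \<in> Mor G B \<and>
      \<Psi> = mor_comp ?F (fun_tensor I G) ?C (id_tensor I G B \<Theta>') (game_mor I Out lam)"
    then have \<Theta>': "\<Theta>' \<in> Mor G B"
      and \<Psi>_eq: "\<Psi> = mor_comp ?F (fun_tensor I G) ?C (id_tensor I G B \<Theta>') (game_mor I Out lam)"
      by blast+
    have hom: "\<Theta>' \<in> star_hom G ?M"
      using \<Theta>' by (simp add: Mor_def)
    have one: "\<Theta>' \<one>\<^bsub>G\<^esub> = \<one>\<^bsub>?M\<^esub>"
      by (rule Mor_one[OF B.cstar_algebra_axioms G_unital \<Theta>'])
    have "\<Theta>' (p x a) = P x a" if x: "x \<in> I" and a: "a \<in> Out" for x a
    proof -
      have "\<Theta>' (\<phi> (unit_vec Out a) x) \<in> carrier ?M" if "x \<in> I" for x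
        using star_homD(1)[OF hom] \<phi>_closed[of "unit_vec Out a"] that by auto
      then have "fibre I B (family I B (\<lambda>x. \<Theta>' (\<phi> (unit_vec Out a) x))) x = \<Theta>' (\<phi> (unit_vec Out a) x)"
        by (rule B.fibre_family[OF I _ x])
      then show ?thesis
        using comp[OF hom one unit[of a]] \<Psi>_eq P_eq[of x a] by (simp add: \<phi>_unit[OF x a])
    qed
    then have "\<Theta>' (univ_gen (I \<times> Out) R g) = \<Theta> (univ_gen (I \<times> Out) R g)" if "g \<in> I \<times> Out" for g
      using \<Theta>_gen[OF that] that by (auto simp: p_eq gen_P)
    then show "\<Theta>' = \<Theta>"
      using U.hom_unique[OF M.cstar_algebra_axioms, of \<Theta>' \<Theta>] hom \<Theta> one unfolding G_eq by simp
  qed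
qed

end
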